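(* Let $\mathbb{F}_q$ be a finite field of characteristic greater than $3$. Let $\Psi$ be the set of ordered pairs $(\mathcal{A},\mathcal{B})$ of smooth plane conics defined over $\mathbb{F}_q$ that intersect transversally, and let $\Gamma_3\subset\Psi$ be the subset of pairs satisfying the Poncelet triangle condition. Then $$|\Gamma_3| = (q^5-q^2)(q+1)q(q-1)^2,$$ and therefore $$\frac{|\Gamma_3|}{|\Psi|}=\frac{q-1}{q^2-q+1}.$$
   Context: A plane conic over a field $k$ is a curve in $\mathbb{P}^2$ given by a nonzero homogeneous quadratic form over $k$ (up to scaling). Two conics intersect transversally if they meet in $4$ distinct points of $\mathbb{P}^2(\overline{k})$. Poncelet construction: for smooth conics $\mathcal{A},\mathcal{B}$ intersecting transversally, let $\mathcal{B}^*$ be the dual conic of $\mathcal{B}$ (the set of tangent lines to $\mathcal{B}$) and, working over $\overline{k}$, let $E=\{(P,\xi)\in\mathcal{A}\times\mathcal{B}^*: P\in\xi\}$. Define $j:E\to E$, $j(P,\xi)=(P',\xi')$, where $P'$ is the other intersection point of $\xi$ with $\mathcal{A}$ (intersections counted with multiplicity, so $P'=P$ if $\xi$ is tangent to $\mathcal{A}$), and $\xi'$ is the other tangent line to $\mathcal{B}$ through $P'$ ($\xi'=\xi$ if $P'\in\mathcal{B}$). The pair $(\mathcal{A},\mathcal{B})$ satisfies the Poncelet triangle condition if there is $(P,\xi)\in E$ (over $\overline{k}$) with $j^3(P,\xi)=(P,\xi)$. *)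

theory Defs
  imports "HOL-Analysis.Cartesian_Space" "HOL-Algebra.Algebraic_Closure_Type"
begin

text \<open>Formal Laurent series redefine \<open>fps_syntax\<close>, so the notation \<open>$\<close> for power series would still clash with
  that for vectors.\<close>

unbundle no Formal_Power_Series.fps_syntax

section \<open>Projective space over a field\<close>

definition proj_rel :: "'a::field ^ 'n::finite \<Rightarrow> 'a ^ 'n \<Rightarrow> bool" where
  "proj_rel v w \<longleftrightarrow> v \<noteq> 0 \<and> w \<noteq> 0 \<and> (\<exists>c. c \<noteq> 0 \<and> w = c *s v)"

lemma part_equivp_proj_rel: "part_equivp (proj_rel :: 'a::field ^ 'n::finite \<Rightarrow> _)"
proof (rule part_equivpI)
  show "\<exists>v :: 'a ^ 'n. proj_rel v v"
    by (rule exI[of _ "\<chi> i. 1"]) (auto simp: proj_rel_def vec_eq_iff intro: exI[of _ 1])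
  show "symp (proj_rel :: 'a ^ 'n \<Rightarrow> _)"
  proof (rule sympI)
    fix v w :: "'a ^ 'n"
    assume "proj_rel v w"
    then obtain c where c: "c \<noteq> 0" "w = c *s v" "v \<noteq> 0" "w \<noteq> 0"
      by (auto simp: proj_rel_def)
    then have "v = inverse c *s w"
      by (simp add: vector_smult_assoc)
    with c show "proj_rel w v"
      unfolding proj_rel_def by (intro conjI exI[of _ "inverse c"]) auto
  qed
  show "transp (proj_rel :: 'a ^ 'n \<Rightarrow> _)"
  proof (rule transpI)
    fix u v w :: "'a ^ 'n"
    assume "proj_rel u v" "proj_rel v w"
    then obtain c d where "c \<noteq> 0" "v = c *s u" "d \<noteq> 0" "w = d *s v" "u \<noteq> 0" "w \<noteq> 0"
      by (auto simp: proj_rel_def)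
    then show "proj_rel u w"
      unfolding proj_rel_def by (intro conjI exI[of _ "d * c"]) (auto simp: vector_smult_assoc)
  qed
qed

text \<open>The nonzero vectors up to scaling, so that \<open>('a, 'n) proj\<close> is the projective space of
  dimension \<open>CARD('n) - 1\<close>.\<close>

quotient_type (overloaded) ('a, 'n) proj = "'a::field ^ 'n::finite" / partial: proj_rel
  by (rule part_equivp_proj_rel)

type_synonym 'a point = "('a, 3) proj"

text \<open>A line is given by the coefficients of its equation.\<close>

type_synonym 'a line = "('a, 3) proj"

text \<open>A conic is given by the six coefficients of a quadratic form; see \<open>qform\<close> for their order.\<close>

type_synonym 'a conic = "('a, 6) proj"

lift_definition base_change :: "('a::field, 'n::finite) proj \<Rightarrow> ('a alg_closure, 'n) proj"
  is "\<lambda>v. \<chi> i. to_ac (v $ i)"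
proof -
  fix v w :: "'a ^ 'n"
  assume "proj_rel v w"
  then obtain c where c: "c \<noteq> 0" "w = c *s v" "v \<noteq> 0" "w \<noteq> 0"
    by (auto simp: proj_rel_def)
  then show "proj_rel (\<chi> i. to_ac (v $ i)) (\<chi> i. to_ac (w $ i))"
    unfolding proj_rel_def
    by (intro conjI exI[of _ "to_ac c"]) (auto simp: vec_eq_iff)
qed


section \<open>Conics\<close>

definition qform :: "'a::field ^ 6 \<Rightarrow> 'a ^ 3 \<Rightarrow> 'a" where
  "qform q v = q$1 * (v$1)^2 + q$2 * (v$2)^2 + q$3 * (v$3)^2
             + q$4 * (v$1 * v$2) + q$5 * (v$1 * v$3) + q$6 * (v$2 * v$3)"

text \<open>The three formal partial derivatives of \<open>qform q\<close>, at \<open>v\<close>.\<close>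

definition qgrad :: "'a::field ^ 6 \<Rightarrow> 'a ^ 3 \<Rightarrow> 'a ^ 3" where
  "qgrad q v = vector
     [2 * q$1 * v$1 + q$4 * v$2 + q$5 * v$3,
      q$4 * v$1 + 2 * q$2 * v$2 + q$6 * v$3,
      q$5 * v$1 + q$6 * v$2 + 2 * q$3 * v$3]"

lemma qform_scale: "qform (c *s q) (d *s v) = c * d^2 * qform q v"
  by (simp add: qform_def algebra_simps power2_eq_square)

lemma qgrad_scale: "qgrad (c *s q) (d *s v) = (c * d) *s qgrad q v"
  by (simp add: qgrad_def vec_eq_iff forall_3 algebra_simps)

lift_definition on_line :: "'a::field point \<Rightarrow> 'a line \<Rightarrow> bool"
  is "\<lambda>v l. l$1 * v$1 + l$2 * v$2 + l$3 * v$3 = 0"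
proof -
  fix v v' l l' :: "'a ^ 3"
  assume "proj_rel v v'" "proj_rel l l'"
  then obtain c d where cd: "c \<noteq> 0" "d \<noteq> 0" "v' = c *s v" "l' = d *s l"
    by (auto simp: proj_rel_def)
  have "l'$1 * v'$1 + l'$2 * v'$2 + l'$3 * v'$3 = (c * d) * (l$1 * v$1 + l$2 * v$2 + l$3 * v$3)"
    by (simp add: cd algebra_simps)
  then show "(l$1 * v$1 + l$2 * v$2 + l$3 * v$3 = 0) = (l'$1 * v'$1 + l'$2 * v'$2 + l'$3 * v'$3 = 0)"
    using cd by simp
qed

lift_definition on_conic :: "'a::field point \<Rightarrow> 'a conic \<Rightarrow> bool"
  is "\<lambda>v q. qform q v = 0"
  by (auto simp: proj_rel_def qform_scale)

lift_definition singular_at :: "'a::field conic \<Rightarrow> 'a point \<Rightarrow> bool"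
  is "\<lambda>q v. qform q v = 0 \<and> qgrad q v = 0"
  by (auto simp: proj_rel_def qform_scale qgrad_scale)

text \<open>The tangent line at a smooth point of a conic has the gradient as coefficient vector. There is
  no tangent line at a singular point, because the vector \<open>l\<close> representing a line is never \<open>0\<close>.\<close>

lift_definition tangent_at :: "'a::field conic \<Rightarrow> 'a point \<Rightarrow> 'a line \<Rightarrow> bool"
  is "\<lambda>q v l. qform q v = 0 \<and> (\<exists>c. c \<noteq> 0 \<and> qgrad q v = c *s l)"
proof -
  fix q q' :: "'a ^ 6" and v v' l l' :: "'a ^ 3"
  assume "proj_rel q q'" "proj_rel v v'" "proj_rel l l'"
  then obtain a b c where abc: "a \<noteq> 0" "b \<noteq> 0" "c \<noteq> 0"
      "q' = a *s q" "v' = b *s v" "l' = c *s l"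
    by (auto simp: proj_rel_def)
  have "(\<exists>d. d \<noteq> 0 \<and> qgrad q v = d *s l) = (\<exists>d. d \<noteq> 0 \<and> qgrad q' v' = d *s l')"
  proof
    assume "\<exists>d. d \<noteq> 0 \<and> qgrad q v = d *s l"
    then obtain d where "d \<noteq> 0" "qgrad q v = d *s l" by blast
    then show "\<exists>d. d \<noteq> 0 \<and> qgrad q' v' = d *s l'"
      using abc by (intro exI[of _ "a * b * d / c"]) (simp add: qgrad_scale vector_smult_assoc)
  next
    assume "\<exists>d. d \<noteq> 0 \<and> qgrad q' v' = d *s l'"
    then obtain d where d: "d \<noteq> 0" "(a * b) *s qgrad q v = (d * c) *s l"
      using abc by (auto simp: qgrad_scale vector_smult_assoc)
    have "qgrad q v = inverse (a * b) *s ((a * b) *s qgrad q v)"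
      using abc(1,2) left_inverse[of "a * b"]
      by (simp only: vector_smult_assoc vector_smult_lid mult_eq_0_iff) simp
    also have "\<dots> = (inverse (a * b) * (d * c)) *s l"
      by (simp only: d(2) vector_smult_assoc)
    finally show "\<exists>d. d \<noteq> 0 \<and> qgrad q v = d *s l"
      using abc d(1) by (intro exI[of _ "inverse (a * b) * (d * c)"]) auto
  qed
  then show "(qform q v = 0 \<and> (\<exists>d. d \<noteq> 0 \<and> qgrad q v = d *s l)) =
             (qform q' v' = 0 \<and> (\<exists>d. d \<noteq> 0 \<and> qgrad q' v' = d *s l'))"
    using abc by (simp add: qform_scale)
qed

definition conic_points :: "'a::field conic \<Rightarrow> 'a point set" where
  "conic_points C = {P. on_conic P C}"

definition dual_conic :: "'a::field conic \<Rightarrow> 'a line set" where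
  "dual_conic C = {\<xi>. \<exists>P. tangent_at C P \<xi>}"

definition smooth_conic :: "'a::field conic \<Rightarrow> bool" where
  "smooth_conic C \<longleftrightarrow> (\<forall>P. \<not> singular_at (base_change C) P)"

definition transversal :: "'a::field conic \<Rightarrow> 'a conic \<Rightarrow> bool" where
  "transversal A B \<longleftrightarrow> card (conic_points (base_change A) \<inter> conic_points (base_change B)) = 4"


section \<open>The Poncelet construction\<close>

text \<open>The descriptions below are proper for smooth conics over an algebraically closed field of
  characteristic other than 2, when \<open>P\<close> lies on both \<open>A\<close> and \<open>\<xi>\<close>, respectively \<open>\<xi>\<close> is a tangent
  line to \<open>B\<close> through \<open>P\<close>.\<close>

definition other_point :: "'a::field conic \<Rightarrow> 'a line \<Rightarrow> 'a point \<Rightarrow> 'a point" where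
  "other_point A \<xi> P =
     (if \<xi> \<in> dual_conic A then P
      else (THE P'. P' \<in> conic_points A \<and> on_line P' \<xi> \<and> P' \<noteq> P))"

definition other_tangent :: "'a::field conic \<Rightarrow> 'a point \<Rightarrow> 'a line \<Rightarrow> 'a line" where
  "other_tangent B P \<xi> =
     (if P \<in> conic_points B then \<xi>
      else (THE \<xi>'. \<xi>' \<in> dual_conic B \<and> on_line P \<xi>' \<and> \<xi>' \<noteq> \<xi>))"

definition poncelet_curve :: "'a::field conic \<Rightarrow> 'a conic \<Rightarrow> ('a point \<times> 'a line) set" where
  "poncelet_curve A B = {(P, \<xi>). P \<in> conic_points A \<and> \<xi> \<in> dual_conic B \<and> on_line P \<xi>}"

definition poncelet_map ::
  "'a::field conic \<Rightarrow> 'a conic \<Rightarrow> 'a point \<times> 'a line \<Rightarrow> 'a point \<times> 'a line" where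
  "poncelet_map A B = (\<lambda>(P, \<xi>).
     let P' = other_point A \<xi> P; \<xi>' = other_tangent B P' \<xi> in (P', \<xi>'))"

definition poncelet_triangle :: "'a::field conic \<Rightarrow> 'a conic \<Rightarrow> bool" where
  "poncelet_triangle A B \<longleftrightarrow>
     (\<exists>e \<in> poncelet_curve (base_change A) (base_change B).
        (poncelet_map (base_change A) (base_change B) ^^ 3) e = e)"

definition \<Psi> :: "('a::field conic \<times> 'a conic) set" where
  "\<Psi> = {(A, B). smooth_conic A \<and> smooth_conic B \<and> transversal A B}"

definition \<Gamma>\<^sub>3 :: "('a::field conic \<times> 'a conic) set" where
  "\<Gamma>\<^sub>3 = {(A, B) \<in> \<Psi>. poncelet_triangle A B}"

end

theory Submission
  imports Defs "HOL-Analysis.Determinants"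
begin

text \<open>
  Fix \<open>B\<close>. Over the finite field it can be brought to the form \<open>xz = y\<^sup>2\<close>, whose tangent lines are
  parametrised by the projective line. A point of the plane is an unordered pair of parameters (the two
  tangents through it), so \<open>A\<close> becomes a symmetric form \<open>F(x, y)\<close> of bidegree \<open>(2, 2)\<close>. A Poncelet
  polygon is a sequence of parameters in which the neighbours of \<open>x\<close> are the two roots of \<open>F(x, -)\<close>, and
  the map \<open>j\<close> is the shift of such sequences. If \<open>u\<close> and \<open>v\<close> are the neighbours of \<open>x\<close>, then \<open>F(u, v)\<close>
  is a multiple of \<open>T F(x, x)\<close> for a quadratic form \<open>T\<close> in the coefficients of \<open>A\<close>; so the triangle
  condition is \<open>T = 0\<close>.

  Restricting \<open>A\<close> to \<open>B\<close> gives a binary quartic with invariants \<open>I\<close> and \<open>J\<close>, and a further linear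
  coordinate \<open>e\<close> completes it to coordinates for \<open>A\<close>. Smoothness of \<open>A\<close> reads \<open>e\<^sup>3 - 3Ie + J \<noteq> 0\<close>,
  transversality reads \<open>4I\<^sup>3 \<noteq> J\<^sup>2\<close>, and \<open>T = 0\<close> reads \<open>e\<^sup>2 = 4I\<close>. Among the quartics with a multiple root,
  where \<open>I = r\<^sup>2\<close> and \<open>J = 2r\<^sup>3\<close>, both equations in \<open>e\<close> have two solutions if \<open>r \<noteq> 0\<close> and one if \<open>r = 0\<close>.
  Everything is thus reduced to counting the points of four explicit varieties.
\<close>

subsection \<open>Binary quartics\<close>

text \<open>The coordinate \<open>e\<close> comes from the pencil: adding
  \<open>t (xz - y^2)\<close> to the form of \<open>A\<close> keeps the quartic and shifts
  \<open>e\<close> by \<open>3t\<close>, so the determinant along the pencil becomes a cubic in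
  \<open>e\<close>, and this cubic is the resolvent of the quartic. The obstacle in the triangle
  criterion is that \<open>T F(x, x)\<close> also vanishes where \<open>F(x, x) = 0\<close>. In a
  closed triangle with \<open>T \<noteq> 0\<close> every parameter would be its own neighbour; all
  three would then coincide and the quartic would have a multiple root, against transversality. For
  the converse, the triangle starts at a parameter that avoids the finitely many roots of the
  quartic and their neighbours, which the algebraic closure provides. If \<open>A\<close> is
  singular and \<open>T = 0\<close>, the quartic has a multiple root. The transversal part of the
  hypersurface \<open>T = 0\<close> therefore consists of smooth conics, and its size is a
  difference of two counts. The hypersurface of quartics with a multiple root is counted with
  \<open>r\<close> as an additional unknown, which makes it explicitly parametrisable.\<close>

text \<open>The classical invariants of a binary quartic, normalised so that its resolvent cubic is
  \<open>x\<^sup>3 - 3Ix + J\<close>.\<close>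

definition invI :: "'a::comm_ring_1 \<Rightarrow> 'a \<Rightarrow> 'a \<Rightarrow> 'a \<Rightarrow> 'a \<Rightarrow> 'a" where
  "invI c0 c1 c2 c3 c4 = 12 * c0 * c4 - 3 * c1 * c3 + c2^2"

definition invJ :: "'a::comm_ring_1 \<Rightarrow> 'a \<Rightarrow> 'a \<Rightarrow> 'a \<Rightarrow> 'a \<Rightarrow> 'a" where
  "invJ c0 c1 c2 c3 c4 =
     72 * c0 * c2 * c4 + 9 * c1 * c2 * c3 - 27 * c0 * c3^2 - 27 * c1^2 * c4 - 2 * c2^3"

definition disc4 :: "'a::comm_ring_1 \<Rightarrow> 'a \<Rightarrow> 'a \<Rightarrow> 'a \<Rightarrow> 'a \<Rightarrow> 'a" where
  "disc4 c0 c1 c2 c3 c4 = 4 * invI c0 c1 c2 c3 c4 ^ 3 - invJ c0 c1 c2 c3 c4 ^ 2"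

lemma invI_shear:
  "invI c0 (c1 + 4*w*c0) (c2 + 3*w*c1 + 6*w^2*c0) (c3 + 2*w*c2 + 3*w^2*c1 + 4*w^3*c0)
     (c4 + w*c3 + w^2*c2 + w^3*c1 + w^4*c0) = invI c0 c1 c2 c3 c4"
  unfolding invI_def
  by (simp add: algebra_simps power2_eq_square power3_eq_cube power4_eq_xxxx)

lemma invJ_shear:
  "invJ c0 (c1 + 4*w*c0) (c2 + 3*w*c1 + 6*w^2*c0) (c3 + 2*w*c2 + 3*w^2*c1 + 4*w^3*c0)
     (c4 + w*c3 + w^2*c2 + w^3*c1 + w^4*c0) = invJ c0 c1 c2 c3 c4"
  unfolding invJ_def
  by (simp add: algebra_simps power2_eq_square power3_eq_cube power4_eq_xxxx)

text \<open>The bracket of two homogeneous coordinate pairs. For nonzero pairs it vanishes exactly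
  when they give the same point of the projective line, and it replaces equality of parameters
  throughout.\<close>

definition br :: "'a::comm_ring_1 \<times> 'a \<Rightarrow> 'a \<times> 'a \<Rightarrow> 'a" where
  "br x y = fst x * snd y - fst y * snd x"

lemma br_self [simp]: "br x x = 0"
  by (simp add: br_def)

lemma br_commute: "br y x = - br x y"
  by (simp add: br_def algebra_simps)

lemma br_commute_0: "br y x = 0 \<longleftrightarrow> br x y = 0"
  by (simp add: br_commute[of y x])

lemma br_eq_0D:
  fixes x y :: "'a::field \<times> 'a"
  assumes "br x y = 0" "x \<noteq> 0" "y \<noteq> 0"
  obtains c where "c \<noteq> 0" "y = (c * fst x, c * snd x)"
proof (cases "fst x = 0")
  case True
  then have sx: "snd x \<noteq> 0" using assms(2) by (auto simp: prod_eq_iff)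
  then have fy: "fst y = 0" using assms(1) True by (simp add: br_def)
  then have "snd y \<noteq> 0" using assms(3) by (auto simp: prod_eq_iff)
  then show ?thesis
    using that[of "snd y / snd x"] sx fy True by (auto simp: prod_eq_iff)
next
  case False
  have eq: "fst x * snd y = fst y * snd x" using assms(1) by (simp add: br_def)
  have "fst y \<noteq> 0"
  proof
    assume "fst y = 0"
    with eq False have "snd y = 0" by simp
    with \<open>fst y = 0\<close> assms(3) show False by (auto simp: prod_eq_iff)
  qed
  then show ?thesis
    using that[of "fst y / fst x"] False eq by (auto simp: prod_eq_iff field_simps)
qed

lemma br_eq_0_trans:
  fixes x y z :: "'a::field \<times> 'a"
  assumes "br x y = 0" "br y z = 0" "y \<noteq> 0"
  shows "br x z = 0"
proof (cases "x = 0 \<or> z = 0")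
  case True
  then show ?thesis by (auto simp: br_def)
next
  case False
  with assms obtain c where "y = (c * fst x, c * snd x)" "c \<noteq> 0"
    by (metis br_eq_0D)
  moreover from False assms obtain d where "z = (d * fst y, d * snd y)" "d \<noteq> 0"
    by (metis br_eq_0D)
  ultimately show ?thesis by (simp add: br_def)
qed

section \<open>Factorisation and discriminant of a quartic\<close>

definition bquart :: "'a::comm_ring_1 \<Rightarrow> 'a \<Rightarrow> 'a \<Rightarrow> 'a \<Rightarrow> 'a \<Rightarrow> 'a \<times> 'a \<Rightarrow> 'a" where
  "bquart c0 c1 c2 c3 c4 x = c0 * fst x^4 + c1 * (fst x^3 * snd x) + c2 * (fst x^2 * snd x^2)
     + c3 * (fst x * snd x^3) + c4 * snd x^4"

text \<open>The coefficients are those of the product of the brackets with \<open>(a1, b1)\<close>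
  to \<open>(a4, b4)\<close>. With \<open>w = - u - v\<close>, the roots of the resolvent cubic are
  the differences \<open>v - u\<close>, \<open>w - v\<close> and \<open>u - w\<close>, which
  explains both formulas.\<close>

lemma inv_quartic_roots:
  fixes a1 a2 a3 a4 b1 b2 b3 b4 c0 c1 c2 c3 c4 u v :: "'a::field"
  assumes c: "c0 = b1*b2*b3*b4" "c4 = a1*a2*a3*a4"
    "c1 = -(a1*b2*b3*b4 + b1*a2*b3*b4 + b1*b2*a3*b4 + b1*b2*b3*a4)"
    "c3 = -(b1*a2*a3*a4 + a1*b2*a3*a4 + a1*a2*b3*a4 + a1*a2*a3*b4)"
    "c2 = a1*a2*b3*b4 + a1*a3*b2*b4 + a1*a4*b2*b3 + a2*a3*b1*b4 + a2*a4*b1*b3 + a3*a4*b1*b2"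
    and uv: "u = (a1*b2 - a2*b1) * (a3*b4 - a4*b3)" "v = (a1*b3 - a3*b1) * (a4*b2 - a2*b4)"
  shows "invI c0 c1 c2 c3 c4 = u^2 + u * v + v^2"
    and "invJ c0 c1 c2 c3 c4 = - ((u - v) * (2 * u + v) * (u + 2 * v))"
proof -
  show "invI c0 c1 c2 c3 c4 = u^2 + u * v + v^2"
    unfolding assms invI_def by (simp add: algebra_simps power2_eq_square)
  show "invJ c0 c1 c2 c3 c4 = - ((u - v) * (2 * u + v) * (u + 2 * v))"
    unfolding c uv invJ_def by (simp add: algebra_simps power2_eq_square power3_eq_cube)
qed

lemma inv_scale:
  "invI (k*c0) (k*c1) (k*c2) (k*c3) (k*c4) = k^2 * invI c0 c1 c2 c3 c4"
  "invJ (k*c0) (k*c1) (k*c2) (k*c3) (k*c4) = k^3 * invJ c0 c1 c2 c3 c4"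
  unfolding invI_def invJ_def by (simp_all add: algebra_simps power2_eq_square power3_eq_cube)

lemma disc4_scale:
  "disc4 (k*c0) (k*c1) (k*c2) (k*c3) (k*c4) = k^6 * disc4 c0 c1 c2 c3 c4"
proof -
  have "(k^2)^3 = k^6" "(k^3)^2 = k^6" by (simp_all flip: power_mult)
  then show ?thesis
    by (simp add: disc4_def inv_scale power_mult_distrib right_diff_distrib)
qed

text \<open>The discriminant of \<open>x^3 - 3Ix + J\<close> is \<open>27 (4 I^3 - J^2)\<close>, and
  its roots differ by \<open>3u\<close>, \<open>3v\<close> and \<open>3(u + v)\<close> up to sign;
  this is the origin of the 27.\<close>

lemma disc4_resolvent:
  fixes u v :: "'a::comm_ring_1"
  shows "4 * (u^2 + u * v + v^2)^3 - (- ((u - v) * (2 * u + v) * (u + 2 * v)))^2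
     = 27 * (u * v * (u + v))^2"
  by (simp add: algebra_simps power2_eq_square power3_eq_cube)

lemma alg_closed_quartic_root:
  fixes c0 c1 c2 c3 c4 :: "'a::alg_closed_field"
  assumes "\<not> (c0 = 0 \<and> c1 = 0 \<and> c2 = 0 \<and> c3 = 0)"
  shows "\<exists>x. c4 + x * (c3 + x * (c2 + x * (c1 + x * c0))) = 0"
proof -
  have "degree [:c4, c3, c2, c1, c0:] > 0" using assms by auto
  from alg_closed_imp_poly_has_root[OF this] show ?thesis by simp
qed

text \<open>The root \<open>a / b\<close> may be the point at infinity, when \<open>b = 0\<close>.\<close>

lemma quartic_split:
  fixes c0 c1 c2 c3 c4 :: "'a::alg_closed_field"
  shows "\<exists>a b d0 d1 d2 d3. (a, b) \<noteq> (0, 0) \<and> c0 = b * d0 \<and> c1 = b * d1 - a * d0 \<and>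
     c2 = b * d2 - a * d1 \<and> c3 = b * d3 - a * d2 \<and> c4 = - (a * d3)"
proof (cases "c0 = 0")
  case True
  then show ?thesis by (intro exI[of _ "-1"] exI[of _ 0] exI[of _ c1] exI[of _ c2] exI[of _ c3] exI[of _ c4]) auto
next
  case False
  then obtain r where "c4 + r * (c3 + r * (c2 + r * (c1 + r * c0))) = 0"
    using alg_closed_quartic_root by blast
  then show ?thesis
    by (intro exI[of _ r] exI[of _ 1] exI[of _ c0] exI[of _ "c1 + r * c0"]
        exI[of _ "c2 + r * (c1 + r * c0)"] exI[of _ "c3 + r * (c2 + r * (c1 + r * c0))"])
      (auto simp: eq_neg_iff_add_eq_0)
qed

lemma cubic_split:
  fixes c1 c2 c3 c4 :: "'a::alg_closed_field"
  shows "\<exists>a b d1 d2 d3. (a, b) \<noteq> (0, 0) \<and> c1 = b * d1 \<and>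
     c2 = b * d2 - a * d1 \<and> c3 = b * d3 - a * d2 \<and> c4 = - (a * d3)"
proof (cases "c1 = 0")
  case True
  then show ?thesis by (intro exI[of _ "-1"] exI[of _ 0] exI[of _ c2] exI[of _ c3] exI[of _ c4]) auto
next
  case False
  then obtain r where "c4 + r * (c3 + r * (c2 + r * (c1 + r * 0))) = 0"
    using alg_closed_quartic_root by blast
  then show ?thesis
    by (intro exI[of _ r] exI[of _ 1] exI[of _ c1] exI[of _ "c2 + r * c1"]
        exI[of _ "c3 + r * (c2 + r * c1)"])
      (auto simp: eq_neg_iff_add_eq_0)
qed

lemma quadratic_split:
  fixes c2 c3 c4 :: "'a::alg_closed_field"
  shows "\<exists>a b d2 d3. (a, b) \<noteq> (0, 0) \<and> c2 = b * d2 \<and> c3 = b * d3 - a * d2 \<and> c4 = - (a * d3)"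
proof (cases "c2 = 0")
  case True
  then show ?thesis by (intro exI[of _ "-1"] exI[of _ 0] exI[of _ c3] exI[of _ c4]) auto
next
  case False
  then obtain r where "c4 + r * (c3 + r * (c2 + r * (0 + r * 0))) = 0"
    using alg_closed_quartic_root by blast
  then show ?thesis
    by (intro exI[of _ r] exI[of _ 1] exI[of _ c2] exI[of _ "c3 + r * c2"])
      (auto simp: eq_neg_iff_add_eq_0)
qed

lemma linear_split:
  fixes c3 c4 :: "'a::field"
  shows "\<exists>a b d. (a, b) \<noteq> (0, 0) \<and> c3 = b * d \<and> c4 = - (a * d)"
proof (cases "c3 = 0 \<and> c4 = 0")
  case True
  then show ?thesis by (intro exI[of _ 1] exI[of _ 1] exI[of _ 0]) auto
next
  case False
  then show ?thesis by (intro exI[of _ "- c4"] exI[of _ c3] exI[of _ 1]) auto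
qed

text \<open>Linear factors are peeled off one at a time. A vanishing leading coefficient gives a
  root at infinity, and the zero quartic is covered by \<open>k = 0\<close>.\<close>

lemma bquart_factor:
  fixes c0 c1 c2 c3 c4 :: "'a::alg_closed_field"
  obtains k z1 z2 z3 z4 where
    "z1 \<noteq> 0" "z2 \<noteq> 0" "z3 \<noteq> 0" "z4 \<noteq> 0"
    "\<And>x. bquart c0 c1 c2 c3 c4 x = k * (br x z1 * br x z2 * br x z3 * br x z4)"
    "disc4 c0 c1 c2 c3 c4 =
       27 * (k^3 * (br z1 z2 * br z3 z4 * br z1 z3 * br z4 z2 * br z1 z4 * br z2 z3))^2"
proof -
  obtain a1 b1 d0 d1 d2 d3 where 1: "(a1, b1) \<noteq> (0, 0)" "c0 = b1 * d0" "c1 = b1 * d1 - a1 * d0"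
     "c2 = b1 * d2 - a1 * d1" "c3 = b1 * d3 - a1 * d2" "c4 = - (a1 * d3)"
    using quartic_split by metis
  obtain a2 b2 e1 e2 e3 where 2: "(a2, b2) \<noteq> (0, 0)" "d0 = b2 * e1"
     "d1 = b2 * e2 - a2 * e1" "d2 = b2 * e3 - a2 * e2" "d3 = - (a2 * e3)"
    using cubic_split by metis
  obtain a3 b3 f2 f3 where 3: "(a3, b3) \<noteq> (0, 0)" "e1 = b3 * f2"
     "e2 = b3 * f3 - a3 * f2" "e3 = - (a3 * f3)"
    using quadratic_split by metis
  obtain a4 b4 k where 4: "(a4, b4) \<noteq> (0, 0)" "f2 = b4 * k" "f3 = - (a4 * k)"
    using linear_split by metis
  define u v where uv: "u = (a1*b2 - a2*b1) * (a3*b4 - a4*b3)"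
     "v = (a1*b3 - a3*b1) * (a4*b2 - a2*b4)"
  define g0 g4 g1 g3 g2 where g:
     "g0 = b1*b2*b3*b4" "g4 = a1*a2*a3*a4"
    "g1 = -(a1*b2*b3*b4 + b1*a2*b3*b4 + b1*b2*a3*b4 + b1*b2*b3*a4)"
    "g3 = -(b1*a2*a3*a4 + a1*b2*a3*a4 + a1*a2*b3*a4 + a1*a2*a3*b4)"
    "g2 = a1*a2*b3*b4 + a1*a3*b2*b4 + a1*a4*b2*b3 + a2*a3*b1*b4 + a2*a4*b1*b3 + a3*a4*b1*b2"
  have c: "c0 = k * g0" "c1 = k * g1" "c2 = k * g2" "c3 = k * g3" "c4 = k * g4"
    unfolding g 1(2-) 2(2-) 3(2-) 4(2-) by (simp_all add: algebra_simps)
  have "disc4 g0 g1 g2 g3 g4 = 27 * (u * v * (u + v))^2"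
    unfolding disc4_def inv_quartic_roots[OF g uv] by (rule disc4_resolvent)
  \<comment> \<open>The Pluecker relation turns \<open>u + v\<close> into the third product of two
    brackets, so that all six pairs of roots occur.\<close>
  moreover have "u + v = - ((a1*b4 - a4*b1) * (a2*b3 - a3*b2))"
    unfolding uv by (simp add: algebra_simps)
  ultimately have "disc4 g0 g1 g2 g3 g4 = 27 * (u * v * ((a1*b4 - a4*b1) * (a2*b3 - a3*b2)))^2"
    by (simp add: power2_eq_square)
  then have "disc4 c0 c1 c2 c3 c4 = k^6 * (27 * (u * v * ((a1*b4 - a4*b1) * (a2*b3 - a3*b2)))^2)"
    unfolding c disc4_scale by simp
  also have "k^6 = (k^3)^2" by (simp flip: power_mult)
  also have "(k^3)^2 * (27 * (u * v * ((a1*b4 - a4*b1) * (a2*b3 - a3*b2)))^2) =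
     27 * (k^3 * (u * v * ((a1*b4 - a4*b1) * (a2*b3 - a3*b2))))^2"
    by (simp add: power_mult_distrib)
  also have "u * v * ((a1*b4 - a4*b1) * (a2*b3 - a3*b2)) =
     br (a1,b1) (a2,b2) * br (a3,b3) (a4,b4) * br (a1,b1) (a3,b3) * br (a4,b4) (a2,b2)
       * br (a1,b1) (a4,b4) * br (a2,b2) (a3,b3)"
    by (simp add: uv br_def mult.assoc)
  finally have "disc4 c0 c1 c2 c3 c4 = 27 * (k^3 * (br (a1,b1) (a2,b2) * br (a3,b3) (a4,b4) *
      br (a1,b1) (a3,b3) * br (a4,b4) (a2,b2) * br (a1,b1) (a4,b4) * br (a2,b2) (a3,b3)))^2" .
  moreover have "bquart c0 c1 c2 c3 c4 x =
      k * (br x (a1,b1) * br x (a2,b2) * br x (a3,b3) * br x (a4,b4))" for x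
    unfolding c g br_def bquart_def
    by (simp add: algebra_simps power2_eq_square power3_eq_cube power4_eq_xxxx)
  ultimately show ?thesis
    using 1(1) 2(1) 3(1) 4(1) that[of "(a1,b1)" "(a2,b2)" "(a3,b3)" "(a4,b4)" k]
    by (simp add: zero_prod_def)
qed

text \<open>A shear moves the double root to \<open>(0, 1)\<close>, where the last two coefficients vanish.\<close>

lemma disc4_double_root:
  fixes c0 c1 c2 c3 c4 s t :: "'a::field"
  assumes "(s, t) \<noteq> (0, 0)"
    and s: "4 * c0 * s^3 + 3 * c1 * s^2 * t + 2 * c2 * s * t^2 + c3 * t^3 = 0"
    and t: "c1 * s^3 + 2 * c2 * s^2 * t + 3 * c3 * s * t^2 + 4 * c4 * t^3 = 0"
    and two: "(2::'a) \<noteq> 0"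
  shows "disc4 c0 c1 c2 c3 c4 = 0"
proof (cases "t = 0")
  case True
  have "(4::'a) = 2 * 2" by simp
  then have "(4::'a) \<noteq> 0" using two by (metis mult_eq_0_iff)
  with True assms have "c0 = 0" "c1 = 0" by auto
  then show ?thesis
    by (simp add: disc4_def invI_def invJ_def power_mult_distrib flip: power_mult)
next
  case False
  define w where "w = s / t"
  have sw: "s = w * t" using False by (simp add: w_def)
  have four: "(4::'a) \<noteq> 0"
  proof -
    have "(4::'a) = 2 * 2" by simp
    then show ?thesis using two by (metis mult_eq_0_iff)
  qed
  have "t^3 * (c3 + 2*w*c2 + 3*w^2*c1 + 4*w^3*c0) = 0"
    using s unfolding sw by (simp add: algebra_simps power2_eq_square power3_eq_cube)
  then have c3: "c3 + 2*w*c2 + 3*w^2*c1 + 4*w^3*c0 = 0" using False by simp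
  have "t^3 * (c1 * w^3 + 2*c2*w^2 + 3*c3*w + 4*c4) = 0"
    using t unfolding sw by (simp add: algebra_simps power2_eq_square power3_eq_cube)
  then have "c1 * w^3 + 2*c2*w^2 + 3*c3*w + 4*c4 = 0" using False by simp
  moreover have "4 * (c4 + w*c3 + w^2*c2 + w^3*c1 + w^4*c0) =
     w * (c3 + 2*w*c2 + 3*w^2*c1 + 4*w^3*c0) + (c1 * w^3 + 2*c2*w^2 + 3*c3*w + 4*c4)"
    by (simp add: algebra_simps power2_eq_square power3_eq_cube power4_eq_xxxx)
  ultimately have "4 * (c4 + w*c3 + w^2*c2 + w^3*c1 + w^4*c0) = 0"
    using c3 by (simp only: mult_zero_right add_0)
  then have c4: "c4 + w*c3 + w^2*c2 + w^3*c1 + w^4*c0 = 0"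
    using four by (simp only: mult_eq_0_iff) blast
  have "disc4 c0 c1 c2 c3 c4 = disc4 c0 (c1 + 4*w*c0) (c2 + 3*w*c1 + 6*w^2*c0) 0 0"
    unfolding disc4_def invI_shear[of c0 c1 w c2 c3 c4, symmetric]
      invJ_shear[of c0 c1 w c2 c3 c4, symmetric] c3 c4 by simp
  also have "\<dots> = 0"
    by (simp add: disc4_def invI_def invJ_def power_mult_distrib flip: power_mult)
  finally show ?thesis .
qed

text \<open>Over a finite field the product of all \<open>X - a\<close>, plus 1, would be a
  nonconstant polynomial without a root.\<close>

lemma infinite_alg_closed: "infinite (UNIV :: 'a::alg_closed_field set)"
proof
  assume fin: "finite (UNIV :: 'a set)"
  define p where "p = (\<Prod>a\<in>(UNIV :: 'a set). [:-a, 1:]) + 1"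
  have "degree (\<Prod>a\<in>(UNIV :: 'a set). [:-a, 1:]) = card (UNIV :: 'a set)"
    by (subst degree_prod_eq_sum_degree) auto
  then have "degree p = card (UNIV :: 'a set)"
    using fin unfolding p_def by (subst degree_add_eq_left) (auto simp: card_gt_0_iff)
  then have "degree p > 0" using fin by (simp add: card_gt_0_iff)
  then obtain x where "poly p x = 0" using alg_closed_imp_poly_has_root by blast
  moreover have "poly (\<Prod>a\<in>(UNIV :: 'a set). [:-a, 1:]) x = 0"
    using fin by (auto simp: poly_prod intro!: prod_zero bexI[of _ x])
  ultimately show False by (simp add: p_def)
qed

subsection \<open>Projective points and quadratic forms\<close>

lemma proj_rel_refl_iff [simp]: "proj_rel v v \<longleftrightarrow> v \<noteq> 0"
  unfolding proj_rel_def by (metis vector_smult_lid one_neq_zero)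

lemma abs_proj_eq_iff:
  assumes "v \<noteq> 0" "w \<noteq> 0"
  shows "abs_proj v = abs_proj w \<longleftrightarrow> (\<exists>c. c \<noteq> 0 \<and> w = c *s v)"
  using Quotient_rel[OF Quotient_proj, of v w] assms by (simp add: proj_rel_def)

lemma abs_proj_scale:
  assumes "c \<noteq> 0" "c *s v \<noteq> 0"
  shows "abs_proj (c *s v) = abs_proj v"
proof -
  have "v \<noteq> 0" using assms(2) by auto
  then show ?thesis using abs_proj_eq_iff[of v "c *s v"] assms by auto
qed

lemma proj_cases [case_names abs, cases type: proj]:
  obtains v where "v \<noteq> 0" "P = abs_proj v"
  using that[of "rep_proj P"] Quotient_rep_reflp[OF Quotient_proj, of P]
    Quotient_abs_rep[OF Quotient_proj, of P] by simp

lemma exhaust_6: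
  fixes x :: 6
  shows "x = 1 \<or> x = 2 \<or> x = 3 \<or> x = 4 \<or> x = 5 \<or> x = 6"
proof (induct x)
  case (of_int z)
  then have "0 \<le> z" and "z < 6" by simp_all
  then have "z = 0 \<or> z = 1 \<or> z = 2 \<or> z = 3 \<or> z = 4 \<or> z = 5" by arith
  then show ?case by auto
qed

lemma forall_6: "(\<forall>i::6. P i) \<longleftrightarrow> P 1 \<and> P 2 \<and> P 3 \<and> P 4 \<and> P 5 \<and> P 6"
  by (metis exhaust_6)

definition vec6 :: "'a \<Rightarrow> 'a \<Rightarrow> 'a \<Rightarrow> 'a \<Rightarrow> 'a \<Rightarrow> 'a \<Rightarrow> 'a ^ 6" where
  "vec6 a1 a2 a3 a4 a5 a6 = (\<chi> i. if i = 1 then a1 else if i = 2 then a2 else if i = 3 then a3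
     else if i = 4 then a4 else if i = 5 then a5 else a6)"

lemma vec6_nth [simp]:
  "vec6 a1 a2 a3 a4 a5 a6 $ 1 = a1" "vec6 a1 a2 a3 a4 a5 a6 $ 2 = a2"
  "vec6 a1 a2 a3 a4 a5 a6 $ 3 = a3" "vec6 a1 a2 a3 a4 a5 a6 $ 4 = a4"
  "vec6 a1 a2 a3 a4 a5 a6 $ 5 = a5" "vec6 a1 a2 a3 a4 a5 a6 $ 6 = a6"
  by (simp_all add: vec6_def)

section \<open>Polar forms and linear substitutions\<close>

definition dot3 :: "'a::comm_ring_1 ^ 3 \<Rightarrow> 'a ^ 3 \<Rightarrow> 'a" where
  "dot3 l v = l$1 * v$1 + l$2 * v$2 + l$3 * v$3"

lemma dot3_add: "dot3 l (v + w) = dot3 l v + dot3 l w" "dot3 (l + m) v = dot3 l v + dot3 m v"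
  by (simp_all add: dot3_def algebra_simps)

lemma dot3_scale [simp]: "dot3 l (c *s v) = c * dot3 l v" "dot3 (c *s l) v = c * dot3 l v"
  by (simp_all add: dot3_def algebra_simps)

lemma dot3_transpose: "dot3 (transpose M *v l) w = dot3 l (M *v w)"
  by (simp add: dot3_def matrix_vector_mult_def transpose_def sum_3 algebra_simps)

lemma dot3_eqI:
  assumes "\<And>v. dot3 l v = dot3 m v"
  shows "l = m"
  using assms[of "axis 1 1"] assms[of "axis 2 1"] assms[of "axis 3 1"]
  by (simp add: dot3_def vec_eq_iff forall_3 axis_def)

lemma qform_polar: "qform a (v + w) = qform a v + qform a w + dot3 (qgrad a v) w"
  by (simp add: qform_def qgrad_def dot3_def algebra_simps power2_eq_square)

lemma qgrad_add: "qgrad a (v + w) = qgrad a v + qgrad a w"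
  by (simp add: qgrad_def vec_eq_iff forall_3 algebra_simps)

lemma qgrad_scale': "qgrad a (c *s v) = c *s qgrad a v"
  using qgrad_scale[of 1 a c v] by simp

lemma qform_scale': "qform a (c *s v) = c^2 * qform a v"
  using qform_scale[of 1 a c v] by simp

lemma qgrad_euler: "dot3 (qgrad a v) v = 2 * qform a v"
  by (simp add: qform_def qgrad_def dot3_def algebra_simps power2_eq_square)

text \<open>The pullback of a quadratic form along \<open>G\<close>: square coefficients are its
  values at the columns, mixed ones its polar values at two columns. No division by 2
  occurs.\<close>

definition conic_subst :: "'a::field ^ 6 \<Rightarrow> 'a ^ 3 ^ 3 \<Rightarrow> 'a ^ 6" where
  "conic_subst a G = vec6
     (qform a (column 1 G)) (qform a (column 2 G)) (qform a (column 3 G))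
     (dot3 (qgrad a (column 1 G)) (column 2 G)) (dot3 (qgrad a (column 1 G)) (column 3 G))
     (dot3 (qgrad a (column 2 G)) (column 3 G))"

lemma qform_conic_subst: "qform (conic_subst a G) v = qform a (G *v v)"
proof -
  have "G *v v = v$1 *s column 1 G + v$2 *s column 2 G + v$3 *s column 3 G"
    by (simp add: vec_eq_iff matrix_vector_mult_def column_def sum_3 algebra_simps)
  then show ?thesis
    by (simp add: qform_polar qgrad_add qgrad_scale' dot3_add qform_scale' algebra_simps)
      (simp add: conic_subst_def qform_def[of "vec6 _ _ _ _ _ _"] algebra_simps)
qed

lemma qgrad_conic_subst: "qgrad (conic_subst a G) v = transpose G *v qgrad a (G *v v)"
proof (rule dot3_eqI)
  fix w
  have "qform (conic_subst a G) (v + w) = qform a (G *v v + G *v w)"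
    by (simp add: qform_conic_subst matrix_vector_right_distrib)
  then show "dot3 (qgrad (conic_subst a G) v) w = dot3 (transpose G *v qgrad a (G *v v)) w"
    by (simp add: qform_polar qform_conic_subst dot3_transpose del: transpose_matrix_vector)
qed

lemma qform_inject:
  assumes "\<And>v. qform a v = qform b v"
  shows "a = b"
proof -
  have 1: "a$1 = b$1" "a$2 = b$2" "a$3 = b$3"
    using assms[of "vector [1,0,0]"] assms[of "vector [0,1,0]"] assms[of "vector [0,0,1]"]
    by (simp_all add: qform_def)
  have "a$4 = b$4" "a$5 = b$5" "a$6 = b$6"
    using assms[of "vector [1,1,0]"] assms[of "vector [1,0,1]"] assms[of "vector [0,1,1]"] 1
    by (simp_all add: qform_def)
  with 1 show ?thesis by (simp add: vec_eq_iff forall_6)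
qed

lemma conic_subst_assoc: "conic_subst (conic_subst a G) H = conic_subst a (G ** H)"
  by (rule qform_inject) (simp add: qform_conic_subst matrix_vector_mul_assoc)

lemma conic_subst_mat_1 [simp]: "conic_subst a (mat 1) = a"
  by (rule qform_inject) (simp add: qform_conic_subst)

lemma qform_0 [simp]: "qform 0 v = 0"
  by (simp add: qform_def)

lemma conic_subst_0 [simp]: "conic_subst 0 G = 0"
  by (rule qform_inject) (simp add: qform_conic_subst)

text \<open>The form \<open>a\<close> at the point \<open>(s^2, s t, t^2)\<close> of
  \<open>xz = y^2\<close>. The coefficients of \<open>y^2\<close> and \<open>xz\<close> are added
  because both monomials become \<open>s^2 t^2\<close>.\<close>

definition quart_of :: "'a::field ^ 6 \<Rightarrow> 'a \<times> 'a \<Rightarrow> 'a" where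
  "quart_of a = bquart (a$1) (a$4) (a$2 + a$5) (a$6) (a$3)"

definition quart_disc :: "'a::field ^ 6 \<Rightarrow> 'a" where
  "quart_disc a = disc4 (a$1) (a$4) (a$2 + a$5) (a$6) (a$3)"

text \<open>Half the determinant of the symmetric matrix of \<open>qgrad a\<close>.\<close>

definition conic_det :: "'a::field ^ 6 \<Rightarrow> 'a" where
  "conic_det a = 4 * a$1 * a$2 * a$3 + a$4 * a$5 * a$6 - a$1 * (a$6)^2 - a$2 * (a$5)^2 - a$3 * (a$4)^2"

text \<open>Cayley's criterion: up to a factor, this is \<open>\<Theta>'\<^sup>2 - 4\<Theta>\<Delta>\<close> for the pencil spanned by \<open>a\<close> and the
  conic \<open>xz = y\<^sup>2\<close> with discriminant \<open>\<Delta>\<close>.\<close>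

definition triangle_form :: "'a::field ^ 6 \<Rightarrow> 'a" where
  "triangle_form a = (a$2)^2 + 4 * a$2 * a$5 + 16 * a$1 * a$3 - 4 * a$4 * a$6"

text \<open>\<open>tanl z\<close> is the tangent line to \<open>xz = y\<^sup>2\<close> at the point with parameter \<open>z\<close>, and \<open>chord x y\<close> is the
  intersection point of \<open>tanl x\<close> and \<open>tanl y\<close>.\<close>

definition chord :: "'a::field \<times> 'a \<Rightarrow> 'a \<times> 'a \<Rightarrow> 'a ^ 3" where
  "chord x y = vector [2 * fst x * fst y, fst x * snd y + fst y * snd x, 2 * snd x * snd y]"

definition tanl :: "'a::field \<times> 'a \<Rightarrow> 'a ^ 3" where
  "tanl z = vector [snd z^2, - 2 * fst z * snd z, fst z^2]"

lemma conic_det_0 [simp]: "conic_det 0 = 0"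
  by (simp add: conic_det_def)

lemma singular_iff_conic_det:
  fixes a :: "'a::field ^ 6"
  assumes "(2::'a) \<noteq> 0"
  shows "(\<exists>v. v \<noteq> 0 \<and> qgrad a v = 0) \<longleftrightarrow> conic_det a = 0"
proof -
  define M :: "'a ^ 3 ^ 3" where
    "M = vector [vector [2 * a$1, a$4, a$5], vector [a$4, 2 * a$2, a$6], vector [a$5, a$6, 2 * a$3]]"
  have M: "qgrad a v = M *v v" for v
    by (simp add: M_def qgrad_def vec_eq_iff forall_3 matrix_vector_mult_def sum_3)
  have "det M = 2 * conic_det a"
    by (simp add: M_def det_3 conic_det_def algebra_simps power2_eq_square)
  then have "conic_det a = 0 \<longleftrightarrow> det M = 0" using assms by simp
  also have "\<dots> \<longleftrightarrow> \<not> invertible M" by (simp add: invertible_det_nz)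
  also have "\<dots> \<longleftrightarrow> (\<exists>v. v \<noteq> 0 \<and> M *v v = 0)"
    by (metis invertible_left_inverse matrix_left_invertible_ker)
  finally show ?thesis by (simp add: M)
qed

subsection \<open>Parametrisation of the tangent lines\<close>

lemma on_line_abs:
  "v \<noteq> 0 \<Longrightarrow> l \<noteq> 0 \<Longrightarrow> on_line (abs_proj v) (abs_proj l) \<longleftrightarrow> dot3 l v = 0"
  by (simp add: on_line.abs_eq dot3_def)

lemma on_conic_abs:
  "v \<noteq> 0 \<Longrightarrow> a \<noteq> 0 \<Longrightarrow> on_conic (abs_proj v) (abs_proj a) \<longleftrightarrow> qform a v = 0"
  by (simp add: on_conic.abs_eq)

lemma tangent_at_abs:
  "v \<noteq> 0 \<Longrightarrow> a \<noteq> 0 \<Longrightarrow> l \<noteq> 0 \<Longrightarrow> tangent_at (abs_proj a) (abs_proj v) (abs_proj l) \<longleftrightarrow>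
     qform a v = 0 \<and> (\<exists>c. c \<noteq> 0 \<and> qgrad a v = c *s l)"
  by (simp add: tangent_at.abs_eq)

lemma chord_add: "chord x (fst y + fst z, snd y + snd z) = chord x y + chord x z"
  by (simp add: chord_def vec_eq_iff forall_3 algebra_simps)

lemma chord_scale: "chord x (c * fst y, c * snd y) = c *s chord x y"
  by (simp add: chord_def vec_eq_iff forall_3 algebra_simps)

lemma chord_commute: "chord x y = chord y x"
  by (simp add: chord_def vec_eq_iff forall_3 algebra_simps)

lemma dot3_tanl_chord: "dot3 (tanl z) (chord x y) = 2 * br z x * br z y"
  by (simp add: dot3_def tanl_def chord_def br_def algebra_simps power2_eq_square)

lemma tanl_scale: "tanl (c * fst x, c * snd x) = c^2 *s tanl x"
  by (simp add: tanl_def vec_eq_iff forall_3 algebra_simps power2_eq_square)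

lemma tanl_eq_0_iff [simp]: "tanl z = 0 \<longleftrightarrow> z = 0"
  by (auto simp: tanl_def vec_eq_iff forall_3 prod_eq_iff)

lemma chord_eq_0_iff:
  assumes "(2::'a::field) \<noteq> 0"
  shows "chord x (y :: 'a \<times> 'a) = 0 \<longleftrightarrow> x = 0 \<or> y = 0"
  using assms by (auto simp: chord_def vec_eq_iff forall_3 prod_eq_iff)

text \<open>The change of coordinates \<open>G\<close>, with inverse \<open>H\<close>, brings
  \<open>b\<close> to a multiple of \<open>xz - y^2\<close>. The factor \<open>lam\<close> is kept
  because over the base field the determinant of \<open>b\<close> fixes it up to squares.\<close>

locale conic_frame =
  fixes b :: "'a::field ^ 6" and G H :: "'a ^ 3 ^ 3" and lam :: 'a
  assumes two: "(2::'a) \<noteq> 0"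
    and GH: "G ** H = mat 1" and HG: "H ** G = mat 1"
    and lam: "lam \<noteq> 0"
    and b: "qform b (G *v v) = lam * (v$1 * v$3 - (v$2)^2)"
begin

definition pt :: "'a \<times> 'a \<Rightarrow> 'a \<times> 'a \<Rightarrow> 'a ^ 3" where
  "pt x y = G *v chord x y"

text \<open>Lines transform contragrediently, so incidence can be computed in the standard
  coordinates.\<close>

definition tln :: "'a \<times> 'a \<Rightarrow> 'a ^ 3" where
  "tln z = transpose H *v tanl z"

lemma GH_cancel [simp]: "G *v (H *v v) = v" "H *v (G *v v) = v"
  by (simp_all add: matrix_vector_mul_assoc GH HG)

lemma G_eq_0_iff [simp]: "G *v v = 0 \<longleftrightarrow> v = 0"
  by (metis GH_cancel(2) matrix_vector_mult_0_right)

lemma dot3_H [simp]: "dot3 (transpose H *v l) (G *v v) = dot3 l v"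
  by (simp only: dot3_transpose GH_cancel)

lemma b_nz: "b \<noteq> 0"
proof
  assume "b = 0"
  then show False using b[of "vector [1, 0, 1]"] lam by simp
qed

lemma pt_commute: "pt x y = pt y x"
  by (simp add: pt_def chord_commute[of x])

lemma pt_add: "pt x (fst y + fst z, snd y + snd z) = pt x y + pt x z"
  by (simp add: pt_def chord_add matrix_vector_right_distrib)

lemma pt_scale: "pt x (c * fst y, c * snd y) = c *s pt x y"
  by (simp add: pt_def chord_scale vector_scalar_commute)

lemma dot3_tln_pt: "dot3 (tln z) (pt x y) = 2 * br z x * br z y"
  unfolding pt_def tln_def by (simp only: dot3_H dot3_tanl_chord)

lemma tln_eq_0_iff [simp]: "tln z = 0 \<longleftrightarrow> z = 0"
proof
  assume "tln z = 0"
  then have "dot3 (tanl z) v = dot3 0 v" for v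
    using dot3_H[of "tanl z" v] by (simp add: tln_def dot3_def)
  then have "tanl z = 0" by (rule dot3_eqI)
  then show "z = 0" by simp
next
  assume "z = 0"
  then have "tanl z = 0" by simp
  then show "tln z = 0" unfolding tln_def by (simp only: matrix_vector_mult_0_right)
qed

lemma pt_eq_0_iff [simp]: "pt x y = 0 \<longleftrightarrow> x = 0 \<or> y = 0"
  by (simp add: pt_def chord_eq_0_iff[OF two])

lemma tln_scale: "tln (c * fst x, c * snd x) = c^2 *s tln x"
  unfolding tln_def by (simp only: tanl_scale vector_scalar_commute)

lemma qform_b_pt: "qform b (pt x y) = - lam * (br x y)^2"
  by (simp add: pt_def b chord_def br_def algebra_simps power2_eq_square)

lemma abs_pt_eq:
  assumes "br y z = 0" "y \<noteq> 0" "z \<noteq> 0" "x \<noteq> 0"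
  shows "abs_proj (pt x y) = abs_proj (pt x z)"
proof -
  obtain c where "c \<noteq> 0" "z = (c * fst y, c * snd y)" using assms br_eq_0D by blast
  then show ?thesis using assms by (subst abs_proj_eq_iff) (auto simp: pt_scale)
qed

lemma abs_tln_eq_iff:
  assumes "y \<noteq> 0" "z \<noteq> 0"
  shows "abs_proj (tln y) = abs_proj (tln z) \<longleftrightarrow> br y z = 0"
proof
  assume "abs_proj (tln y) = abs_proj (tln z)"
  then obtain c where c: "c \<noteq> 0" "tln z = c *s tln y"
    using assms by (subst (asm) abs_proj_eq_iff) auto
  have "dot3 (tln z) (pt y y) = 0" unfolding c(2) by (simp add: dot3_tln_pt)
  then show "br y z = 0" using two by (simp add: dot3_tln_pt br_commute_0)
next
  assume "br y z = 0"
  then obtain c where "c \<noteq> 0" "z = (c * fst y, c * snd y)" using assms br_eq_0D by blast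
  then show "abs_proj (tln y) = abs_proj (tln z)"
    using assms by (subst abs_proj_eq_iff) (auto simp: tln_scale intro!: exI[of _ "c^2"])
qed

text \<open>For fixed \<open>z\<close> the map from \<open>y\<close> to \<open>pt z y\<close> is
  linear and injective, so it fills the plane of all vectors on the tangent line. The proof inverts
  it explicitly.\<close>

lemma on_tln_iff:
  assumes "z \<noteq> 0" "dot3 (tln z) v = 0"
  obtains y where "v = pt z y"
proof -
  define w where "w = H *v v"
  have v: "v = G *v w" by (simp add: w_def)
  have eq: "(snd z)^2 * w$1 + (fst z)^2 * w$3 = 2 * fst z * snd z * w$2"
    using assms(2) unfolding v tln_def
    by (simp only: dot3_H) (simp add: dot3_def tanl_def algebra_simps)
  show ?thesis
  proof (cases "fst z = 0")
    case True
    then have z2: "snd z \<noteq> 0" using assms(1) by (auto simp: prod_eq_iff)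
    then have "w$1 = 0" using eq True by simp
    then have "w = chord z (w$2 / snd z, w$3 / (2 * snd z))"
      using z2 True two by (simp add: chord_def vec_eq_iff forall_3)
    then show ?thesis using that v pt_def by metis
  next
    case False
    define y1 where "y1 = w$1 / (2 * fst z)"
    have y1: "w$1 = 2 * fst z * y1" using False two by (simp add: y1_def)
    define y2 where "y2 = (w$2 - snd z * y1) / fst z"
    have y2: "w$2 = fst z * y2 + snd z * y1" using False by (simp add: y2_def)
    have "(fst z)^2 * w$3 = (fst z)^2 * (2 * snd z * y2)"
      using eq unfolding y1 y2 by (simp add: algebra_simps power2_eq_square)
    then have "w$3 = 2 * snd z * y2" using False by simp
    then have "w = chord z (y1, y2)"
      using y1 y2 by (simp add: chord_def vec_eq_iff forall_3 algebra_simps)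
    then show ?thesis using that v pt_def by metis
  qed
qed

lemma on_conic_b_iff:
  assumes "v \<noteq> 0" "qform b v = 0"
  obtains x c where "x \<noteq> 0" "c \<noteq> 0" "v = c *s pt x x"
proof -
  define w where "w = H *v v"
  have v: "v = G *v w" by (simp add: w_def)
  have w0: "w \<noteq> 0" using v assms(1) by auto
  have eq: "w$1 * w$3 = (w$2)^2" using assms(2) unfolding v b using lam by simp
  show ?thesis
  proof (cases "w$1 = 0")
    case True
    then have "w$2 = 0" using eq by simp
    moreover from this True w0 have w3: "w$3 \<noteq> 0" by (simp add: vec_eq_iff forall_3)
    ultimately have "w = (w$3 / 2) *s chord (0, 1) (0, 1)"
      using True two by (simp add: chord_def vec_eq_iff forall_3)
    then have "v = (w$3 / 2) *s pt (0, 1) (0, 1)"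
      unfolding v pt_def by (metis vector_scalar_commute)
    then show ?thesis using that[of "(0, 1)" "w$3 / 2"] w3 two by (simp add: prod_eq_iff)
  next
    case False
    \<comment> \<open>The parameter is \<open>(w$1, w$2)\<close>, since multiplying \<open>w\<close>
      by \<open>w$1\<close> gives \<open>(s^2, s t, t^2)\<close> for these \<open>s\<close> and
      \<open>t\<close>.\<close>
    have "chord (w$1, w$2) (w$1, w$2) = (2 * w$1) *s w"
      using eq by (simp add: chord_def vec_eq_iff forall_3 power2_eq_square algebra_simps)
    then have "pt (w$1, w$2) (w$1, w$2) = (2 * w$1) *s v"
      unfolding v pt_def by (simp add: vector_scalar_commute)
    then have "v = (1 / (2 * w$1)) *s pt (w$1, w$2) (w$1, w$2)"
      using False two by simp
    then show ?thesis using that[of "(w$1, w$2)" "1 / (2 * w$1)"] False two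
      by (simp add: prod_eq_iff)
  qed
qed

text \<open>Comparing the linear parts of the form near \<open>pt x x\<close> shows that
  \<open>tln x\<close> is indeed the tangent line at this point.\<close>

lemma qgrad_b_pt: "qgrad b (pt x x) = (2 * lam) *s tln x"
proof (rule dot3_eqI)
  fix v
  have v: "v = G *v (H *v v)" by simp
  define w where "w = H *v v"
  have "qform b (pt x x + v) = qform b (G *v (chord x x + w))"
    unfolding w_def by (simp add: pt_def matrix_vector_right_distrib)
  also have "\<dots> = qform b (pt x x) + qform b (G *v w) + 2 * lam * dot3 (tanl x) w"
    by (simp only: pt_def b)
      (simp add: dot3_def tanl_def chord_def algebra_simps power2_eq_square)
  also have "dot3 (tanl x) w = dot3 (tln x) v"
    by (subst v, simp only: tln_def dot3_H w_def)
  also have "G *v w = v" by (simp add: w_def)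
  finally show "dot3 (qgrad b (pt x x)) v = dot3 ((2 * lam) *s tln x) v"
    by (simp add: qform_polar)
qed

lemma dual_conic_b_iff:
  "\<xi> \<in> dual_conic (abs_proj b) \<longleftrightarrow> (\<exists>z. z \<noteq> 0 \<and> \<xi> = abs_proj (tln z))"
proof
  assume "\<xi> \<in> dual_conic (abs_proj b)"
  then obtain P where P: "tangent_at (abs_proj b) P \<xi>" by (auto simp: dual_conic_def)
  obtain v where v: "v \<noteq> 0" "P = abs_proj v" by (cases P)
  obtain l where l: "l \<noteq> 0" "\<xi> = abs_proj l" by (cases \<xi>)
  from P v l b_nz obtain c where c: "qform b v = 0" "c \<noteq> 0" "qgrad b v = c *s l"
    by (auto simp: tangent_at_abs)
  obtain x k where x: "x \<noteq> 0" "k \<noteq> 0" "v = k *s pt x x" using on_conic_b_iff v c by blast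
  have eq: "(k * (2 * lam)) *s tln x = c *s l"
    using c(3) unfolding x(3) qgrad_scale' qgrad_b_pt by (simp add: vector_smult_assoc)
  have "l = (k * (2 * lam) / c) *s tln x"
  proof -
    have "l = (1 / c) *s (c *s l)" using c by simp
    also have "\<dots> = (k * (2 * lam) / c) *s tln x" unfolding eq[symmetric] by simp
    finally show ?thesis .
  qed
  then have "\<xi> = abs_proj (tln x)"
    unfolding l(2) using l(1) x c lam two abs_proj_scale[of "k * (2 * lam) / c" "tln x"] by auto
  then show "\<exists>z. z \<noteq> 0 \<and> \<xi> = abs_proj (tln z)" using x by blast
next
  assume "\<exists>z. z \<noteq> 0 \<and> \<xi> = abs_proj (tln z)"
  then obtain z where z: "z \<noteq> 0" "\<xi> = abs_proj (tln z)" by blast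
  have "tangent_at (abs_proj b) (abs_proj (pt z z)) \<xi>"
    unfolding z(2) using z(1) b_nz two lam
    by (subst tangent_at_abs) (auto simp: qform_b_pt qgrad_b_pt intro!: exI[of _ "2 * lam"])
  then show "\<xi> \<in> dual_conic (abs_proj b)" by (auto simp: dual_conic_def)
qed

lemma tln_in_dual: "z \<noteq> 0 \<Longrightarrow> abs_proj (tln z) \<in> dual_conic (abs_proj b)"
  using dual_conic_b_iff by blast

lemma abs_pt_diag_eq_iff:
  assumes "x \<noteq> 0" "y \<noteq> 0"
  shows "abs_proj (pt x x) = abs_proj (pt y y) \<longleftrightarrow> br x y = 0"
proof
  assume "abs_proj (pt x x) = abs_proj (pt y y)"
  then obtain c where c: "c \<noteq> 0" "pt y y = c *s pt x x"
    using assms by (subst (asm) abs_proj_eq_iff) auto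
  have "dot3 (tln x) (pt y y) = 0" unfolding c(2) by (simp add: dot3_tln_pt)
  then show "br x y = 0" using two by (simp add: dot3_tln_pt)
next
  assume "br x y = 0"
  then show "abs_proj (pt x x) = abs_proj (pt y y)"
    using assms abs_pt_eq[of x y x] abs_pt_eq[of x y y] pt_commute[of x y] by simp
qed

end

subsection \<open>The Poncelet correspondence\<close>

locale poncelet_frame = conic_frame b G H lam
  for b :: "'a::alg_closed_field ^ 6" and G H lam +
  fixes a :: "'a ^ 6"
  assumes smooth: "v \<noteq> 0 \<Longrightarrow> qgrad a v \<noteq> 0"
begin

definition a' :: "'a ^ 6" where "a' = conic_subst a G"

text \<open>The symmetric form \<open>F\<close> of the overview: it vanishes when the tangents with
  parameters \<open>x\<close> and \<open>y\<close> meet on \<open>a\<close>. An element of the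
  Poncelet curve is written as \<open>pt x0 x1\<close> and \<open>tln x1\<close> with
  \<open>inc x1 x0 = 0\<close>.\<close>

definition inc :: "'a \<times> 'a \<Rightarrow> 'a \<times> 'a \<Rightarrow> 'a" where
  "inc x y = qform a (pt x y)"

lemma a_nz: "a \<noteq> 0"
proof
  assume "a = 0"
  then have "qgrad a (vector [1, 0, 0]) = 0" by (simp add: qgrad_def vec_eq_iff forall_3)
  then show False using smooth[of "vector [1, 0, 0]"] by (auto simp: vec_eq_iff forall_3)
qed

lemma inc_eq: "inc x y = qform a' (chord x y)"
  by (simp add: inc_def pt_def a'_def qform_conic_subst)

lemma inc_commute: "inc x y = inc y x"
  by (simp add: inc_def pt_commute)

lemma inc_scale: "inc x (c * fst y, c * snd y) = c^2 * inc x y"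
  by (simp add: inc_def pt_scale qform_scale')

lemma inc_add: "inc x (fst y + fst z, snd y + snd z) =
    inc x y + inc x z + dot3 (qgrad a (pt x y)) (pt x z)"
  by (simp add: inc_def pt_add qform_polar)

lemma inc_diag: "inc x x = 4 * quart_of a' x"
  by (simp add: inc_eq quart_of_def bquart_def chord_def qform_def algebra_simps
      power2_eq_square power3_eq_cube power4_eq_xxxx)

lemma inc_eq_0_cong:
  assumes "br y z = 0" "y \<noteq> 0" "z \<noteq> 0"
  shows "inc x y = 0 \<longleftrightarrow> inc x z = 0"
proof -
  obtain c where "c \<noteq> 0" "z = (c * fst y, c * snd y)" using assms br_eq_0D by blast
  then show ?thesis by (simp add: inc_scale)
qed

lemma inc_quadratic:
  "inc x y =
     (4 * a'$1 * (fst x)^2 + a'$2 * (snd x)^2 + 2 * a'$4 * fst x * snd x) * (fst y)^2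
   + (2 * a'$2 * fst x * snd x + 2 * a'$4 * (fst x)^2 + 4 * a'$5 * fst x * snd x
        + 2 * a'$6 * (snd x)^2) * (fst y * snd y)
   + (a'$2 * (fst x)^2 + 4 * a'$3 * (snd x)^2 + 2 * a'$6 * fst x * snd x) * (snd y)^2"
  by (simp add: inc_eq chord_def qform_def algebra_simps power2_eq_square)

text \<open>The values at \<open>(1, 0)\<close>, \<open>(0, 1)\<close> and \<open>(1, 1)\<close>
  determine the coefficients of a binary quadratic form.\<close>

lemma inc_coeffs:
  assumes "\<And>y. inc x y = c * br y u * br y v"
  shows "4 * a'$1 * (fst x)^2 + a'$2 * (snd x)^2 + 2 * a'$4 * fst x * snd x = c * snd u * snd v" (is "?p = _")
    and "2 * a'$2 * fst x * snd x + 2 * a'$4 * (fst x)^2 + 4 * a'$5 * fst x * snd x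
        + 2 * a'$6 * (snd x)^2 = - c * (fst u * snd v + fst v * snd u)" (is "?q = _")
    and "a'$2 * (fst x)^2 + 4 * a'$3 * (snd x)^2 + 2 * a'$6 * fst x * snd x = c * fst u * fst v" (is "?r = _")
proof -
  show p: "?p = c * snd u * snd v"
    using assms[of "(1, 0)"] unfolding inc_quadratic by (simp add: br_def)
  show r: "?r = c * fst u * fst v"
    using assms[of "(0, 1)"] unfolding inc_quadratic by (simp add: br_def)
  have eq: "?p + ?q + ?r = c * br (1, 1) u * br (1, 1) v"
    using assms[of "(1, 1)"] unfolding inc_quadratic by simp
  have "?q = (?p + ?q + ?r) - ?p - ?r" by simp
  also have "\<dots> = c * br (1, 1) u * br (1, 1) v - c * snd u * snd v - c * fst u * fst v"
    unfolding eq unfolding p r ..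
  finally show "?q = - c * (fst u * snd v + fst v * snd u)"
    by (simp add: br_def algebra_simps)
qed

text \<open>Hence, when \<open>triangle_form a'\<close> vanishes, the two neighbours of any parameter are neighbours of
  each other, and the Poncelet polygons close up after three steps.\<close>

lemma inc_neighbours:
  assumes "\<And>y. inc x y = c * br y u * br y v"
  shows "c^2 * inc u v = triangle_form a' * inc x x"
proof -
  define p q r where "p = 4 * a'$1 * (fst x)^2 + a'$2 * (snd x)^2 + 2 * a'$4 * fst x * snd x"
    and "q = 2 * a'$2 * fst x * snd x + 2 * a'$4 * (fst x)^2 + 4 * a'$5 * fst x * snd x
        + 2 * a'$6 * (snd x)^2"
    and "r = a'$2 * (fst x)^2 + 4 * a'$3 * (snd x)^2 + 2 * a'$6 * fst x * snd x"
  note pqr = this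
  have eqs: "p = c * snd u * snd v" "q = - c * (fst u * snd v + fst v * snd u)" "r = c * fst u * fst v"
    unfolding pqr by (rule inc_coeffs[OF assms])+
  have "c^2 * inc u v = qform a' (c *s chord u v)"
    by (simp add: inc_eq qform_scale')
  also have "c *s chord u v = vector [2 * r, - q, 2 * p]"
    \<comment> \<open>The chord of the two roots depends only on the coefficients of the quadratic,
      so the roots themselves disappear from the computation. The identity after it is where
      \<open>triangle_form\<close> comes from: the factor left beside \<open>inc x x\<close> is free
      of \<open>x\<close>.\<close>
    by (simp add: chord_def vec_eq_iff forall_3 eqs algebra_simps)
  also have "qform a' (vector [2 * r, - q, 2 * p]) =
      triangle_form a' * (p * (fst x)^2 + q * (fst x * snd x) + r * (snd x)^2)"
    unfolding pqr by (simp add: qform_def triangle_form_def algebra_simps power2_eq_square)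
  also have "p * (fst x)^2 + q * (fst x * snd x) + r * (snd x)^2 = inc x x"
    by (simp add: inc_quadratic pqr)
  finally show ?thesis .
qed

text \<open>The vectors \<open>pt x y\<close> fill a plane, and the functionals vanishing on it form
  a line, which contains \<open>tln x\<close>.\<close>

lemma perp_pt:
  assumes "x \<noteq> 0" "\<And>y. dot3 l (pt x y) = 0"
  obtains k where "l = k *s tln x"
proof -
  define L where "L = transpose G *v l"
  have L: "dot3 L (chord x y) = 0" for y
    using assms(2)[of y] unfolding L_def pt_def dot3_transpose .
  have l: "l = transpose H *v L"
  proof (rule dot3_eqI)
    fix v
    have "dot3 (transpose H *v L) v = dot3 l (G *v (H *v v))"
      unfolding L_def dot3_transpose ..
    then show "dot3 l v = dot3 (transpose H *v L) v" by simp
  qed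
  have 1: "2 * fst x * L$1 + snd x * L$2 = 0"
    using L[of "(1, 0)"] by (simp add: dot3_def chord_def algebra_simps)
  have 2: "fst x * L$2 + 2 * snd x * L$3 = 0"
    using L[of "(0, 1)"] by (simp add: dot3_def chord_def algebra_simps)
  have "\<exists>k. L = k *s tanl x"
  proof (cases "fst x = 0")
    case True
    then have "snd x \<noteq> 0" using assms(1) by (auto simp: prod_eq_iff)
    then show ?thesis using 1 2 True two
      by (intro exI[of _ "L$1 / (snd x)^2"]) (simp add: tanl_def vec_eq_iff forall_3)
  next
    case False
    define k where "k = L$3 / (fst x)^2"
    have l3: "L$3 = k * (fst x)^2" using False by (simp add: k_def)
    have "fst x * L$2 = fst x * (- 2 * k * fst x * snd x)"
      using 2 unfolding l3 by (simp add: algebra_simps power2_eq_square eq_neg_iff_add_eq_0)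
    then have l2: "L$2 = - 2 * k * fst x * snd x" using False by (metis mult_cancel_left)
    have "(2 * fst x) * L$1 = (2 * fst x) * (k * (snd x)^2)"
      using 1 unfolding l2 by (simp add: algebra_simps power2_eq_square)
    then have l1: "L$1 = k * (snd x)^2" using False two by simp
    show ?thesis
      by (intro exI[of _ k]) (simp add: tanl_def vec_eq_iff forall_3 l1 l2 l3)
  qed
  then obtain k where "L = k *s tanl x" ..
  then have "l = k *s tln x" unfolding l tln_def by (simp only: vector_scalar_commute)
  then show ?thesis using that by blast
qed

text \<open>Otherwise the smooth conic would contain the tangent line with parameter \<open>x\<close>.\<close>

lemma inc_not_all_0:
  assumes "x \<noteq> 0"
  shows "\<exists>y. inc x y \<noteq> 0"
proof (rule ccontr)
  assume "\<not> ?thesis"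
  then have z: "inc x y = 0" for y by blast
  have perp: "dot3 (qgrad a (pt x y)) (pt x w) = 0" for y w
    using inc_add[of x y w] z by simp
  obtain k1 where k1: "qgrad a (pt x (1, 0)) = k1 *s tln x" using perp_pt[OF assms perp] .
  obtain k2 where k2: "qgrad a (pt x (0, 1)) = k2 *s tln x" using perp_pt[OF assms perp] .
  have e: "(1::'a, 0::'a) \<noteq> 0" by (simp add: prod_eq_iff)
  have k10: "k1 \<noteq> 0" using k1 smooth[of "pt x (1, 0)"] assms e by auto
  \<comment> \<open>On a line inside the conic the gradient is a linear map into the multiples of
    \<open>tln x\<close>, so it has a kernel; this vector is in it.\<close>
  have "pt x (k2, - k1) = k2 *s pt x (1, 0) + (- k1) *s pt x (0, 1)"
    using pt_add[of x "(k2, 0)" "(0, - k1)"] pt_scale[of x k2 "(1, 0)"] pt_scale[of x "- k1" "(0, 1)"]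
    by simp
  then have "qgrad a (pt x (k2, - k1)) = k2 *s (k1 *s tln x) + (- k1) *s (k2 *s tln x)"
    by (simp only: qgrad_add qgrad_scale' k1 k2)
  also have "\<dots> = 0" by (simp add: vec_eq_iff)
  finally show False using smooth[of "pt x (k2, - k1)"] assms k10 by (auto simp: prod_eq_iff)
qed

lemma inc_factor:
  assumes "x \<noteq> 0"
  obtains u v c where "u \<noteq> 0" "v \<noteq> 0" "c \<noteq> 0" "\<And>y. inc x y = c * br y u * br y v"
proof -
  obtain p q r where pqr: "\<And>y. inc x y = p * (fst y)^2 + q * (fst y * snd y) + r * (snd y)^2"
    using inc_quadratic[of x] by blast
  obtain a1 b1 d2 d3 where 1: "(a1, b1) \<noteq> (0, 0)" "p = b1 * d2" "q = b1 * d3 - a1 * d2" "r = - (a1 * d3)"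
    using quadratic_split by metis
  obtain a2 b2 k where 2: "(a2, b2) \<noteq> (0, 0)" "d2 = b2 * k" "d3 = - (a2 * k)"
    using linear_split by metis
  have eq: "inc x y = k * br y (a1, b1) * br y (a2, b2)" for y
    unfolding pqr 1(2-) 2(2-) br_def by (simp add: algebra_simps power2_eq_square)
  moreover have "k \<noteq> 0" using inc_not_all_0[OF assms] eq by auto
  ultimately show ?thesis
    using that[of "(a1, b1)" "(a2, b2)" k] 1(1) 2(1) by (simp add: zero_prod_def)
qed

text \<open>The scalar between the given root and the one found by factoring is absorbed into
  \<open>c\<close>, so that the prescribed representative \<open>u\<close> occurs in the
  factorisation.\<close>

lemma inc_factor_root:
  assumes "x \<noteq> 0" "u \<noteq> 0" "inc x u = 0"
  obtains v c where "v \<noteq> 0" "c \<noteq> 0" "\<And>y. inc x y = c * br y u * br y v"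
proof -
  obtain u' v' c' where 1: "u' \<noteq> 0" "v' \<noteq> 0" "c' \<noteq> 0" "\<And>y. inc x y = c' * br y u' * br y v'"
    using inc_factor[OF assms(1)] by metis
  note goal = that
  have *: thesis if 2: "w \<noteq> 0" "w' \<noteq> 0" "\<And>y. inc x y = c' * br y w * br y w'" "br u w = 0" for w w'
  proof -
    obtain d where d: "d \<noteq> 0" "w = (d * fst u, d * snd u)" using br_eq_0D 2 assms by metis
    have "inc x y = (c' * d) * br y u * br y w'" for y
      unfolding 2(3) d(2) by (simp add: br_def algebra_simps)
    then show ?thesis using goal[OF 2(2), of "c' * d"] 1(3) d(1) by simp
  qed
  have "br u u' = 0 \<or> br u v' = 0" using assms(3) 1 by simp
  then show ?thesis
  proof
    assume "br u u' = 0"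
    then show ?thesis using *[of u' v'] 1 by simp
  next
    assume "br u v' = 0"
    then show ?thesis using *[of v' u'] 1 by (simp add: mult.commute mult.left_commute)
  qed
qed

text \<open>A line touches the conic exactly when the restricted quadratic has a double root: at
  that root the polar form vanishes along the line, so the gradient is a multiple of the equation of
  the line.\<close>

lemma tangent_iff:
  assumes "x \<noteq> 0" "u \<noteq> 0" "v \<noteq> 0" "c \<noteq> 0" and f: "\<And>y. inc x y = c * br y u * br y v"
  shows "abs_proj (tln x) \<in> dual_conic (abs_proj a) \<longleftrightarrow> br u v = 0"
proof
  assume "abs_proj (tln x) \<in> dual_conic (abs_proj a)"
  then obtain P where P: "tangent_at (abs_proj a) P (abs_proj (tln x))" by (auto simp: dual_conic_def)
  obtain w where w: "w \<noteq> 0" "P = abs_proj w" by (cases P)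
  from P obtain d where d: "qform a w = 0" "d \<noteq> 0" "qgrad a w = d *s tln x"
    unfolding w using w a_nz assms(1) by (auto simp: tangent_at_abs)
  have "d * dot3 (tln x) w = 0" using qgrad_euler[of a w] d by simp
  then obtain y where y: "w = pt x y" using on_tln_iff[OF assms(1)] d(2) by auto
  have ynz: "y \<noteq> 0" using w(1) y by auto
  have y0: "inc x y = 0" using d(1) by (simp add: inc_def y)
  \<comment> \<open>At the point of contact both the value and the polar term vanish, so translation
    by \<open>y\<close> leaves the quadratic \<open>inc x\<close> unchanged. Only a double root
    allows this.\<close>
  have "inc x (fst y + fst z, snd y + snd z) = inc x z" for z
    using d(3) by (simp add: inc_add y0 y dot3_tln_pt)
  moreover have "br (fst y + fst z, snd y + snd z) w = br y w + br z w" for z w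
    by (simp add: br_def algebra_simps)
  ultimately have expand: "(br y u + br z u) * (br y v + br z v) = br z u * br z v" for z
    using assms(4) by (simp add: f mult.assoc)
  have yuv: "br y u = 0 \<or> br y v = 0" using y0 f assms(4) by simp
  have e: "br y u * br z v + br z u * br y v = 0" for z
  proof -
    have "br y u * br y v + (br y u * br z v + br z u * br y v) = 0"
      using expand[of z] by (simp add: algebra_simps)
    then show ?thesis using yuv by auto
  qed
  show "br u v = 0"
  proof (cases "br y u = 0")
    case True
    have "\<exists>z. br z u \<noteq> 0"
      using assms(2) by (intro exI[of _ "if fst u = 0 then (1, 0) else (0, 1)"]) (auto simp: br_def prod_eq_iff)
    then have "br y v = 0" using e True by (metis add_0 mult_eq_0_iff mult_zero_left)
    then show ?thesis using True br_eq_0_trans[of u y v] ynz by (simp add: br_commute_0)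
  next
    case False
    then have "br y v = 0" using yuv by simp
    have "\<exists>z. br z v \<noteq> 0"
      using assms(3) by (intro exI[of _ "if fst v = 0 then (1, 0) else (0, 1)"]) (auto simp: br_def prod_eq_iff)
    then have "br y u = 0" using e \<open>br y v = 0\<close> by (metis add.right_neutral mult_eq_0_iff mult_zero_right)
    then show ?thesis using False by simp
  qed
next
  assume uv: "br u v = 0"
  have "dot3 (qgrad a (pt x u)) (pt x z) = 0" for z
  proof -
    have "br (fst u + fst z, snd u + snd z) u = br z u" "br (fst u + fst z, snd u + snd z) v = br u v + br z v"
      by (simp_all add: br_def algebra_simps)
    then have "inc x (fst u + fst z, snd u + snd z) = inc x z" by (simp add: f uv)
    then show ?thesis by (simp add: inc_add f)
  qed
  then obtain k where k: "qgrad a (pt x u) = k *s tln x" using perp_pt[OF assms(1)] by blast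
  have "k \<noteq> 0" using k smooth[of "pt x u"] assms by auto
  then have "tangent_at (abs_proj a) (abs_proj (pt x u)) (abs_proj (tln x))"
    using assms a_nz k f[of u] by (subst tangent_at_abs) (auto simp: inc_def)
  then show "abs_proj (tln x) \<in> dual_conic (abs_proj a)" by (auto simp: dual_conic_def)
qed

text \<open>In parameters \<open>j\<close> is the shift from \<open>(x0, x1)\<close> to
  \<open>(x1, x2)\<close>, where \<open>x2\<close> is the second root of \<open>inc x1\<close>,
  counted with multiplicity. A double root is the tangency case of \<open>other_point\<close>, and
  \<open>br x1 x2 = 0\<close> is the case of a point on \<open>b\<close> in
  \<open>other_tangent\<close>.\<close>

lemma poncelet_map_pt:
  assumes "x0 \<noteq> 0" "x1 \<noteq> 0" "inc x1 x0 = 0"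
  obtains x2 c where "x2 \<noteq> 0" "c \<noteq> 0" "\<And>y. inc x1 y = c * br y x0 * br y x2"
    "poncelet_map (abs_proj a) (abs_proj b) (abs_proj (pt x0 x1), abs_proj (tln x1)) =
       (abs_proj (pt x1 x2), abs_proj (tln x2))"
proof -
  obtain x2 c where x2: "x2 \<noteq> 0" "c \<noteq> 0" and f: "\<And>y. inc x1 y = c * br y x0 * br y x2"
    using inc_factor_root[OF assms(2,1,3)] by metis
  let ?A = "abs_proj a" and ?B = "abs_proj b"
  have P': "other_point ?A (abs_proj (tln x1)) (abs_proj (pt x0 x1)) = abs_proj (pt x1 x2)"
  proof (cases "br x0 x2 = 0")
    case True
    then show ?thesis
      using tangent_iff[OF assms(2,1) x2 f] abs_pt_eq[of x0 x2 x1] assms x2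
      by (simp add: other_point_def pt_commute)
  next
    case False
    have "(THE P'. P' \<in> conic_points ?A \<and> on_line P' (abs_proj (tln x1)) \<and> P' \<noteq> abs_proj (pt x0 x1))
       = abs_proj (pt x1 x2)"
    proof (rule the_equality)
      have "abs_proj (pt x1 x2) \<noteq> abs_proj (pt x0 x1)"
      proof
        assume "abs_proj (pt x1 x2) = abs_proj (pt x0 x1)"
        then obtain d where d: "d \<noteq> 0" "pt x0 x1 = d *s pt x1 x2"
          using assms x2 by (subst (asm) abs_proj_eq_iff) auto
        have "pt x1 (fst x0 - d * fst x2, snd x0 - d * snd x2) = 0"
          using pt_add[of x1 x0 "(- d * fst x2, - d * snd x2)"] pt_scale[of x1 "- d" x2] d(2)
          by (simp add: pt_commute[of x0 x1])
        then have "fst x0 = d * fst x2" "snd x0 = d * snd x2"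
          using assms(2) by (auto simp: prod_eq_iff)
        then have "br x0 x2 = 0" by (simp add: br_def)
        then show False using False by simp
      qed
      moreover have "qform a (pt x1 x2) = 0" using f[of x2] by (simp add: inc_def)
      ultimately show "abs_proj (pt x1 x2) \<in> conic_points ?A \<and>
          on_line (abs_proj (pt x1 x2)) (abs_proj (tln x1)) \<and> abs_proj (pt x1 x2) \<noteq> abs_proj (pt x0 x1)"
        using assms x2 a_nz by (simp add: conic_points_def on_conic_abs on_line_abs dot3_tln_pt)
    next
      fix P'
      assume P': "P' \<in> conic_points ?A \<and> on_line P' (abs_proj (tln x1)) \<and> P' \<noteq> abs_proj (pt x0 x1)"
      obtain v where v: "v \<noteq> 0" "P' = abs_proj v" by (cases P')
      have v0: "qform a v = 0" "dot3 (tln x1) v = 0"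
        using P' v assms a_nz by (simp_all add: conic_points_def on_conic_abs on_line_abs)
      obtain y where y: "v = pt x1 y" using on_tln_iff[OF assms(2) v0(2)] .
      have ynz: "y \<noteq> 0" using v(1) y by auto
      have "br y x0 = 0 \<or> br y x2 = 0" using f[of y] v0(1) x2(2) by (simp add: inc_def y)
      moreover have "br y x0 \<noteq> 0"
        using P' abs_pt_eq[of y x0 x1] ynz assms by (auto simp: v y pt_commute)
      ultimately show "P' = abs_proj (pt x1 x2)"
        using abs_pt_eq[of y x2 x1] ynz assms x2 by (auto simp: v y)
    qed
    then show ?thesis
      using tangent_iff[OF assms(2,1) x2 f] False by (simp add: other_point_def)
  qed
  have L': "other_tangent ?B (abs_proj (pt x1 x2)) (abs_proj (tln x1)) = abs_proj (tln x2)"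
  proof (cases "br x1 x2 = 0")
    case True
    then have "qform b (pt x1 x2) = 0" by (simp add: qform_b_pt)
    then show ?thesis
      using True assms x2 b_nz
      by (simp add: other_tangent_def conic_points_def on_conic_abs abs_tln_eq_iff)
  next
    case False
    then have "qform b (pt x1 x2) \<noteq> 0" using lam by (simp add: qform_b_pt)
    then have nB: "abs_proj (pt x1 x2) \<notin> conic_points ?B"
      using assms x2 b_nz by (simp add: conic_points_def on_conic_abs)
    have "(THE \<xi>'. \<xi>' \<in> dual_conic ?B \<and> on_line (abs_proj (pt x1 x2)) \<xi>' \<and> \<xi>' \<noteq> abs_proj (tln x1))
       = abs_proj (tln x2)"
    proof (rule the_equality)
      show "abs_proj (tln x2) \<in> dual_conic ?B \<and> on_line (abs_proj (pt x1 x2)) (abs_proj (tln x2)) \<and>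
          abs_proj (tln x2) \<noteq> abs_proj (tln x1)"
        using False assms x2 by (auto simp: tln_in_dual on_line_abs dot3_tln_pt abs_tln_eq_iff br_commute_0)
    next
      fix \<xi>'
      assume \<xi>': "\<xi>' \<in> dual_conic ?B \<and> on_line (abs_proj (pt x1 x2)) \<xi>' \<and> \<xi>' \<noteq> abs_proj (tln x1)"
      then obtain z where z: "z \<noteq> 0" "\<xi>' = abs_proj (tln z)" by (auto simp: dual_conic_b_iff)
      have "br z x1 = 0 \<or> br z x2 = 0"
        using \<xi>' z assms x2 two by (simp add: on_line_abs dot3_tln_pt)
      then show "\<xi>' = abs_proj (tln x2)"
        using \<xi>' z assms x2 by (auto simp: abs_tln_eq_iff)
    qed
    then show ?thesis using nB by (simp add: other_tangent_def)
  qed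
  have "poncelet_map ?A ?B (abs_proj (pt x0 x1), abs_proj (tln x1)) = (abs_proj (pt x1 x2), abs_proj (tln x2))"
    by (simp add: poncelet_map_def Let_def P' L')
  then show ?thesis using that x2 f by blast
qed

lemma poncelet_curve_iff:
  "(P, \<xi>) \<in> poncelet_curve (abs_proj a) (abs_proj b) \<longleftrightarrow>
     (\<exists>x0 x1. x0 \<noteq> 0 \<and> x1 \<noteq> 0 \<and> inc x1 x0 = 0 \<and> P = abs_proj (pt x0 x1) \<and> \<xi> = abs_proj (tln x1))"
proof
  assume *: "(P, \<xi>) \<in> poncelet_curve (abs_proj a) (abs_proj b)"
  then obtain x1 where x1: "x1 \<noteq> 0" "\<xi> = abs_proj (tln x1)"
    by (auto simp: poncelet_curve_def dual_conic_b_iff)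
  obtain v where v: "v \<noteq> 0" "P = abs_proj v" by (cases P)
  have v0: "qform a v = 0" "dot3 (tln x1) v = 0"
    using * v x1 a_nz by (simp_all add: poncelet_curve_def conic_points_def on_conic_abs on_line_abs)
  obtain y where y: "v = pt x1 y" using on_tln_iff[OF x1(1) v0(2)] .
  then show "\<exists>x0 x1. x0 \<noteq> 0 \<and> x1 \<noteq> 0 \<and> inc x1 x0 = 0 \<and> P = abs_proj (pt x0 x1) \<and> \<xi> = abs_proj (tln x1)"
    using v x1 v0 by (intro exI[of _ y] exI[of _ x1]) (auto simp: inc_def pt_commute)
next
  assume "\<exists>x0 x1. x0 \<noteq> 0 \<and> x1 \<noteq> 0 \<and> inc x1 x0 = 0 \<and> P = abs_proj (pt x0 x1) \<and> \<xi> = abs_proj (tln x1)"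
  then obtain x0 x1 where x: "x0 \<noteq> 0" "x1 \<noteq> 0" "inc x1 x0 = 0" "P = abs_proj (pt x0 x1)" "\<xi> = abs_proj (tln x1)"
    by blast
  then show "(P, \<xi>) \<in> poncelet_curve (abs_proj a) (abs_proj b)"
    using a_nz
    by (auto simp: poncelet_curve_def conic_points_def tln_in_dual on_conic_abs on_line_abs
        dot3_tln_pt inc_def pt_commute[of x1 x0])
qed

end

lemma card_4_iff: "card {p, q, r, s} = 4 \<longleftrightarrow> p \<noteq> q \<and> p \<noteq> r \<and> p \<noteq> s \<and> q \<noteq> r \<and> q \<noteq> s \<and> r \<noteq> s"
  by (auto simp: card_insert_if)

section \<open>Transversality and the closing condition\<close>

context poncelet_frame
begin

lemma common_points_iff:
  assumes "z \<noteq> 0"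
  shows "abs_proj (pt z z) \<in> conic_points (abs_proj a) \<inter> conic_points (abs_proj b) \<longleftrightarrow> quart_of a' z = 0"
proof -
  have "(4::'a) \<noteq> 0" using two by (metis mult_eq_0_iff numeral_Bit0_eq_double numeral_One)
  then show ?thesis
    using assms a_nz b_nz inc_diag[of z] by (auto simp: conic_points_def on_conic_abs qform_b_pt inc_def)
qed

lemma common_points_cases:
  assumes "P \<in> conic_points (abs_proj b)"
  obtains z where "z \<noteq> 0" "P = abs_proj (pt z z)"
proof -
  obtain v where v: "v \<noteq> 0" "P = abs_proj v" by (cases P)
  then have "qform b v = 0" using assms b_nz by (simp add: conic_points_def on_conic_abs)
  then obtain x c where "x \<noteq> 0" "c \<noteq> 0" "v = c *s pt x x" using on_conic_b_iff v by blast
  then show ?thesis using that[of x] v abs_proj_scale[of c "pt x x"] by simp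
qed

text \<open>The common points are the \<open>pt z z\<close> for the roots \<open>z\<close> of the
  quartic, so there are four of them when all six brackets of roots are nonzero.\<close>

lemma transversal_iff:
  assumes three: "(3::'a) \<noteq> 0"
  shows "card (conic_points (abs_proj a) \<inter> conic_points (abs_proj b)) = 4 \<longleftrightarrow> quart_disc a' \<noteq> 0"
proof -
  let ?S = "conic_points (abs_proj a) \<inter> conic_points (abs_proj b)"
  obtain k z1 z2 z3 z4 where z: "z1 \<noteq> 0" "z2 \<noteq> 0" "z3 \<noteq> 0" "z4 \<noteq> 0"
    and f: "\<And>x. quart_of a' x = k * (br x z1 * br x z2 * br x z3 * br x z4)"
    and d: "quart_disc a' =
       27 * (k^3 * (br z1 z2 * br z3 z4 * br z1 z3 * br z4 z2 * br z1 z4 * br z2 z3))^2"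
    using bquart_factor[of "a'$1" "a'$4" "a'$2 + a'$5" "a'$6" "a'$3"]
    unfolding quart_of_def quart_disc_def by metis
  have 27: "(27::'a) \<noteq> 0"
  proof -
    have "(27::'a) = 3 * (3 * 3)" by simp
    then show ?thesis using three by (metis mult_eq_0_iff)
  qed
  show ?thesis
  proof (cases "k = 0")
    case True
    then have q0: "quart_of a' x = 0" for x by (simp add: f)
    have "inj (\<lambda>t. abs_proj (pt (t, 1) (t, 1)))"
      by (rule injI, subst (asm) abs_pt_diag_eq_iff) (auto simp: prod_eq_iff br_def)
    then have "infinite (range (\<lambda>t. abs_proj (pt (t, 1) (t, 1))))"
      using infinite_alg_closed finite_imageD by blast
    moreover have "range (\<lambda>t. abs_proj (pt (t, 1) (t, 1))) \<subseteq> ?S"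
      using common_points_iff q0 by (auto simp: prod_eq_iff)
    ultimately have "infinite ?S" using finite_subset by blast
    \<comment> \<open>An infinite set has \<open>card\<close> 0, and the discriminant contains the
      factor \<open>k\<close>: both sides are false.\<close>
    then show ?thesis using True d by simp
  next
    case False
    have "?S = (\<lambda>z. abs_proj (pt z z)) ` {z1, z2, z3, z4}" (is "_ = ?p ` ?Z")
    proof
      show "?p ` ?Z \<subseteq> ?S"
        using common_points_iff[OF z(1)] common_points_iff[OF z(2)] common_points_iff[OF z(3)]
          common_points_iff[OF z(4)] by (simp add: f)
    next
      show "?S \<subseteq> ?p ` ?Z"
      proof
        fix P assume P: "P \<in> ?S"
        then obtain y where y: "y \<noteq> 0" "P = abs_proj (pt y y)" using common_points_cases by blast
        then have "quart_of a' y = 0" using P common_points_iff by blast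
        then have "br y z1 = 0 \<or> br y z2 = 0 \<or> br y z3 = 0 \<or> br y z4 = 0" using f False by auto
        then show "P \<in> ?p ` ?Z" using y z by (auto simp: abs_pt_diag_eq_iff)
      qed
    qed
    then have "card ?S = 4 \<longleftrightarrow>
        br z1 z2 \<noteq> 0 \<and> br z1 z3 \<noteq> 0 \<and> br z1 z4 \<noteq> 0 \<and> br z2 z3 \<noteq> 0 \<and> br z2 z4 \<noteq> 0 \<and> br z3 z4 \<noteq> 0"
      using z by (simp add: card_4_iff abs_pt_diag_eq_iff)
    also have "\<dots> \<longleftrightarrow> quart_disc a' \<noteq> 0"
      using False 27 by (auto simp: d br_commute_0[of z4 z2])
    finally show ?thesis .
  qed
qed

lemma finite_quart_roots:
  assumes "quart_disc a' \<noteq> 0"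
  obtains z1 z2 z3 z4 where "z1 \<noteq> 0" "z2 \<noteq> 0" "z3 \<noteq> 0" "z4 \<noteq> 0"
    "\<And>x. inc x x = 0 \<longleftrightarrow> br x z1 = 0 \<or> br x z2 = 0 \<or> br x z3 = 0 \<or> br x z4 = 0"
proof -
  obtain k z1 z2 z3 z4 where z: "z1 \<noteq> 0" "z2 \<noteq> 0" "z3 \<noteq> 0" "z4 \<noteq> 0"
    and f: "\<And>x. quart_of a' x = k * (br x z1 * br x z2 * br x z3 * br x z4)"
    and d: "quart_disc a' =
       27 * (k^3 * (br z1 z2 * br z3 z4 * br z1 z3 * br z4 z2 * br z1 z4 * br z2 z3))^2"
    using bquart_factor[of "a'$1" "a'$4" "a'$2 + a'$5" "a'$6" "a'$3"]
    unfolding quart_of_def quart_disc_def by metis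
  have "(4::'a) \<noteq> 0" using two by (metis mult_eq_0_iff numeral_Bit0_eq_double numeral_One)
  moreover have "k \<noteq> 0" using assms d by auto
  ultimately show ?thesis using that[OF z] by (simp add: inc_diag f)
qed

text \<open>By symmetry of \<open>inc\<close>, the derivative of \<open>inc x x\<close> is twice the
  partial derivative in one argument. The latter vanishes at a double root, so \<open>x\<close> is a
  multiple root of the quartic.\<close>

lemma quart_disc_double_neighbour:
  assumes "x \<noteq> 0" and f: "\<And>y. inc x y = c * br y x * br y x"
  shows "quart_disc a' = 0"
proof -
  obtain s t where x: "x = (s, t)" by (cases x)
  define p q r where "p = 4 * a'$1 * s^2 + a'$2 * t^2 + 2 * a'$4 * s * t"
    and "q = 2 * a'$2 * s * t + 2 * a'$4 * s^2 + 4 * a'$5 * s * t + 2 * a'$6 * t^2"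
    and "r = a'$2 * s^2 + 4 * a'$3 * t^2 + 2 * a'$6 * s * t"
  note pqr = this
  have e: "p = c * t * t" "q = - c * (s * t + s * t)" "r = c * s * s"
    using inc_coeffs[OF f] unfolding pqr x by simp_all
  have "2 * (4 * a'$1 * s^3 + 3 * a'$4 * s^2 * t + 2 * (a'$2 + a'$5) * s * t^2 + a'$6 * t^3)
      = 2 * p * s + q * t"
    unfolding pqr by (simp add: algebra_simps power2_eq_square power3_eq_cube)
  also have "\<dots> = 0" unfolding e by (simp add: algebra_simps)
  finally have 1: "4 * a'$1 * s^3 + 3 * a'$4 * s^2 * t + 2 * (a'$2 + a'$5) * s * t^2 + a'$6 * t^3 = 0"
    using two by (metis mult_eq_0_iff)
  have "2 * (a'$4 * s^3 + 2 * (a'$2 + a'$5) * s^2 * t + 3 * a'$6 * s * t^2 + 4 * a'$3 * t^3)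
      = q * s + 2 * r * t"
    unfolding pqr by (simp add: algebra_simps power2_eq_square power3_eq_cube)
  also have "\<dots> = 0" unfolding e by (simp add: algebra_simps)
  finally have 2: "a'$4 * s^3 + 2 * (a'$2 + a'$5) * s^2 * t + 3 * a'$6 * s * t^2 + 4 * a'$3 * t^3 = 0"
    using two by (metis mult_eq_0_iff)
  show ?thesis
    unfolding quart_disc_def using disc4_double_root[OF _ 1 2 two] assms(1) x by (simp add: zero_prod_def)
qed

text \<open>Periodicity makes the two neighbours of each parameter adjacent. If
  \<open>triangle_form a'\<close> were nonzero, \<open>inc_neighbours\<close> would then make every
  parameter adjacent to itself.\<close>

lemma triangle_form_0_if_periodic:
  assumes disc: "quart_disc a' \<noteq> 0"
    and e: "e \<in> poncelet_curve (abs_proj a) (abs_proj b)"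
    and per: "(poncelet_map (abs_proj a) (abs_proj b) ^^ 3) e = e"
  shows "triangle_form a' = 0"
proof (rule ccontr)
  assume nz: "triangle_form a' \<noteq> 0"
  let ?j = "poncelet_map (abs_proj a) (abs_proj b)"
  obtain x0 x1 where x: "x0 \<noteq> 0" "x1 \<noteq> 0" "inc x1 x0 = 0"
    and ee: "e = (abs_proj (pt x0 x1), abs_proj (tln x1))"
    using e poncelet_curve_iff by (cases e) auto
  obtain x2 c1 where x2: "x2 \<noteq> 0" "c1 \<noteq> 0" and f1: "\<And>y. inc x1 y = c1 * br y x0 * br y x2"
    and j1: "?j (abs_proj (pt x0 x1), abs_proj (tln x1)) = (abs_proj (pt x1 x2), abs_proj (tln x2))"
    using poncelet_map_pt[OF x] by metis
  have "inc x2 x1 = 0" using f1[of x2] by (simp add: inc_commute)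
  then obtain x3 c2 where x3: "x3 \<noteq> 0" "c2 \<noteq> 0" and f2: "\<And>y. inc x2 y = c2 * br y x1 * br y x3"
    and j2: "?j (abs_proj (pt x1 x2), abs_proj (tln x2)) = (abs_proj (pt x2 x3), abs_proj (tln x3))"
    using poncelet_map_pt[OF x(2) x2(1)] by metis
  have "inc x3 x2 = 0" using f2[of x3] by (simp add: inc_commute)
  then obtain x4 c3 where x4: "x4 \<noteq> 0" "c3 \<noteq> 0" and f3: "\<And>y. inc x3 y = c3 * br y x2 * br y x4"
    and j3: "?j (abs_proj (pt x2 x3), abs_proj (tln x3)) = (abs_proj (pt x3 x4), abs_proj (tln x4))"
    using poncelet_map_pt[OF x2(1) x3(1)] by metis
  have "(?j ^^ 3) e = (abs_proj (pt x3 x4), abs_proj (tln x4))"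
    by (simp add: numeral_3_eq_3 ee j1 j2 j3)
  with per ee have eq: "abs_proj (pt x3 x4) = abs_proj (pt x0 x1)" "abs_proj (tln x4) = abs_proj (tln x1)"
    by simp_all
  have b41: "br x4 x1 = 0" using eq(2) x x4 by (simp add: abs_tln_eq_iff)
  have b30: "br x3 x0 = 0"
  proof -
    have "abs_proj (pt x3 x1) = abs_proj (pt x0 x1)"
      using eq(1) abs_pt_eq[OF b41 x4(1) x(2) x3(1)] by simp
    then obtain c where c: "c \<noteq> 0" "pt x0 x1 = c *s pt x3 x1"
      using x x3 by (subst (asm) abs_proj_eq_iff) auto
    have "pt x1 (fst x0 + fst (- c * fst x3, - c * snd x3), snd x0 + snd (- c * fst x3, - c * snd x3)) = 0"
      unfolding pt_add pt_scale using c(2) by (simp add: pt_commute[of x0] pt_commute[of x3])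
    then have "fst x0 = c * fst x3" "snd x0 = c * snd x3" using x(2) by (auto simp: prod_eq_iff)
    then show ?thesis by (simp add: br_def)
  qed
  have "inc x0 x2 = 0"
    using f3[of x2] inc_eq_0_cong[OF b30 x3(1) x(1), of x2] by (simp add: inc_commute)
  then have s1: "inc x1 x1 = 0" using inc_neighbours[OF f1] nz by simp
  have "inc x1 x3 = 0"
    using f1[of x0] inc_eq_0_cong[OF b30 x3(1) x(1), of x1] by simp
  then have s2: "inc x2 x2 = 0" using inc_neighbours[OF f2] nz by simp
  have "inc x2 x4 = 0"
    using f2[of x1] inc_eq_0_cong[OF b41 x4(1) x(2), of x2] by simp
  then have s3: "inc x3 x3 = 0" using inc_neighbours[OF f3] nz by simp
  \<comment> \<open>A parameter adjacent to itself equals one of its two neighbours. When each of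
    three points equals one of the other two, all three agree, and \<open>inc x1\<close> has the
    double root \<open>x1\<close>.\<close>
  have 1: "br x1 x0 = 0 \<or> br x1 x2 = 0" using s1 f1 x2 by simp
  have 2: "br x2 x1 = 0 \<or> br x2 x0 = 0"
    using s2 f2[of x2] x3 br_eq_0_trans[OF _ b30, of x2] by auto
  have 3: "br x0 x2 = 0 \<or> br x0 x1 = 0"
  proof -
    have "br x3 x2 = 0 \<or> br x3 x4 = 0" using s3 f3[of x3] x4 by simp
    moreover have b03: "br x0 x3 = 0" using b30 br_commute_0 by blast
    moreover have "br x0 x4 = 0 \<Longrightarrow> br x0 x1 = 0" by (rule br_eq_0_trans[OF _ b41 x4(1)])
    ultimately show ?thesis
      using br_eq_0_trans[OF b03 _ x3(1)] by blast
  qed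
  have "br x1 x0 = 0 \<and> br x1 x2 = 0"
  proof -
    note sym = br_commute_0[of x1 x0] br_commute_0[of x2 x0] br_commute_0[of x2 x1]
    have "br x1 x0 = 0 \<Longrightarrow> br x0 x2 = 0 \<Longrightarrow> br x1 x2 = 0"
      "br x1 x2 = 0 \<Longrightarrow> br x2 x0 = 0 \<Longrightarrow> br x1 x0 = 0"
      by (rule br_eq_0_trans, assumption+, rule x x2)+
    then show ?thesis using 1 2 3 sym by argo
  qed
  then obtain d0 d2 where d: "x0 = (d0 * fst x1, d0 * snd x1)" "x2 = (d2 * fst x1, d2 * snd x1)"
    using br_eq_0D[of x1 x0] br_eq_0D[of x1 x2] x x2 by metis
  have "inc x1 y = (c1 * d0 * d2) * br y x1 * br y x1" for y
    unfolding f1 d by (simp add: br_def algebra_simps)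
  then have "quart_disc a' = 0" by (rule quart_disc_double_neighbour[OF x(2)])
  with disc show False ..
qed

lemma finite_inc_roots:
  assumes "x \<noteq> 0"
  shows "finite {t. inc x (t, 1) = 0}"
proof -
  obtain u v c where u: "u \<noteq> 0" "v \<noteq> 0" "c \<noteq> 0" "\<And>y. inc x y = c * br y u * br y v"
    using inc_factor[OF assms] by metis
  have "t = fst w / snd w" if "br (t, 1) w = 0" "w \<noteq> 0" for t :: 'a and w
    using that by (cases "snd w = 0") (auto simp: br_def field_simps prod_eq_iff)
  then have "{t. inc x (t, 1) = 0} \<subseteq> {fst u / snd u, fst v / snd v}" using u by auto
  then show ?thesis by (rule finite_subset) simp
qed

text \<open>The neighbours \<open>x0\<close> and \<open>x2\<close> of a parameter \<open>x1\<close>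
  are adjacent to each other. If the three are distinct, each has exactly the other two as
  neighbours, and the shift has to return after three steps.\<close>

lemma periodic_if_triangle_form_0:
  assumes disc: "quart_disc a' \<noteq> 0" and q0: "triangle_form a' = 0"
  shows "\<exists>e \<in> poncelet_curve (abs_proj a) (abs_proj b).
    (poncelet_map (abs_proj a) (abs_proj b) ^^ 3) e = e"
proof -
  let ?j = "poncelet_map (abs_proj a) (abs_proj b)"
  obtain z1 z2 z3 z4 where z: "z1 \<noteq> 0" "z2 \<noteq> 0" "z3 \<noteq> 0" "z4 \<noteq> 0"
    and r: "\<And>x. inc x x = 0 \<longleftrightarrow> br x z1 = 0 \<or> br x z2 = 0 \<or> br x z3 = 0 \<or> br x z4 = 0"
    using finite_quart_roots[OF disc] by metis
  \<comment> \<open>The values to be avoided: neighbours of the roots of the quartic, and then these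
    roots themselves.\<close>
  have "finite (\<Union>w\<in>{z1, z2, z3, z4}. {t. inc w (t, 1) = 0})" using z finite_inc_roots by auto
  moreover have "finite {t :: 'a. inc (t, 1) (t, 1) = 0}"
  proof -
    have "t = fst w / snd w" if "br (t, 1) w = 0" "w \<noteq> 0" for t :: 'a and w
      using that by (cases "snd w = 0") (auto simp: br_def field_simps prod_eq_iff)
    then have "{t. inc (t, 1) (t, 1) = 0} \<subseteq> (\<lambda>w. fst w / snd w) ` {z1, z2, z3, z4}" using r z by auto
    then show ?thesis by (rule finite_subset) simp
  qed
  ultimately have "finite ((\<Union>w\<in>{z1, z2, z3, z4}. {t. inc w (t, 1) = 0}) \<union> {t :: 'a. inc (t, 1) (t, 1) = 0})"
    by (rule finite_UnI)
  from ex_new_if_finite[OF infinite_alg_closed this] obtain t where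
    t: "t \<notin> (\<Union>w\<in>{z1, z2, z3, z4}. {t. inc w (t, 1) = 0}) \<union> {t :: 'a. inc (t, 1) (t, 1) = 0}"
    by blast
  define x1 where "x1 = (t, 1 :: 'a)"
  have x1: "x1 \<noteq> 0" "inc x1 x1 \<noteq> 0"
    and ni: "inc z1 x1 \<noteq> 0" "inc z2 x1 \<noteq> 0" "inc z3 x1 \<noteq> 0" "inc z4 x1 \<noteq> 0"
    using t by (simp_all add: x1_def prod_eq_iff)
  have root_ni: "inc w w \<noteq> 0" if "inc w x1 = 0" "w \<noteq> 0" for w
  proof
    assume "inc w w = 0"
    then consider "br w z1 = 0" | "br w z2 = 0" | "br w z3 = 0" | "br w z4 = 0" using r by blast
    then show False
      using that ni z inc_eq_0_cong[of w _ x1] by cases (simp_all add: inc_commute[of _ x1])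
  qed
  obtain x0 x2 c where x: "x0 \<noteq> 0" "x2 \<noteq> 0" "c \<noteq> 0" and f: "\<And>y. inc x1 y = c * br y x0 * br y x2"
    using inc_factor[OF x1(1)] by metis
  have i02: "inc x0 x2 = 0" using inc_neighbours[OF f] q0 x by simp
  have i10: "inc x1 x0 = 0" and i12: "inc x1 x2 = 0" by (simp_all add: f)
  have b: "br x1 x0 \<noteq> 0" "br x1 x2 \<noteq> 0" using x1(2) f by auto
  \<comment> \<open>Equal neighbours would make \<open>x0\<close> a root of the quartic adjacent to
    \<open>x1\<close>, which the choice of \<open>x1\<close> excludes.\<close>
  have b02: "br x0 x2 \<noteq> 0"
  proof
    assume "br x0 x2 = 0"
    then have "inc x0 x0 = 0" using inc_eq_0_cong i02 x by blast
    then show False using root_ni i10 x inc_commute by metis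
  qed
  obtain y2 c1 where y2: "y2 \<noteq> 0" "c1 \<noteq> 0" and f1: "\<And>y. inc x1 y = c1 * br y x0 * br y y2"
    and j1: "?j (abs_proj (pt x0 x1), abs_proj (tln x1)) = (abs_proj (pt x1 y2), abs_proj (tln y2))"
    using poncelet_map_pt[OF x(1) x1(1) i10] by metis
  have b22: "br x2 y2 = 0" using f1[of x2] i12 y2 b02 by (simp add: br_commute_0[of x2 x0])
  have i20: "inc y2 x0 = 0" using i02 inc_eq_0_cong[OF b22 x(2) y2(1)] inc_commute by metis
  have i21: "inc y2 x1 = 0" using f1[of y2] by (simp add: inc_commute)
  have b12: "br x1 y2 \<noteq> 0" using b(2) b22 br_eq_0_trans[of x1 y2 x2] y2 by (auto simp: br_commute_0[of y2])
  obtain y3 c2 where y3: "y3 \<noteq> 0" "c2 \<noteq> 0" and f2: "\<And>y. inc y2 y = c2 * br y x1 * br y y3"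
    and j2: "?j (abs_proj (pt x1 y2), abs_proj (tln y2)) = (abs_proj (pt y2 y3), abs_proj (tln y3))"
    using poncelet_map_pt[OF x1(1) y2(1) i21] by metis
  have b03: "br x0 y3 = 0" using f2[of x0] i20 y3 b(1) by (simp add: br_commute_0[of x0 x1])
  have i31: "inc y3 x1 = 0" using i10 inc_eq_0_cong[OF b03 x(1) y3(1)] inc_commute by metis
  have i32: "inc y3 y2 = 0" using f2[of y3] by (simp add: inc_commute)
  obtain y4 c3 where y4: "y4 \<noteq> 0" "c3 \<noteq> 0" and f3: "\<And>y. inc y3 y = c3 * br y y2 * br y y4"
    and j3: "?j (abs_proj (pt y2 y3), abs_proj (tln y3)) = (abs_proj (pt y3 y4), abs_proj (tln y4))"
    using poncelet_map_pt[OF y2(1) y3(1) i32] by metis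
  have b14: "br x1 y4 = 0" using f3[of x1] i31 y4 b12 by simp
  have "abs_proj (tln y4) = abs_proj (tln x1)"
    using b14 y4 x1 abs_tln_eq_iff by metis
  moreover have "abs_proj (pt y3 y4) = abs_proj (pt x0 x1)"
    using abs_pt_eq[OF b14 x1(1) y4(1) y3(1)] abs_pt_eq[OF b03 x(1) y3(1) x1(1)]
    by (simp add: pt_commute[of x0] pt_commute[of y3 x1])
  ultimately have "(?j ^^ 3) (abs_proj (pt x0 x1), abs_proj (tln x1)) = (abs_proj (pt x0 x1), abs_proj (tln x1))"
    by (simp add: numeral_3_eq_3 j1 j2 j3)
  moreover have "(abs_proj (pt x0 x1), abs_proj (tln x1)) \<in> poncelet_curve (abs_proj a) (abs_proj b)"
    using poncelet_curve_iff x x1 i10 by blast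
  ultimately show ?thesis by blast
qed

end

subsection \<open>Counting points over a finite field\<close>

lemma card_Collect_bij:
  assumes "\<And>x. P x \<Longrightarrow> Q (f x) \<and> g (f x) = x" and "\<And>y. Q y \<Longrightarrow> P (g y) \<and> f (g y) = y"
  shows "card {x. P x} = card {y. Q y}"
  by (rule bij_betw_same_card[OF bij_betw_byWitness[of _ g f]]) (use assms in auto)

lemma card_Collect_prod:
  "card {p :: 'a::finite \<times> 'b::finite. P (fst p) (snd p)} = (\<Sum>x\<in>UNIV. card {y. P x y})"
proof -
  have "{p :: 'a \<times> 'b. P (fst p) (snd p)} = (SIGMA x:UNIV. {y. P x y})" by auto
  then show ?thesis by simp
qed

text \<open>The shape of most counts below: the coordinates are split so that the fibres over all
  nonzero prefixes have one common size.\<close>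

lemma card_Collect_prefix:
  fixes P :: "'a::{finite,zero} \<Rightarrow> 'b::finite \<Rightarrow> bool"
  assumes "card {y. P 0 y} = m" "\<And>x. x \<noteq> 0 \<Longrightarrow> card {y. P x y} = n"
  shows "card {p. P (fst p) (snd p)} = m + (CARD('a) - 1) * n"
proof -
  have "card {p. P (fst p) (snd p)} = (\<Sum>x\<in>UNIV. card {y. P x y})" by (rule card_Collect_prod)
  also have "\<dots> = card {y. P 0 y} + (\<Sum>x\<in>UNIV - {0}. card {y. P x y})"
    by (rule sum.remove) auto
  also have "(\<Sum>x\<in>UNIV - {0}. card {y. P x y}) = (\<Sum>x\<in>UNIV - {0 :: 'a}. n)"
    by (rule sum.cong) (use assms in auto)
  finally show ?thesis using assms by (simp add: card_Diff_singleton)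
qed

lemma card_linear3:
  fixes x y z w :: "'k::{field,finite}"
  assumes "\<not> (x = 0 \<and> y = 0 \<and> z = 0)"
  shows "card {(a, b, c). x * a + y * b + z * c = w} = CARD('k)^2"
proof -
  have *: "card {(a, b, c). x * a + y * b + z * c = w} = CARD('k)^2" if "x \<noteq> 0" for x y z :: 'k
  proof -
    have "card {(a, b, c). x * a + y * b + z * c = w} = card {_ :: 'k \<times> 'k. True}"
      by (rule card_Collect_bij[of _ _ snd "\<lambda>(b, c). ((w - y * b - z * c) / x, b, c)"])
        (use that in \<open>auto simp: field_simps\<close>)
    then show ?thesis by (simp add: power2_eq_square)
  qed
  consider "x \<noteq> 0" | "y \<noteq> 0" | "z \<noteq> 0" using assms by blast
  then show ?thesis
  proof cases
    case 2
    have "card {(a, b, c). x * a + y * b + z * c = w} = card {(b, a, c). y * b + x * a + z * c = w}"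
      by (rule card_Collect_bij[of _ _ "\<lambda>(a, b, c). (b, a, c)" "\<lambda>(a, b, c). (b, a, c)"]) (auto simp: ac_simps)
    then show ?thesis using *[OF 2] by simp
  next
    case 3
    have "card {(a, b, c). x * a + y * b + z * c = w} = card {(c, b, a). z * c + y * b + x * a = w}"
      by (rule card_Collect_bij[of _ _ "\<lambda>(a, b, c). (c, b, a)" "\<lambda>(a, b, c). (c, b, a)"]) (auto simp: ac_simps)
    then show ?thesis using *[OF 3] by simp
  qed (rule *)
qed

lemma card_quadric_cone: "card {(u, v, w :: 'k::{field,finite}). u * v = w^2} = CARD('k)^2"
proof -
  have "card {p :: 'k \<times> 'k \<times> 'k. fst p * fst (snd p) = (snd (snd p))^2} =
      CARD('k) + (CARD('k) - 1) * CARD('k)"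
  proof (rule card_Collect_prefix[where P = "\<lambda>u p. u * fst p = (snd p)^2"])
    have "card {p :: 'k \<times> 'k. 0 * fst p = (snd p)^2} = card {_ :: 'k. True}"
      by (rule card_Collect_bij[of _ _ fst "\<lambda>v. (v, 0)"]) (auto simp: prod_eq_iff)
    then show "card {p :: 'k \<times> 'k. 0 * fst p = (snd p)^2} = CARD('k)" by simp
  next
    fix u :: 'k assume u: "u \<noteq> 0"
    have "card {p :: 'k \<times> 'k. u * fst p = (snd p)^2} = card {_ :: 'k. True}"
      by (rule card_Collect_bij[of _ _ snd "\<lambda>w. (w^2 / u, w)"]) (use u in \<open>auto simp: prod_eq_iff field_simps\<close>)
    then show "card {p :: 'k \<times> 'k. u * fst p = (snd p)^2} = CARD('k)" by simp
  qed
  moreover have "CARD('k) + (CARD('k) - 1) * CARD('k) = CARD('k)^2"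
    by (cases "CARD('k)") (auto simp: power2_eq_square)
  ultimately show ?thesis by (simp add: case_prod_unfold)
qed

lemma vec6_eta [simp]: "vec6 (a$1) (a$2) (a$3) (a$4) (a$5) (a$6) = a"
  by (simp add: vec_eq_iff forall_6)

lemma prefix3_count:
  assumes "n > (0::nat)"
  shows "n^3 + (n * (n * n) - Suc 0) * n^2 = n^5 + n^3 - n^2"
proof -
  obtain m where "n = Suc m" using assms by (cases n) auto
  then have "n^5 + n^3 = n^3 + (n * (n * n) - 1) * n^2 + n^2"
    by (simp add: algebra_simps power2_eq_square power3_eq_cube eval_nat_numeral)
  then show ?thesis by simp
qed

text \<open>For fixed \<open>a1\<close>, \<open>a2\<close>, \<open>a4\<close> the equation is affine
  linear in the other three coefficients, and it is trivial only if these three vanish.\<close>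

lemma card_triangle_form_0:
  assumes two: "(2::'k::{field,finite}) \<noteq> 0"
  shows "card {a :: 'k ^ 6. triangle_form a = 0} = CARD('k)^5 + CARD('k)^3 - CARD('k)^2"
proof -
  have four: "(4::'k) \<noteq> 0" "(16::'k) \<noteq> 0"
  proof -
    have "(4::'k) = 2 * 2" "(16::'k) = 2 * (2 * (2 * 2))" by simp_all
    then show "(4::'k) \<noteq> 0" "(16::'k) \<noteq> 0" using two by (metis mult_eq_0_iff)+
  qed
  define P where "P = (\<lambda>(a1, a2, a4) (a3, a5, a6). 16 * a1 * a3 + 4 * a2 * a5 + (- 4 * a4) * a6 = - ((a2::'k)^2))"
  have "card {a :: 'k ^ 6. triangle_form a = 0} = card {p. P (fst p) (snd p)}"
  by (rule card_Collect_bij[of _ _ "\<lambda>a. ((a$1, a$2, a$4), (a$3, a$5, a$6))"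
        "\<lambda>((a1, a2, a4), (a3, a5, a6)). vec6 a1 a2 a3 a4 a5 a6"])
    (auto simp: P_def triangle_form_def eq_neg_iff_add_eq_0 algebra_simps)
  also have "\<dots> = CARD('k)^3 + (CARD('k \<times> 'k \<times> 'k) - 1) * CARD('k)^2"
  proof (rule card_Collect_prefix)
    show "card {y. P 0 y} = CARD('k)^3"
      by (simp add: P_def zero_prod_def case_prod_unfold power3_eq_cube)
  next
    fix x :: "'k \<times> 'k \<times> 'k" assume x: "x \<noteq> 0"
    obtain a1 a2 a4 where x': "x = (a1, a2, a4)" by (cases x)
    show "card {y. P x y} = CARD('k)^2"
      using card_linear3[of "16 * a1" "4 * a2" "- 4 * a4" "- (a2^2)"] x four
      by (simp add: P_def x' zero_prod_def)
  qed
  finally show ?thesis by (simp add: prefix3_count)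
qed

text \<open>The first row of the symmetric matrix is fixed. For \<open>a1 = 0\<close> the equation
  is linear in the remaining coefficients; for \<open>a1 \<noteq> 0\<close> it becomes a quadric
  cone.\<close>

lemma card_conic_det_0:
  assumes two: "(2::'k::{field,finite}) \<noteq> 0"
  shows "card {a :: 'k ^ 6. conic_det a = 0} = CARD('k)^5 + CARD('k)^3 - CARD('k)^2"
proof -
  have four: "(4::'k) \<noteq> 0"
  proof -
    have "(4::'k) = 2 * 2" by simp
    then show "(4::'k) \<noteq> 0" using two by (metis mult_eq_0_iff)
  qed
  define P where "P = (\<lambda>(a1, a4, a5) (a2, a3, a6).
    4 * a1 * a2 * a3 + a4 * a5 * a6 - a1 * a6^2 - a2 * a5^2 - a3 * a4^2 = (0::'k))"
  have "card {a :: 'k ^ 6. conic_det a = 0} = card {p. P (fst p) (snd p)}"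
  by (rule card_Collect_bij[of _ _ "\<lambda>a. ((a$1, a$4, a$5), (a$2, a$3, a$6))"
        "\<lambda>((a1, a4, a5), (a2, a3, a6)). vec6 a1 a2 a3 a4 a5 a6"])
    (auto simp: P_def conic_det_def)
  also have "\<dots> = CARD('k)^3 + (CARD('k \<times> 'k \<times> 'k) - 1) * CARD('k)^2"
  proof (rule card_Collect_prefix)
    show "card {y. P 0 y} = CARD('k)^3"
      by (simp add: P_def zero_prod_def case_prod_unfold power3_eq_cube)
  next
    fix x :: "'k \<times> 'k \<times> 'k" assume x: "x \<noteq> 0"
    obtain a1 a4 a5 where x': "x = (a1, a4, a5)" by (cases x)
    show "card {y. P x y} = CARD('k)^2"
    proof (cases "a1 = 0")
      case True
      have "P x = (\<lambda>(a2, a3, a6). (- (a5^2)) * a2 + (- (a4^2)) * a3 + (a4 * a5) * a6 = 0)"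
        by (auto simp: P_def x' True fun_eq_iff algebra_simps)
      then show ?thesis
        using card_linear3[of "- (a5^2)" "- (a4^2)" "a4 * a5" 0] x True by (auto simp: x' zero_prod_def)
    next
      case False
      \<comment> \<open>Completing the squares with respect to \<open>a1\<close> leaves the
        determinant of the Schur complement.\<close>
      have key: "4 * a1 * (4 * a1 * a2 * a3 + a4 * a5 * a6 - a1 * a6^2 - a2 * a5^2 - a3 * a4^2)
         = (4 * a1 * a2 - a4^2) * (4 * a1 * a3 - a5^2) - (2 * a1 * a6 - a4 * a5)^2" for a2 a3 a6 :: 'k
        by (simp add: algebra_simps power2_eq_square)
      have P_iff: "P x (a2, a3, a6) \<longleftrightarrow> (4 * a1 * a2 - a4^2) * (4 * a1 * a3 - a5^2) = (2 * a1 * a6 - a4 * a5)^2" for a2 a3 a6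
      proof -
        have "P x (a2, a3, a6) \<longleftrightarrow>
            4 * a1 * (4 * a1 * a2 * a3 + a4 * a5 * a6 - a1 * a6^2 - a2 * a5^2 - a3 * a4^2) = 0"
          using False four by (simp add: P_def x')
        then show ?thesis unfolding key by simp
      qed
      have "card {y. P x y} = card {(u, v, w :: 'k). u * v = w^2}"
        by (rule card_Collect_bij[of _ _ "\<lambda>(a2, a3, a6). (4 * a1 * a2 - a4^2, 4 * a1 * a3 - a5^2, 2 * a1 * a6 - a4 * a5)"
              "\<lambda>(u, v, w). ((u + a4^2) / (4 * a1), (v + a5^2) / (4 * a1), (w + a4 * a5) / (2 * a1))"])
          (use False four two in \<open>auto simp: P_iff\<close>)
      then show ?thesis by (simp add: card_quadric_cone)
    qed
  qed
  finally show ?thesis by (simp add: prefix3_count)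
qed

section \<open>Quartics with a multiple root\<close>

lemma invI_zero: "invI 0 0 c2 c3 c4 = c2^2"
  and invJ_zero: "invJ 0 0 c2 c3 c4 = - (2 * c2^3)"
  by (simp_all add: invI_def invJ_def)

text \<open>A shear removes the cubic term and keeps both invariants. For fixed \<open>c0\<close>
  and \<open>c1\<close> it permutes the triples of remaining coefficients, so the count is unchanged
  for any condition \<open>P\<close>.\<close>

lemma card_shear:
  fixes c0 c1 :: "'k::{field,finite}" and P :: "'k \<Rightarrow> 'k \<Rightarrow> 'k \<Rightarrow> bool"
  assumes "c0 \<noteq> 0" "(4::'k) \<noteq> 0"
  shows "card {((c2, c3, c4), r). P (invI c0 c1 c2 c3 c4) (invJ c0 c1 c2 c3 c4) r}
     = card {((c2, c3, c4), r). P (invI c0 0 c2 c3 c4) (invJ c0 0 c2 c3 c4) r}"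
proof -
  define w where "w = - c1 / (4 * c0)"
  have w: "c1 = - (4 * w * c0)" using assms by (simp add: w_def)
  have I: "invI c0 0 (c2 + 3*w*c1 + 6*w^2*c0) (c3 + 2*w*c2 + 3*w^2*c1 + 4*w^3*c0)
     (c4 + w*c3 + w^2*c2 + w^3*c1 + w^4*c0) = invI c0 c1 c2 c3 c4" for c2 c3 c4
    using invI_shear[of c0 c1 w c2 c3 c4] by (simp add: w)
  have J: "invJ c0 0 (c2 + 3*w*c1 + 6*w^2*c0) (c3 + 2*w*c2 + 3*w^2*c1 + 4*w^3*c0)
     (c4 + w*c3 + w^2*c2 + w^3*c1 + w^4*c0) = invJ c0 c1 c2 c3 c4" for c2 c3 c4
    using invJ_shear[of c0 c1 w c2 c3 c4] by (simp add: w)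
  define f where "f = (\<lambda>((c2, c3, c4), r::'k). ((c2 + 3*w*c1 + 6*w^2*c0, c3 + 2*w*c2 + 3*w^2*c1 + 4*w^3*c0,
     c4 + w*c3 + w^2*c2 + w^3*c1 + w^4*c0), r))"
  define g where "g = (\<lambda>((c2, c3, c4), r::'k). ((c2 + 6*w^2*c0, c3 - 2*w*c2 - 4*w^3*c0,
     c4 - w*c3 + w^2*c2 + w^4*c0), r))"
  have gf: "g (f x) = x" and fg: "f (g x) = x" for x
    by (auto simp: f_def g_def w algebra_simps power2_eq_square power3_eq_cube power4_eq_xxxx split: prod.splits)
  define Q where "Q = (\<lambda>c1 ((c2, c3, c4), r). P (invI c0 c1 c2 c3 c4) (invJ c0 c1 c2 c3 c4) r)"
  have Qf: "Q 0 (f x) = Q c1 x" for x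
    by (auto simp: Q_def f_def I J split: prod.splits)
  have "card {x. Q c1 x} = card {x. Q 0 x}"
    by (rule card_Collect_bij[of _ _ f g]) (simp_all add: gf fg Qf flip: Qf[of "g _"])
  then show ?thesis by (simp add: Q_def)
qed

lemma numerals_nz:
  assumes "(2::'a::idom) \<noteq> 0" "(3::'a) \<noteq> 0"
  shows "(4::'a) \<noteq> 0" "(8::'a) \<noteq> 0" "(12::'a) \<noteq> 0" "(27::'a) \<noteq> 0"
    "(6::'a) \<noteq> 0" "(9::'a) \<noteq> 0" "(36::'a) \<noteq> 0"
proof -
  have "(4::'a) = 2 * 2" "(8::'a) = 2 * (2 * 2)" "(12::'a) = 2 * (2 * 3)" "(27::'a) = 3 * (3 * 3)"
    "(6::'a) = 2 * 3" "(9::'a) = 3 * 3" "(36::'a) = 2 * (2 * (3 * 3))" by simp_all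
  then show "(4::'a) \<noteq> 0" "(8::'a) \<noteq> 0" "(12::'a) \<noteq> 0" "(27::'a) \<noteq> 0"
    "(6::'a) \<noteq> 0" "(9::'a) \<noteq> 0" "(36::'a) \<noteq> 0"
    using assms by (metis mult_eq_0_iff)+
qed

text \<open>A Whitney umbrella: \<open>w \<noteq> 0\<close> determines \<open>v\<close> from
  \<open>x\<close>, while \<open>w = 0\<close> forces \<open>x = 0\<close> and leaves
  \<open>v\<close> free.\<close>

lemma card_cusp_surface:
  fixes c :: "'k::{field,finite}"
  assumes "c \<noteq> 0"
  shows "card {(w, v, x). c * x^2 = w^2 * v} = CARD('k)^2"
proof -
  have "card {p :: 'k \<times> 'k \<times> 'k. c * (snd (snd p))^2 = (fst p)^2 * fst (snd p)} =
      CARD('k) + (CARD('k) - 1) * CARD('k)"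
  proof (rule card_Collect_prefix[where P = "\<lambda>w p. c * (snd p)^2 = w^2 * fst p"])
    have "card {p :: 'k \<times> 'k. c * (snd p)^2 = 0^2 * fst p} = card {_ :: 'k. True}"
      by (rule card_Collect_bij[of _ _ fst "\<lambda>v. (v, 0)"]) (use assms in \<open>auto simp: prod_eq_iff\<close>)
    then show "card {p :: 'k \<times> 'k. c * (snd p)^2 = 0^2 * fst p} = CARD('k)" by simp
  next
    fix w :: 'k assume w: "w \<noteq> 0"
    have "card {p :: 'k \<times> 'k. c * (snd p)^2 = w^2 * fst p} = card {_ :: 'k. True}"
      by (rule card_Collect_bij[of _ _ snd "\<lambda>x. (c * x^2 / w^2, x)"]) (use w in \<open>auto simp: prod_eq_iff field_simps\<close>)
    then show "card {p :: 'k \<times> 'k. c * (snd p)^2 = w^2 * fst p} = CARD('k)" by simp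
  qed
  moreover have "CARD('k) + (CARD('k) - 1) * CARD('k) = CARD('k)^2"
    by (cases "CARD('k)") (auto simp: power2_eq_square)
  ultimately show ?thesis by (simp add: case_prod_unfold)
qed

lemma card_cusp_curve:
  fixes h :: "'k::{field,finite}"
  assumes "h \<noteq> 0"
  shows "card {(x, y). h * y^2 = x^3} = CARD('k)"
proof -
  have "card {(x, y). h * y^2 = x^3} = card {_ :: 'k. True}"
  \<comment> \<open>The slope parametrises the cuspidal cubic. Since \<open>0 / 0 = 0\<close>, the
    formula also sends the cusp to the parameter 0.\<close>
  proof (rule card_Collect_bij[of _ _ "\<lambda>(x, y). y / x" "\<lambda>s. (h * s^2, h * s^3)"], goal_cases)
    case (1 p)
    obtain x y where p: "p = (x, y)" by (cases p)
    have eq: "h * y^2 = x^3" using 1 p by simp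
    show ?case
    proof (cases "x = 0")
      case True
      then show ?thesis using eq assms by (simp add: p)
    next
      case False
      have x: "h * (y / x)^2 = x"
        unfolding power_divide times_divide_eq_right eq using False
        by (simp add: power2_eq_square power3_eq_cube)
      have "h * (y / x)^3 = (h * (y / x)^2) * (y / x)"
        by (simp add: power2_eq_square power3_eq_cube)
      also have "\<dots> = y" unfolding x using False by simp
      finally show ?thesis using x by (simp add: p)
    qed
  next
    case (2 s)
    show ?case using assms by (auto simp: power2_eq_square power3_eq_cube)
  qed
  then show ?thesis by simp
qed

text \<open>The first equation eliminates \<open>c4\<close>. What remains of the second is the
  resolvent cubic \<open>e^3 - 3 r^2 e + 2 r^3\<close> at \<open>e = 2 * c2\<close>, which factors
  as \<open>(e - r)^2 (e + 2 r)\<close>.\<close>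

lemma depressed_double_root_iff:
  fixes c0 c2 c3 c4 r :: "'k::field"
  shows "invI c0 0 c2 c3 c4 = r^2 \<and> invJ c0 0 c2 c3 c4 = 2 * r^3 \<longleftrightarrow>
    12 * c0 * c4 = r^2 - c2^2 \<and> - (27 * c0) * c3^2 = (2 * c2 - r)^2 * (2 * (c2 + r))"
proof -
  have "invI c0 0 c2 c3 c4 = r^2 \<longleftrightarrow> 12 * c0 * c4 = r^2 - c2^2"
    by (auto simp: invI_def algebra_simps)
  moreover have "invJ c0 0 c2 c3 c4 = 2 * r^3 \<longleftrightarrow> - (27 * c0) * c3^2 = (2 * c2 - r)^2 * (2 * (c2 + r))"
    if c4: "12 * c0 * c4 = r^2 - c2^2"
  proof -
    have "invJ c0 0 c2 c3 c4 = 6 * c2 * (12 * c0 * c4) - 27 * c0 * c3^2 - 2 * c2^3"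
      by (simp add: invJ_def)
    also have "\<dots> = 2 * r^3 + (- (27 * c0) * c3^2 - (2 * c2 - r)^2 * (2 * (c2 + r)))"
      unfolding c4 by (simp add: algebra_simps power2_eq_square power3_eq_cube)
    finally show ?thesis by simp
  qed
  ultimately show ?thesis by blast
qed

text \<open>The double root \<open>r\<close> of the resolvent is carried along as an unknown. The
  pair \<open>(c0, c1)\<close> stands apart as a prefix, because the fibre over
  \<open>(0, 0)\<close> is larger than the others.\<close>

definition double_root_prop :: "'k::field \<times> 'k \<Rightarrow> ('k \<times> 'k \<times> 'k) \<times> 'k \<Rightarrow> bool" where
  "double_root_prop = (\<lambda>(c0, c1) ((c2, c3, c4), r). invI c0 c1 c2 c3 c4 = r^2 \<and> invJ c0 c1 c2 c3 c4 = 2 * r^3)"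

text \<open>Over \<open>c0 = c1 = 0\<close> the conditions say \<open>c2 = - r\<close>. If only
  \<open>c0\<close> vanishes, \<open>c2\<close> and \<open>r\<close> determine \<open>c3\<close> and
  \<open>c4\<close>. Otherwise a shear and the elimination of \<open>c4\<close> lead to the surface
  of \<open>card_cusp_surface\<close>.\<close>

lemma card_double_root:
  assumes two: "(2::'k::{field,finite}) \<noteq> 0" and three: "(3::'k) \<noteq> 0"
  shows "card {p :: ('k \<times> 'k) \<times> ('k \<times> 'k \<times> 'k) \<times> 'k. double_root_prop (fst p) (snd p)}
     = CARD('k)^3 + (CARD('k \<times> 'k) - 1) * CARD('k)^2"
proof (rule card_Collect_prefix)
  note nz = numerals_nz[OF two three]
  have "c2^2 = r^2 \<and> - (2 * c2^3) = 2 * r^3 \<longleftrightarrow> c2 = - r" for c2 r :: 'k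
  proof
    assume *: "c2^2 = r^2 \<and> - (2 * c2^3) = 2 * r^3"
    then have "c2 = r \<or> c2 = - r" by (simp add: power2_eq_iff)
    moreover have "r = 0" if "c2 = r"
    proof -
      have "4 * r^3 = 0" using * that by (simp add: algebra_simps eq_neg_iff_add_eq_0)
      then show ?thesis using nz by simp
    qed
    ultimately show "c2 = - r" by auto
  qed auto
  then have "card {y :: ('k \<times> 'k \<times> 'k) \<times> 'k. double_root_prop 0 y} = card {_ :: 'k \<times> 'k \<times> 'k. True}"
    by (intro card_Collect_bij[of _ _ "\<lambda>((c2, c3, c4), r). (c3, c4, r)" "\<lambda>(c3, c4, r). ((- r, c3, c4), r)"])
      (auto simp: double_root_prop_def zero_prod_def invI_zero invJ_zero)
  then show "card {y :: ('k \<times> 'k \<times> 'k) \<times> 'k. double_root_prop 0 y} = CARD('k)^3"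
    by (simp add: power3_eq_cube)
next
  note nz = numerals_nz[OF two three]
  fix x :: "'k \<times> 'k" assume x: "x \<noteq> 0"
  obtain c0 c1 where x': "x = (c0, c1)" by (cases x)
  show "card {y. double_root_prop x y} = CARD('k)^2"
  proof (cases "c0 = 0")
    case True
    then have c1: "c1 \<noteq> 0" using x by (simp add: x' zero_prod_def)
    have iff: "double_root_prop x ((c2, c3, c4), r) \<longleftrightarrow>
        c3 = (c2^2 - r^2) / (3 * c1) \<and> c4 = (3 * c2 * (c2^2 - r^2) - 2 * c2^3 - 2 * r^3) / (27 * c1^2)" for c2 c3 c4 r
    proof -
      have "invI c0 c1 c2 c3 c4 = r^2 \<longleftrightarrow> 3 * c1 * c3 = c2^2 - r^2"
        by (auto simp: invI_def True algebra_simps)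
      moreover have "invJ c0 c1 c2 c3 c4 = 2 * r^3 \<longleftrightarrow>
          27 * c1^2 * c4 = 3 * c2 * (c2^2 - r^2) - 2 * c2^3 - 2 * r^3" if "3 * c1 * c3 = c2^2 - r^2"
        unfolding that[symmetric] by (auto simp: invJ_def True algebra_simps)
      ultimately show ?thesis using c1 three nz by (auto simp: double_root_prop_def x' field_simps)
    qed
    have "card {y. double_root_prop x y} = card {_ :: 'k \<times> 'k. True}"
      by (rule card_Collect_bij[of _ _ "\<lambda>((c2, c3, c4), r). (c2, r)"
            "\<lambda>(c2, r). ((c2, (c2^2 - r^2) / (3 * c1), (3 * c2 * (c2^2 - r^2) - 2 * c2^3 - 2 * r^3) / (27 * c1^2)), r)"])
        (auto simp: iff)
    then show ?thesis by (simp add: power2_eq_square)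
  next
    case False
    have solve: "12 * c0 * c4 = z \<longleftrightarrow> c4 = z / (12 * c0)" for c4 z
      using False nz by (auto simp: field_simps)
    have "card {y. double_root_prop x y} =
       card {((c2, c3, c4), r). invI c0 c1 c2 c3 c4 = r^2 \<and> invJ c0 c1 c2 c3 c4 = 2 * r^3}"
      by (simp add: double_root_prop_def x')
    also have "\<dots> = card {((c2, c3, c4), r). invI c0 0 c2 c3 c4 = r^2 \<and> invJ c0 0 c2 c3 c4 = 2 * r^3}"
      by (rule card_shear) (use False nz in auto)
    also have "\<dots> = card {(c2, r, c3). - (27 * c0) * c3^2 = (2 * c2 - r)^2 * (2 * (c2 + r))}"
      unfolding depressed_double_root_iff solve
      by (rule card_Collect_bij[of _ _ "\<lambda>((c2, c3, c4), r). (c2, r, c3)"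
            "\<lambda>(c2, r, c3). ((c2, c3, (r^2 - c2^2) / (12 * c0)), r)"])
        auto
    \<comment> \<open>The linear change from \<open>(c2, r)\<close> to \<open>(w, v)\<close> has
      determinant 6.\<close>
    also have "\<dots> = card {(w, v, x). - (27 * c0) * x^2 = w^2 * v}"
    proof (rule card_Collect_bij[of _ _ "\<lambda>(c2, r, c3). (2 * c2 - r, 2 * (c2 + r), c3)"
            "\<lambda>(w, v, x). ((2 * w + v) / 6, (v - w) / 3, x)"], goal_cases)
      case (2 y)
      have "2 * ((2 * w + v) / 6) - (v - w) / 3 = w" "2 * ((2 * w + v) / 6 + (v - w) / 3) = v" for w v :: 'k
      proof -
        have "(2 * w + v) / 6 = (2 * w + v) / 3 / 2" by simp
        moreover have "2 * (x / 2) = x" for x :: 'k using two by simp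
        ultimately have h: "2 * ((2 * w + v) / 6) = (2 * w + v) / 3" by metis
        then show "2 * ((2 * w + v) / 6) - (v - w) / 3 = w" using three by (simp add: field_simps)
        show "2 * ((2 * w + v) / 6 + (v - w) / 3) = v"
          unfolding distrib_left h using three nz by (simp add: field_simps)
      qed
      then show ?case using 2 by auto
    next
      case (1 y)
      have "(2 * (2 * c2 - r) + 2 * (c2 + r)) / 6 = c2" "(2 * (c2 + r) - (2 * c2 - r)) / 3 = r" for c2 r :: 'k
        using nz three by (simp_all add: field_simps)
      then show ?case using 1 by auto
    qed
    also have "\<dots> = CARD('k)^2"
      by (rule card_cusp_surface) (use False nz in auto)
    finally show ?thesis .
  qed
qed

text \<open>These are the cases \<open>I = J = 0\<close>. The division into fibres is the same, with
  a cuspidal cubic in place of the surface.\<close>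

lemma card_triple_root:
  assumes two: "(2::'k::{field,finite}) \<noteq> 0" and three: "(3::'k) \<noteq> 0"
  shows "card {p :: ('k \<times> 'k) \<times> ('k \<times> 'k \<times> 'k) \<times> 'k. double_root_prop (fst p) (snd p) \<and> snd (snd p) = 0}
     = CARD('k)^2 + (CARD('k \<times> 'k) - 1) * CARD('k)"
proof (rule card_Collect_prefix)
  note nz = numerals_nz[OF two three]
  have "card {y :: ('k \<times> 'k \<times> 'k) \<times> 'k. double_root_prop 0 y \<and> snd y = 0} = card {_ :: 'k \<times> 'k. True}"
    by (intro card_Collect_bij[of _ _ "\<lambda>((c2, c3, c4), r). (c3, c4)" "\<lambda>(c3, c4). ((0, c3, c4), 0)"])
      (auto simp: double_root_prop_def zero_prod_def invI_zero invJ_zero)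
  then show "card {y :: ('k \<times> 'k \<times> 'k) \<times> 'k. double_root_prop 0 y \<and> snd y = 0} = CARD('k)^2"
    by (simp add: power2_eq_square)
next
  note nz = numerals_nz[OF two three]
  fix x :: "'k \<times> 'k" assume x: "x \<noteq> 0"
  obtain c0 c1 where x': "x = (c0, c1)" by (cases x)
  show "card {y. double_root_prop x y \<and> snd y = 0} = CARD('k)"
  proof (cases "c0 = 0")
    case True
    then have c1: "c1 \<noteq> 0" using x by (simp add: x' zero_prod_def)
    have iff: "double_root_prop x ((c2, c3, c4), 0) \<longleftrightarrow>
        c3 = c2^2 / (3 * c1) \<and> c4 = (3 * c2 * c2^2 - 2 * c2^3) / (27 * c1^2)" for c2 c3 c4
    proof -
      have "invI c0 c1 c2 c3 c4 = 0 \<longleftrightarrow> 3 * c1 * c3 = c2^2"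
        by (auto simp: invI_def True algebra_simps)
      moreover have "invJ c0 c1 c2 c3 c4 = 0 \<longleftrightarrow>
          27 * c1^2 * c4 = 3 * c2 * c2^2 - 2 * c2^3" if "3 * c1 * c3 = c2^2"
        unfolding that[symmetric] by (auto simp: invJ_def True algebra_simps)
      ultimately show ?thesis using c1 three nz by (auto simp: double_root_prop_def x' field_simps)
    qed
    have "card {y. double_root_prop x y \<and> snd y = 0} = card {_ :: 'k. True}"
      by (rule card_Collect_bij[of _ _ "\<lambda>((c2, c3, c4), r). c2"
            "\<lambda>c2. ((c2, c2^2 / (3 * c1), (3 * c2 * c2^2 - 2 * c2^3) / (27 * c1^2)), 0)"])
        (auto simp: iff)
    then show ?thesis by simp
  next
    case False
    have solve: "12 * c0 * c4 = z \<longleftrightarrow> c4 = z / (12 * c0)" for c4 z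
      using False nz by (auto simp: field_simps)
    have cube: "c2^2 * c2 = c2^3" for c2 :: 'k
      by (simp add: power2_eq_square power3_eq_cube)
    have "card {y. double_root_prop x y \<and> snd y = 0} =
       card {((c2, c3, c4), r). (invI c0 c1 c2 c3 c4 = r^2 \<and> invJ c0 c1 c2 c3 c4 = 2 * r^3) \<and> r = 0}"
      by (rule arg_cong[where f = card]) (auto simp: double_root_prop_def x')
    also have "\<dots> = card {((c2, c3, c4), r). (invI c0 0 c2 c3 c4 = r^2 \<and> invJ c0 0 c2 c3 c4 = 2 * r^3) \<and> r = 0}"
      by (rule card_shear) (use False nz in auto)
    also have "\<dots> = card {(c2, c3). - (27 * c0) * c3^2 = 8 * c2^3}"
      unfolding depressed_double_root_iff solve
      by (rule card_Collect_bij[of _ _ "\<lambda>((c2, c3, c4), r). (c2, c3)"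
            "\<lambda>(c2, c3). ((c2, c3, - (c2^2) / (12 * c0)), 0)"])
        (auto simp: cube)
    also have "\<dots> = card {(x, y). (- (27 * c0) / 8) * y^2 = x^3}"
      using nz by (simp add: field_simps)
    also have "\<dots> = CARD('k)"
      by (rule card_cusp_curve) (use False nz in auto)
    finally show ?thesis .
  qed
qed

section \<open>From quartics to conics\<close>

definition conic_inv :: "'a::field ^ 6 \<Rightarrow> 'a \<times> 'a" where
  "conic_inv a = (invI (a$1) (a$4) (a$2 + a$5) (a$6) (a$3), invJ (a$1) (a$4) (a$2 + a$5) (a$6) (a$3))"

definition conic_trace :: "'a::field ^ 6 \<Rightarrow> 'a" where
  "conic_trace a = 2 * a$5 - a$2"

text \<open>Adding \<open>t (xz - y^2)\<close> to the form gives a determinant with leading term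
  \<open>t^3\<close> and adds \<open>3t\<close> to the trace; hence the factor 27.\<close>

lemma conic_det_resolvent:
  "27 * conic_det a = conic_trace a^3 - 3 * fst (conic_inv a) * conic_trace a + snd (conic_inv a)"
  unfolding conic_det_def conic_trace_def conic_inv_def invI_def invJ_def
  by (simp add: algebra_simps power2_eq_square power3_eq_cube)

text \<open>With \<open>e\<close> the trace, the determinant along the pencil is
  \<open>t^3 + e t^2 + (e^2 - I)/3 t + conic_det a\<close>. Cayley's expression
  \<open>e^2 - 4 (e^2 - I)/3\<close> is the triangle form.\<close>

lemma triangle_form_resolvent:
  "3 * triangle_form a = 4 * fst (conic_inv a) - conic_trace a^2"
  unfolding triangle_form_def conic_trace_def conic_inv_def invI_def
  by (simp add: algebra_simps power2_eq_square)

lemma quart_disc_inv: "quart_disc a = 4 * fst (conic_inv a)^3 - snd (conic_inv a)^2"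
  by (simp add: quart_disc_def disc4_def conic_inv_def)

text \<open>From \<open>I = r^2\<close> and \<open>J = 2 r^3\<close> the root is recovered
  rationally, without choosing a square root. On \<open>4 I^3 = J^2\<close>, \<open>I = 0\<close>
  forces \<open>J = 0\<close>, so the default value 0 is correct.\<close>

definition double_root :: "'a::field \<times> 'a \<Rightarrow> 'a" where
  "double_root p = (if fst p = 0 then 0 else snd p / (2 * fst p))"

lemma double_root_iff:
  fixes I J :: "'a::field"
  assumes "(2::'a) \<noteq> 0"
  shows "I = r^2 \<and> J = 2 * r^3 \<longleftrightarrow> 4 * I^3 - J^2 = 0 \<and> r = double_root (I, J)"
proof
  assume "I = r^2 \<and> J = 2 * r^3"
  moreover have "2 * r^3 / (2 * r^2) = r" if "r \<noteq> 0"
    using that assms by (simp add: power2_eq_square power3_eq_cube)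
  ultimately show "4 * I^3 - J^2 = 0 \<and> r = double_root (I, J)"
    by (auto simp: double_root_def power_mult_distrib simp flip: power_mult)
next
  assume *: "4 * I^3 - J^2 = 0 \<and> r = double_root (I, J)"
  show "I = r^2 \<and> J = 2 * r^3"
  proof (cases "I = 0")
    case True
    then show ?thesis using * by (simp add: double_root_def)
  next
    case False
    then have J: "J = 2 * I * r" using * assms by (simp add: double_root_def)
    have "4 * I^3 = 4 * I^2 * r^2" using * unfolding J by (simp add: power_mult_distrib)
    moreover have "(4::'a) \<noteq> 0" using assms by (metis mult_eq_0_iff numeral_Bit0_eq_double numeral_One)
    ultimately have "I^2 * I = I^2 * r^2" by (simp add: power2_eq_square power3_eq_cube)
    then have "I = r^2" using False by simp
    then show ?thesis using J by (simp add: power2_eq_square power3_eq_cube)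
  qed
qed

text \<open>A conic is encoded by its quartic, the double root of the resolvent cubic
  \<open>x^3 - 3 I x + J\<close>, and its trace.\<close>

lemma card_quart_disc_0:
  fixes R :: "'k::{field,finite} \<Rightarrow> 'k \<Rightarrow> bool"
  assumes two: "(2::'k) \<noteq> 0" and three: "(3::'k) \<noteq> 0"
  shows "card {a :: 'k ^ 6. quart_disc a = 0 \<and> R (double_root (conic_inv a)) (conic_trace a)}
     = card {(p, e). double_root_prop (fst p) (snd p) \<and> R (snd (snd p)) e}"
proof (rule card_Collect_bij[of _ _
    "\<lambda>a. (((a$1, a$4), ((a$2 + a$5, a$6, a$3), double_root (conic_inv a))), conic_trace a)"
    "\<lambda>(((c0, c1), ((c2, c3, c4), r)), e). vec6 c0 ((2 * c2 - e) / 3) c4 c1 ((c2 + e) / 3) c3"], goal_cases)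
  case (1 a)
  have "(2 * (a$2 + a$5) - conic_trace a) / 3 = a$2" "(a$2 + a$5 + conic_trace a) / 3 = a$5"
    using three by (simp_all add: conic_trace_def field_simps)
  then have v: "vec6 (a$1) ((2 * (a$2 + a$5) - conic_trace a) / 3) (a$3) (a$4)
      ((a$2 + a$5 + conic_trace a) / 3) (a$6) = a"
    by (simp only: vec6_eta)
  have "4 * fst (conic_inv a)^3 - snd (conic_inv a)^2 = 0" using 1 by (simp add: quart_disc_inv)
  then have "fst (conic_inv a) = double_root (conic_inv a)^2 \<and> snd (conic_inv a) = 2 * double_root (conic_inv a)^3"
    using double_root_iff[OF two, of "fst (conic_inv a)" _ "snd (conic_inv a)"] by simp
  then have "double_root_prop (a$1, a$4) ((a$2 + a$5, a$6, a$3), double_root (conic_inv a))"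
    by (simp add: double_root_prop_def) (simp add: conic_inv_def)
  then show ?case using 1 v by simp
next
  case (2 y)
  obtain c0 c1 c2 c3 c4 r e where y: "y = (((c0, c1), ((c2, c3, c4), r)), e)" by (metis surj_pair)
  define a where "a = vec6 c0 ((2 * c2 - e) / 3) c4 c1 ((c2 + e) / 3) c3"
  have s: "a$2 + a$5 = c2" using three numerals_nz[OF two three] by (simp add: a_def field_simps)
  have t: "conic_trace a = e" using three numerals_nz[OF two three] by (simp add: a_def conic_trace_def field_simps)
  have i: "conic_inv a = (invI c0 c1 c2 c3 c4, invJ c0 c1 c2 c3 c4)"
    unfolding conic_inv_def s by (simp add: a_def)
  have "invI c0 c1 c2 c3 c4 = r^2 \<and> invJ c0 c1 c2 c3 c4 = 2 * r^3"
    using 2 by (simp add: y double_root_prop_def)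
  then have "quart_disc a = 0 \<and> r = double_root (conic_inv a)"
    unfolding double_root_iff[OF two] by (simp add: quart_disc_inv i)
  then show ?case
    using 2 s t by (simp add: y flip: a_def) (simp add: a_def)
qed

text \<open>Each quartic with a multiple root has two admissible traces, or one if
  \<open>r = 0\<close>. The number of quartics with \<open>r = 0\<close> is added on the left to
  avoid subtraction of natural numbers.\<close>

lemma card_quart_disc_0_two_roots:
  fixes R :: "'k::{field,finite} \<Rightarrow> 'k \<Rightarrow> bool"
  assumes two: "(2::'k) \<noteq> 0" and three: "(3::'k) \<noteq> 0"
    and R: "\<And>r. card {e. R r e} = (if r = 0 then 1 else 2)"
  shows "card {a :: 'k ^ 6. quart_disc a = 0 \<and> R (double_root (conic_inv a)) (conic_trace a)}
      + card {p :: ('k \<times> 'k) \<times> ('k \<times> 'k \<times> 'k) \<times> 'k. double_root_prop (fst p) (snd p) \<and> snd (snd p) = 0}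
     = 2 * card {p :: ('k \<times> 'k) \<times> ('k \<times> 'k \<times> 'k) \<times> 'k. double_root_prop (fst p) (snd p)}"
proof -
  let ?D = "{p :: ('k \<times> 'k) \<times> ('k \<times> 'k \<times> 'k) \<times> 'k. double_root_prop (fst p) (snd p)}"
  have "{(p, e). double_root_prop (fst p) (snd p) \<and> R (snd (snd p)) e} = (SIGMA p:?D. {e. R (snd (snd p)) e})"
    by auto
  then have "card {(p, e). double_root_prop (fst p) (snd p) \<and> R (snd (snd p)) e} =
      (\<Sum>p\<in>?D. if snd (snd p) = 0 then 1 else 2)"
    by (simp add: R)
  moreover have "card {p :: ('k \<times> 'k) \<times> ('k \<times> 'k \<times> 'k) \<times> 'k. double_root_prop (fst p) (snd p) \<and> snd (snd p) = 0}
      = (\<Sum>p\<in>?D. if snd (snd p) = 0 then 1 else 0)"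
    by (simp add: sum.If_cases Int_def)
  moreover have "(\<Sum>p\<in>?D. if snd (snd p) = 0 then 1 else 2) + (\<Sum>p\<in>?D. if snd (snd p) = 0 then 1 else 0)
      = (\<Sum>p\<in>?D. 2 :: nat)"
    by (subst sum.distrib[symmetric], rule sum.cong) auto
  ultimately show ?thesis by (simp add: card_quart_disc_0[OF two three])
qed

lemma two_roots_square:
  fixes r :: "'k::{field,finite}"
  assumes two: "(2::'k) \<noteq> 0"
  shows "card {e. e^2 = 4 * r^2} = (if r = 0 then 1 else 2)"
proof -
  have "e^2 = 4 * r^2 \<longleftrightarrow> e = 2 * r \<or> e = - (2 * r)" for e
    by (simp add: power_mult_distrib flip: power2_eq_iff)
  then have "{e. e^2 = 4 * r^2} = {2 * r, - (2 * r)}" by auto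
  moreover have "2 * r \<noteq> - (2 * r)" if "r \<noteq> 0"
  proof
    assume "2 * r = - (2 * r)"
    then have "2 * (2 * r) = 0" by (simp add: eq_neg_iff_add_eq_0)
    then show False using two that by (metis mult_eq_0_iff)
  qed
  ultimately show ?thesis by auto
qed

lemma two_roots_cubic:
  fixes r :: "'k::{field,finite}"
  assumes three: "(3::'k) \<noteq> 0"
  shows "card {e. e^3 - 3 * r^2 * e + 2 * r^3 = 0} = (if r = 0 then 1 else 2)"
proof -
  have "e^3 - 3 * r^2 * e + 2 * r^3 = (e - r)^2 * (e + 2 * r)" for e
    by (simp add: algebra_simps power2_eq_square power3_eq_cube)
  then have "{e. e^3 - 3 * r^2 * e + 2 * r^3 = 0} = {r, - (2 * r)}"
    by (auto simp: eq_neg_iff_add_eq_0)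
  moreover have "r \<noteq> - (2 * r)" if "r \<noteq> 0"
  proof
    assume "r = - (2 * r)"
    then have "3 * r = 0" by (simp add: eq_neg_iff_add_eq_0)
    then show False using three that by (metis mult_eq_0_iff)
  qed
  ultimately show ?thesis by auto
qed

lemma card_split:
  fixes P Q :: "'a::finite \<Rightarrow> bool"
  shows "int (card {a. P a}) = int (card {a. P a \<and> Q a}) + int (card {a. P a \<and> \<not> Q a})"
proof -
  have "{a. P a} = {a. P a \<and> Q a} \<union> {a. P a \<and> \<not> Q a}" by auto
  moreover have "card ({a. P a \<and> Q a} \<union> {a. P a \<and> \<not> Q a}) = card {a. P a \<and> Q a} + card {a. P a \<and> \<not> Q a}"
    by (rule card_Un_disjoint) auto
  ultimately show ?thesis by simp
qed

section \<open>Smooth and transversal forms by inclusion and exclusion\<close>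

locale finite_field_count =
  fixes K :: "'k::{field,finite} itself" and q :: int
  assumes two: "(2::'k) \<noteq> 0" and three: "(3::'k) \<noteq> 0"
    and q: "q = int CARD('k)"
begin

lemma card_D: "int (card {p :: ('k \<times> 'k) \<times> ('k \<times> 'k \<times> 'k) \<times> 'k. double_root_prop (fst p) (snd p)}) = q^4 + q^3 - q^2"
proof -
  have h: "int (CARD('k \<times> 'k) - 1) = q^2 - 1" by (simp add: q power2_eq_square of_nat_diff Suc_le_eq)
  show ?thesis
    unfolding card_double_root[OF two three] of_nat_add of_nat_mult of_nat_power h q[symmetric]
    by (simp add: algebra_simps eval_nat_numeral)
qed

lemma card_T: "int (card {p :: ('k \<times> 'k) \<times> ('k \<times> 'k \<times> 'k) \<times> 'k. double_root_prop (fst p) (snd p) \<and> snd (snd p) = 0})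
   = q^3 + q^2 - q"
proof -
  have h: "int (CARD('k \<times> 'k) - 1) = q^2 - 1" by (simp add: q power2_eq_square of_nat_diff Suc_le_eq)
  show ?thesis
    unfolding card_triple_root[OF two three] of_nat_add of_nat_mult of_nat_power h q[symmetric]
    by (simp add: algebra_simps eval_nat_numeral)
qed

lemma card_two_roots:
  fixes R :: "'k \<Rightarrow> 'k \<Rightarrow> bool"
  assumes R: "\<And>r. card {e. R r e} = (if r = 0 then 1 else 2)"
  shows "int (card {a :: 'k ^ 6. quart_disc a = 0 \<and> R (double_root (conic_inv a)) (conic_trace a)})
    = 2 * (q^4 + q^3 - q^2) - (q^3 + q^2 - q)"
  using arg_cong[OF card_quart_disc_0_two_roots[OF two three R], of int]
  unfolding of_nat_add of_nat_mult card_D card_T by simp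

lemma card_disc_0: "int (card {a :: 'k ^ 6. quart_disc a = 0}) = q * (q^4 + q^3 - q^2)"
proof -
  let ?D = "{p :: ('k \<times> 'k) \<times> ('k \<times> 'k \<times> 'k) \<times> 'k. double_root_prop (fst p) (snd p)}"
  have "card {a :: 'k ^ 6. quart_disc a = 0} = card {(p, e :: 'k). double_root_prop (fst p) (snd p :: ('k \<times> 'k \<times> 'k) \<times> 'k)}"
    using card_quart_disc_0[OF two three, of "\<lambda>_ _. True"] by simp
  also have "{(p, e :: 'k). double_root_prop (fst p) (snd p :: ('k \<times> 'k \<times> 'k) \<times> 'k)} = ?D \<times> UNIV" by auto
  finally show ?thesis using card_D by (simp add: card_cartesian_product q)
qed

lemma card_disc_0_triangle:
  "int (card {a :: 'k ^ 6. quart_disc a = 0 \<and> triangle_form a = 0}) = 2 * (q^4 + q^3 - q^2) - (q^3 + q^2 - q)"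
proof -
  have "triangle_form a = 0 \<longleftrightarrow> conic_trace a^2 = 4 * double_root (conic_inv a)^2" if "quart_disc a = 0" for a :: "'k ^ 6"
  proof -
    have "fst (conic_inv a) = double_root (conic_inv a)^2"
      using double_root_iff[OF two, of "fst (conic_inv a)" "double_root (conic_inv a)" "snd (conic_inv a)"] that
      by (simp add: quart_disc_inv)
    then have "3 * triangle_form a = 4 * double_root (conic_inv a)^2 - conic_trace a^2"
      by (simp add: triangle_form_resolvent)
    then show ?thesis using three by (metis eq_iff_diff_eq_0 mult_eq_0_iff)
  qed
  then have eq: "{a :: 'k ^ 6. quart_disc a = 0 \<and> triangle_form a = 0} =
      {a. quart_disc a = 0 \<and> conic_trace a^2 = 4 * double_root (conic_inv a)^2}" by blast
  show ?thesis
    unfolding eq by (rule card_two_roots[of "\<lambda>r e. e^2 = 4 * r^2", OF two_roots_square[OF two]])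
qed

lemma card_disc_0_det:
  "int (card {a :: 'k ^ 6. quart_disc a = 0 \<and> conic_det a = 0}) = 2 * (q^4 + q^3 - q^2) - (q^3 + q^2 - q)"
proof -
  have "conic_det a = 0 \<longleftrightarrow>
      conic_trace a^3 - 3 * double_root (conic_inv a)^2 * conic_trace a + 2 * double_root (conic_inv a)^3 = 0"
    if "quart_disc a = 0" for a :: "'k ^ 6"
  proof -
    have "fst (conic_inv a) = double_root (conic_inv a)^2 \<and> snd (conic_inv a) = 2 * double_root (conic_inv a)^3"
      using double_root_iff[OF two, of "fst (conic_inv a)" "double_root (conic_inv a)" "snd (conic_inv a)"] that
      by (simp add: quart_disc_inv)
    then have "27 * conic_det a =
        conic_trace a^3 - 3 * double_root (conic_inv a)^2 * conic_trace a + 2 * double_root (conic_inv a)^3"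
      by (simp only: conic_det_resolvent)
    then show ?thesis using numerals_nz(4)[OF two three] by (metis mult_eq_0_iff)
  qed
  then have eq: "{a :: 'k ^ 6. quart_disc a = 0 \<and> conic_det a = 0} = {a. quart_disc a = 0 \<and>
      conic_trace a^3 - 3 * double_root (conic_inv a)^2 * conic_trace a + 2 * double_root (conic_inv a)^3 = 0}" by blast
  show ?thesis
    unfolding eq by (rule card_two_roots[of "\<lambda>r e. e^3 - 3 * r^2 * e + 2 * r^3 = 0", OF two_roots_cubic[OF three]])
qed

lemma int_card_det_0: "int (card {a :: 'k ^ 6. conic_det a = 0}) = q^5 + q^3 - q^2"
  and int_card_triangle_0: "int (card {a :: 'k ^ 6. triangle_form a = 0}) = q^5 + q^3 - q^2"
proof -
  have "CARD('k)^2 \<le> CARD('k)^5" by (rule power_increasing) (auto simp: Suc_le_eq)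
  then have "int (CARD('k)^5 + CARD('k)^3 - CARD('k)^2) = q^5 + q^3 - q^2"
    by (simp add: of_nat_diff q)
  then show "int (card {a :: 'k ^ 6. conic_det a = 0}) = q^5 + q^3 - q^2"
    and "int (card {a :: 'k ^ 6. triangle_form a = 0}) = q^5 + q^3 - q^2"
    by (simp_all add: card_conic_det_0[OF two] card_triangle_form_0[OF two])
qed

lemma card_vec6: "int CARD('k ^ 6) = q^6"
  by (simp add: q)

lemma card_smooth: "int (card {a :: 'k ^ 6. conic_det a \<noteq> 0}) = (q - 1) * (q^5 - q^2)"
  using card_split[of "\<lambda>_. True" "\<lambda>a :: 'k ^ 6. conic_det a = 0"] int_card_det_0 card_vec6
  by (simp add: algebra_simps eval_nat_numeral)

lemma card_smooth_transversal:
  "int (card {a :: 'k ^ 6. conic_det a \<noteq> 0 \<and> quart_disc a \<noteq> 0}) =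
     (q - 1) * ((q + 1) * q * (q - 1) * (q^2 - q + 1))"
proof -
  have "int (card {a :: 'k ^ 6. quart_disc a = 0}) =
      int (card {a :: 'k ^ 6. quart_disc a = 0 \<and> conic_det a = 0}) + int (card {a :: 'k ^ 6. quart_disc a = 0 \<and> conic_det a \<noteq> 0})"
    by (rule card_split)
  moreover have "int (card {a :: 'k ^ 6. conic_det a \<noteq> 0}) =
      int (card {a :: 'k ^ 6. conic_det a \<noteq> 0 \<and> quart_disc a = 0}) + int (card {a :: 'k ^ 6. conic_det a \<noteq> 0 \<and> quart_disc a \<noteq> 0})"
    by (rule card_split)
  moreover have "{a :: 'k ^ 6. conic_det a \<noteq> 0 \<and> quart_disc a = 0} = {a. quart_disc a = 0 \<and> conic_det a \<noteq> 0}"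
    by blast
  ultimately have "int (card {a :: 'k ^ 6. conic_det a \<noteq> 0 \<and> quart_disc a \<noteq> 0}) =
      (q - 1) * (q^5 - q^2) - (q * (q^4 + q^3 - q^2) - (2 * (q^4 + q^3 - q^2) - (q^3 + q^2 - q)))"
    using card_smooth card_disc_0 card_disc_0_det by simp
  then show ?thesis by (simp add: algebra_simps eval_nat_numeral)
qed

text \<open>Inserting \<open>4 I = e^2\<close> into the resolvent cubic gives
  \<open>4 J = - e^3\<close>, and both \<open>(4 I)^3\<close> and \<open>(4 J)^2\<close> equal
  \<open>e^6\<close>.\<close>

lemma triangle_singular_imp_disc_0:
  fixes a :: "'k ^ 6"
  assumes "triangle_form a = 0" "conic_det a = 0"
  shows "quart_disc a = 0"
proof -
  define e I J where "e = conic_trace a" and "I = fst (conic_inv a)" and "J = snd (conic_inv a)"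
  have 1: "4 * I = e^2" using triangle_form_resolvent[of a] assms by (simp add: e_def I_def)
  have 2: "e^3 - 3 * I * e + J = 0" using conic_det_resolvent[of a] assms by (simp add: e_def I_def J_def)
  have "4 * J = - (e^3)"
  proof -
    have "4 * (e^3 - 3 * I * e + J) = 4 * e^3 - 3 * (4 * I) * e + 4 * J" by (simp add: algebra_simps)
    then have "4 * e^3 - 3 * e^2 * e + 4 * J = 0" using 2 unfolding 1 by simp
    then show ?thesis by (simp add: power2_eq_square power3_eq_cube eq_neg_iff_add_eq_0 add.commute mult.assoc)
  qed
  then have "16 * (4 * I^3 - J^2) = 0"
  proof -
    have "16 * (4 * I^3 - J^2) = (4 * I)^3 - (4 * J)^2" by (simp add: power2_eq_square power3_eq_cube algebra_simps)
    also have "\<dots> = 0" unfolding 1 \<open>4 * J = - (e^3)\<close> by (simp flip: power_mult)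
    finally show ?thesis .
  qed
  moreover have "(16::'k) = 4 * 4" by simp
  ultimately show ?thesis using numerals_nz(1)[OF two three]
    unfolding quart_disc_inv I_def J_def by (metis mult_eq_0_iff)
qed

lemma card_smooth_transversal_triangle:
  "int (card {a :: 'k ^ 6. conic_det a \<noteq> 0 \<and> quart_disc a \<noteq> 0 \<and> triangle_form a = 0}) =
     (q - 1) * ((q + 1) * q * (q - 1)^2)"
proof -
  have "int (card {a :: 'k ^ 6. triangle_form a = 0}) =
      int (card {a :: 'k ^ 6. triangle_form a = 0 \<and> quart_disc a = 0}) + int (card {a :: 'k ^ 6. triangle_form a = 0 \<and> quart_disc a \<noteq> 0})"
    by (rule card_split)
  moreover have "{a :: 'k ^ 6. triangle_form a = 0 \<and> quart_disc a = 0} = {a. quart_disc a = 0 \<and> triangle_form a = 0}"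
    by blast
  moreover have "{a :: 'k ^ 6. triangle_form a = 0 \<and> quart_disc a \<noteq> 0} =
      {a. conic_det a \<noteq> 0 \<and> quart_disc a \<noteq> 0 \<and> triangle_form a = 0}"
    using triangle_singular_imp_disc_0 by blast
  ultimately have "int (card {a :: 'k ^ 6. conic_det a \<noteq> 0 \<and> quart_disc a \<noteq> 0 \<and> triangle_form a = 0}) =
      q^5 + q^3 - q^2 - (2 * (q^4 + q^3 - q^2) - (q^3 + q^2 - q))"
    using int_card_triangle_0 card_disc_0_triangle by simp
  then show ?thesis by (simp add: algebra_simps eval_nat_numeral)
qed

end

subsection \<open>Normal form of a smooth conic over a finite field\<close>

text \<open>Every element is a chosen root of its square or the negative of one, and 0 needs only
  one sign. Hence more than half of the elements are squares.\<close>

lemma card_squares: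
  assumes "(2::'k::{field,finite}) \<noteq> 0"
  shows "CARD('k) < 2 * card (range (\<lambda>x::'k. x^2))"
proof -
  let ?S = "range (\<lambda>x::'k. x^2)"
  define rt where "rt = (\<lambda>s::'k. SOME x. x^2 = s)"
  have rt: "rt (x^2)^2 = x^2" for x
    unfolding rt_def by (rule someI[of _ x]) simp
  have "UNIV \<subseteq> rt ` ?S \<union> (\<lambda>s. - rt s) ` (?S - {0})"
  proof
    fix x :: 'k
    have "rt (x^2) = x \<or> rt (x^2) = - x" using rt[of x] by (simp add: power2_eq_iff)
    then consider "x = rt (x^2)" | "x = - rt (x^2)" "x^2 \<noteq> 0" by force
    then show "x \<in> rt ` ?S \<union> (\<lambda>s. - rt s) ` (?S - {0})"
    proof cases
      case 1
      then show ?thesis by (intro UnI1 image_eqI[of _ rt "x^2"]) auto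
    next
      case 2
      then show ?thesis by (intro UnI2 image_eqI[of _ "\<lambda>s. - rt s" "x^2"]) auto
    qed
  qed
  then have "CARD('k) \<le> card (rt ` ?S \<union> (\<lambda>s. - rt s) ` (?S - {0}))"
    by (intro card_mono) auto
  also have "\<dots> \<le> card (rt ` ?S) + card ((\<lambda>s. - rt s) ` (?S - {0}))" by (rule card_Un_le)
  also have "\<dots> \<le> card ?S + card (?S - {0})" by (intro add_mono card_image_le) auto
  also have "card (?S - {0}) < card ?S" by (rule psubset_card_mono) (auto simp: image_iff intro: exI[of _ 0])
  finally show ?thesis by simp
qed

text \<open>The values of \<open>\<alpha> * x^2\<close> and of \<open>- \<epsilon> - y^2\<close>
  each fill more than half of the field, so the two sets meet.\<close>

lemma binary_form_represents:
  fixes \<alpha> \<epsilon> :: "'k::{field,finite}"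
  assumes two: "(2::'k) \<noteq> 0" and "\<alpha> \<noteq> 0"
  shows "\<exists>x y. \<alpha> * x^2 + y^2 + \<epsilon> = 0"
proof (rule ccontr)
  assume neg: "\<not> ?thesis"
  let ?S = "range (\<lambda>x::'k. x^2)"
  have "((\<lambda>s. \<alpha> * s) ` ?S) \<inter> ((\<lambda>s. - \<epsilon> - s) ` ?S) = {}"
  proof (rule ccontr)
    assume "((\<lambda>s. \<alpha> * s) ` ?S) \<inter> ((\<lambda>s. - \<epsilon> - s) ` ?S) \<noteq> {}"
    then obtain x y where "\<alpha> * x^2 = - \<epsilon> - y^2" by auto
    then have "\<alpha> * x^2 + y^2 + \<epsilon> = 0" by simp
    then show False using neg by blast
  qed
  then have "card (((\<lambda>s. \<alpha> * s) ` ?S) \<union> ((\<lambda>s. - \<epsilon> - s) ` ?S)) = card ((\<lambda>s. \<alpha> * s) ` ?S) + card ((\<lambda>s. - \<epsilon> - s) ` ?S)"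
    by (intro card_Un_disjoint) auto
  also have "card ((\<lambda>s. \<alpha> * s) ` ?S) = card ?S" using assms by (intro card_image inj_onI) auto
  also have "card ((\<lambda>s. - \<epsilon> - s) ` ?S) = card ?S" by (intro card_image inj_onI) auto
  finally have "2 * card ?S \<le> CARD('k)"
    using card_mono[OF finite_class.finite_UNIV, of "((\<lambda>s. \<alpha> * s) ` ?S) \<union> ((\<lambda>s. - \<epsilon> - s) ` ?S)"] by simp
  then show False using card_squares[OF two] by simp
qed

text \<open>Completing the square twice reduces a conic to the equation solved in
  \<open>binary_form_represents\<close>; the degenerate cases have visible points.\<close>

lemma conic_has_point:
  fixes b :: "'k::{field,finite} ^ 6"
  assumes two: "(2::'k) \<noteq> 0"
  shows "\<exists>v. v \<noteq> 0 \<and> qform b v = 0"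
proof (cases "b$1 = 0")
  case True
  then show ?thesis
    by (intro exI[of _ "vector [1, 0, 0]"]) (simp add: qform_def vec_eq_iff forall_3)
next
  case False
  define \<alpha> \<beta> \<delta> where "\<alpha> = 4 * b$1 * b$2 - (b$4)^2" and "\<beta> = 2 * b$1 * b$6 - b$4 * b$5"
    and "\<delta> = 4 * b$1 * b$3 - (b$5)^2"
  note defs = this
  have four: "(4::'k) \<noteq> 0" using two by (metis mult_eq_0_iff numeral_Bit0_eq_double numeral_One)
  have key: "4 * b$1 * qform b v = (2 * b$1 * v$1 + b$4 * v$2 + b$5 * v$3)^2
      + \<alpha> * (v$2)^2 + 2 * \<beta> * v$2 * v$3 + \<delta> * (v$3)^2" for v
    by (simp add: defs qform_def algebra_simps power2_eq_square)
  show ?thesis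
  proof (cases "\<alpha> = 0")
    case True
    define v :: "'k ^ 3" where "v = vector [- b$4 / (2 * b$1), 1, 0]"
    have "4 * b$1 * qform b v = 0"
      unfolding key using True False two by (simp add: v_def)
    then have "qform b v = 0" using False four by simp
    then show ?thesis by (intro exI[of _ v]) (simp add: v_def vec_eq_iff forall_3)
  next
    case \<alpha>: False
    \<comment> \<open>Here \<open>x\<close> is the value of the first completed square's base and
      \<open>y\<close> that of the second, \<open>\<alpha> * v2 + \<beta>\<close>, with the third
      coordinate set to 1.\<close>
    obtain x y where xy: "\<alpha> * x^2 + y^2 + (\<alpha> * \<delta> - \<beta>^2) = 0"
      using binary_form_represents[OF two \<alpha>] by blast
    define v2 where "v2 = (y - \<beta>) / \<alpha>"
    have y: "y = \<alpha> * v2 + \<beta>" using \<alpha> by (simp add: v2_def)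
    define v :: "'k ^ 3" where "v = vector [(x - b$4 * v2 - b$5) / (2 * b$1), v2, 1]"
    have "2 * b$1 * v$1 + b$4 * v$2 + b$5 * v$3 = x" using False two by (simp add: v_def)
    then have "\<alpha> * (4 * b$1 * qform b v) = \<alpha> * x^2 + y^2 + (\<alpha> * \<delta> - \<beta>^2)"
      unfolding key y by (simp add: v_def algebra_simps power2_eq_square)
    then have "qform b v = 0" using xy False four \<alpha> by simp
    then show ?thesis by (intro exI[of _ v]) (simp add: v_def vec_eq_iff forall_3)
  qed
qed

lemma dot3_qgrad_commute: "dot3 (qgrad b v) w = dot3 (qgrad b w) v"
  by (simp add: dot3_def qgrad_def algebra_simps)

lemma ex_perp2: "\<exists>u :: 'a::field ^ 3. u \<noteq> 0 \<and> dot3 l u = 0 \<and> dot3 m u = 0"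
proof -
  define M :: "'a ^ 3 ^ 3" where "M = vector [l, m, 0]"
  have "det M = 0" by (simp add: M_def det_3)
  then have "\<not> invertible M" by (simp add: invertible_det_nz)
  then obtain u where u: "u \<noteq> 0" "M *v u = 0"
    by (metis invertible_left_inverse matrix_left_invertible_ker)
  then show ?thesis
    by (intro exI[of _ u]) (simp add: M_def vec_eq_iff forall_3 matrix_vector_mult_def sum_3 dot3_def)
qed

text \<open>A hyperbolic pair \<open>v\<close>, \<open>w\<close> is split off, and \<open>u\<close>
  spans its orthogonal complement. In this basis only the \<open>xz\<close> and \<open>y^2\<close>
  terms survive, and scaling \<open>v\<close> adjusts their ratio.\<close>

lemma ex_conic_frame:
  fixes b :: "'k::{field,finite} ^ 6"
  assumes two: "(2::'k) \<noteq> 0" and det: "conic_det b \<noteq> 0"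
  obtains G H lam where "G ** H = mat 1" "H ** G = mat 1" "lam \<noteq> 0"
    "conic_subst b G = vec6 0 (- lam) 0 0 lam 0"
proof -
  have nonsing: "qgrad b v \<noteq> 0" if "v \<noteq> 0" for v
    using that det singular_iff_conic_det[OF two, of b] by blast
  obtain v where v: "v \<noteq> 0" "qform b v = 0" using conic_has_point[OF two] by blast
  obtain w0 where w0: "dot3 (qgrad b v) w0 \<noteq> 0"
    using dot3_eqI[of "qgrad b v" 0] nonsing[OF v(1)] by (auto simp: dot3_def)
  define \<beta> where "\<beta> = dot3 (qgrad b v) w0"
  \<comment> \<open>This multiple of the isotropic \<open>v\<close> makes \<open>w0 + c *s v\<close>
    isotropic as well.\<close>
  define c where "c = - qform b w0 / \<beta>"
  define w where "w = w0 + c *s v"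
  have \<beta>: "\<beta> \<noteq> 0" using w0 by (simp add: \<beta>_def)
  have vv: "dot3 (qgrad b v) v = 0" by (simp add: qgrad_euler v)
  have c: "c * \<beta> = - qform b w0" using \<beta> by (simp add: c_def)
  have w: "qform b w = 0"
    unfolding w_def qform_polar using v c
    by (simp add: qform_scale' dot3_qgrad_commute[of b w0] flip: \<beta>_def)
  have vw: "dot3 (qgrad b v) w = \<beta>" by (simp add: w_def dot3_add vv \<beta>_def)
  have ww: "dot3 (qgrad b w) w = 0" by (simp add: qgrad_euler w)
  obtain u where u: "u \<noteq> 0" "dot3 (qgrad b v) u = 0" "dot3 (qgrad b w) u = 0"
    using ex_perp2 by blast
  have basis: "x = 0 \<and> y = 0 \<and> z = 0" if eq: "x *s v + y *s u + z *s w = 0" for x y z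
  proof -
    have "dot3 (qgrad b v) (x *s v + y *s u + z *s w) = 0"
      "dot3 (qgrad b w) (x *s v + y *s u + z *s w) = 0"
      unfolding eq by (simp_all add: dot3_def)
    then have "z = 0" "x = 0"
      using u vv vw ww \<beta> by (simp_all add: dot3_add dot3_qgrad_commute[of b w v])
    with eq u show ?thesis by simp
  qed
  define mk where "mk = (\<lambda>s. (\<chi> i j. (vector [s *s v, u, w] :: 'k ^ 3 ^ 3) $ j $ i) :: 'k ^ 3 ^ 3)"
  have col: "column 1 (mk s) = s *s v" "column 2 (mk s) = u" "column 3 (mk s) = w" for s
    by (simp_all add: column_def mk_def vec_eq_iff)
  have mul: "mk s *v x = (s * x$1) *s v + x$2 *s u + x$3 *s w" for s x
    by (simp add: mk_def vec_eq_iff matrix_vector_mult_def sum_3 algebra_simps)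
  have inv: "invertible (mk s)" if "s \<noteq> 0" for s
    unfolding invertible_left_inverse matrix_left_invertible_ker
  proof (intro allI impI)
    fix x assume "mk s *v x = 0"
    then have "s * x$1 = 0 \<and> x$2 = 0 \<and> x$3 = 0" unfolding mul by (rule basis)
    then show "x = 0" using that by (simp add: vec_eq_iff forall_3)
  qed
  define \<gamma> where "\<gamma> = qform b u"
  \<comment> \<open>If \<open>u\<close> were isotropic it would be orthogonal to the whole basis,
    hence a singular vector.\<close>
  have \<gamma>: "\<gamma> \<noteq> 0"
  proof
    assume "\<gamma> = 0"
    obtain M where M: "mk 1 ** M = mat 1" using inv[of 1] unfolding invertible_def by auto
    have "dot3 (qgrad b u) x = 0" for x
    proof -
      have "x = mk 1 *v (M *v x)" by (simp add: matrix_vector_mul_assoc M)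
      then have "dot3 (qgrad b u) x = dot3 (qgrad b u) (mk 1 *v (M *v x))" by simp
      also have "\<dots> = 0"
        unfolding mul using u \<open>\<gamma> = 0\<close> qgrad_euler[of b u]
        by (simp add: dot3_add dot3_qgrad_commute[of b u v] dot3_qgrad_commute[of b u w] \<gamma>_def)
      finally show ?thesis .
    qed
    then have "qgrad b u = 0" by (intro dot3_eqI) (simp add: dot3_def)
    then show False using nonsing u by blast
  qed
  \<comment> \<open>The scaling makes the \<open>xz\<close> coefficient the negative of the
    \<open>y^2\<close> coefficient.\<close>
  define s where "s = - \<gamma> / \<beta>"
  have s: "s * \<beta> = - \<gamma>" using \<beta> by (simp add: s_def)
  have "s \<noteq> 0" using \<gamma> \<beta> by (simp add: s_def)
  then obtain M where M: "mk s ** M = mat 1" "M ** mk s = mat 1"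
    using inv unfolding invertible_def by blast
  have "conic_subst b (mk s) = vec6 0 (- (- \<gamma>)) 0 0 (- \<gamma>) 0"
    unfolding conic_subst_def col using u v w vw s
    by (simp add: qform_scale' qgrad_scale' \<gamma>_def[symmetric] dot3_qgrad_commute[of b u w])
  then show ?thesis using that[OF M, of "- \<gamma>"] \<gamma> by simp
qed

subsection \<open>Descent to the finite field\<close>

definition ac_vec :: "'a::field ^ 'n \<Rightarrow> 'a alg_closure ^ 'n" where
  "ac_vec v = (\<chi> i. to_ac (v$i))"

definition ac_mat :: "'a::field ^ 'n ^ 'm \<Rightarrow> 'a alg_closure ^ 'n ^ 'm" where
  "ac_mat M = (\<chi> i j. to_ac (M$i$j))"

lemma ac_vec_nth [simp]: "ac_vec v $ i = to_ac (v$i)"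
  by (simp add: ac_vec_def)

lemma ac_vec_eq_0_iff [simp]: "ac_vec v = 0 \<longleftrightarrow> v = 0"
  by (simp add: vec_eq_iff)

lemma base_change_abs: "v \<noteq> 0 \<Longrightarrow> base_change (abs_proj v) = abs_proj (ac_vec v)"
  by (simp add: base_change.abs_eq ac_vec_def)

lemma ac_mat_mult: "ac_mat (A ** B) = ac_mat A ** ac_mat B"
  by (simp add: ac_mat_def matrix_matrix_mult_def vec_eq_iff to_ac_sum)

lemma ac_mat_1: "ac_mat (mat 1) = mat 1"
  by (simp add: ac_mat_def mat_def vec_eq_iff)

lemma ac_vec_conic_subst: "ac_vec (conic_subst a G) = conic_subst (ac_vec a) (ac_mat G)"
  by (simp add: vec_eq_iff forall_6 conic_subst_def qform_def qgrad_def dot3_def column_def ac_mat_def)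

lemma conic_det_ac_vec: "conic_det (ac_vec a) = to_ac (conic_det a)"
  by (simp add: conic_det_def)

lemma quart_disc_ac_vec: "quart_disc (ac_vec a) = to_ac (quart_disc a)"
  by (simp add: quart_disc_def disc4_def invI_def invJ_def)

lemma triangle_form_ac_vec: "triangle_form (ac_vec a) = to_ac (triangle_form a)"
  by (simp add: triangle_form_def)

lemma two_ac: "(2::'a::field) \<noteq> 0 \<Longrightarrow> (2::'a alg_closure) \<noteq> 0"
  and three_ac: "(3::'a::field) \<noteq> 0 \<Longrightarrow> (3::'a alg_closure) \<noteq> 0"
  by (metis to_ac_eq_0_iff to_ac_numeral)+

lemma smooth_conic_abs_iff:
  fixes a :: "'a::field ^ 6"
  assumes two: "(2::'a) \<noteq> 0" and a: "a \<noteq> 0"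
  shows "smooth_conic (abs_proj a) \<longleftrightarrow> conic_det a \<noteq> 0"
proof -
  have sing: "singular_at (abs_proj (ac_vec a)) (abs_proj v) \<longleftrightarrow> qgrad (ac_vec a) v = 0" if "v \<noteq> 0" for v
  proof -
    have "qform (ac_vec a) v = 0" if "qgrad (ac_vec a) v = 0"
      using qgrad_euler[of "ac_vec a" v] that two_ac[OF two] by (simp add: dot3_def)
    then show ?thesis using that a by (auto simp: singular_at.abs_eq)
  qed
  have "smooth_conic (abs_proj a) \<longleftrightarrow> \<not> (\<exists>v. v \<noteq> 0 \<and> qgrad (ac_vec a) v = 0)"
    unfolding smooth_conic_def base_change_abs[OF a] by (metis proj_cases sing)
  also have "\<dots> \<longleftrightarrow> conic_det (ac_vec a) \<noteq> 0"
    by (simp add: singular_iff_conic_det[OF two_ac[OF two]])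
  finally show ?thesis by (simp add: conic_det_ac_vec)
qed

text \<open>\<open>G\<close> carries singular vectors of the substituted form to singular vectors of
  \<open>a\<close>; the inverse substitution gives the other direction.\<close>

lemma conic_det_subst_iff:
  fixes a :: "'a::field ^ 6"
  assumes two: "(2::'a) \<noteq> 0" and GH: "G ** H = mat 1" and HG: "H ** G = mat 1"
  shows "conic_det (conic_subst a G) = 0 \<longleftrightarrow> conic_det a = 0"
proof -
  have *: "conic_det a = 0" if det: "conic_det (conic_subst a G) = 0" and inv: "G ** H = mat 1" "H ** G = mat 1"
    for a :: "'a ^ 6" and G H
  proof -
    obtain v where v: "v \<noteq> 0" "qgrad (conic_subst a G) v = 0"
      using det singular_iff_conic_det[OF two, of "conic_subst a G"] by blast
    have GHv: "G *v (H *v x) = x" and HGv: "H *v (G *v x) = x" for x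
      by (simp_all add: matrix_vector_mul_assoc inv)
    have "dot3 (qgrad a (G *v v)) x = dot3 0 x" for x
    proof -
      have "dot3 (qgrad a (G *v v)) x = dot3 (transpose G *v qgrad a (G *v v)) (H *v x)"
        unfolding dot3_transpose GHv ..
      also have "\<dots> = 0" using v(2) unfolding qgrad_conic_subst by (simp only:) (simp add: dot3_def)
      finally show ?thesis by (simp add: dot3_def)
    qed
    then have "qgrad a (G *v v) = 0" by (rule dot3_eqI)
    moreover have "G *v v \<noteq> 0" using HGv[of v] v(1) by auto
    ultimately show ?thesis using singular_iff_conic_det[OF two, of a] by auto
  qed
  have "conic_subst (conic_subst a G) H = a" by (simp add: conic_subst_assoc GH)
  then show ?thesis using *[of a G H] *[of "conic_subst a G" H G] GH HG by metis
qed

lemma conic_frame_ac: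
  fixes b :: "'k::field ^ 6"
  assumes two: "(2::'k) \<noteq> 0" and GH: "G ** H = mat 1" and HG: "H ** G = mat 1" and lam: "lam \<noteq> 0"
    and b: "conic_subst b G = vec6 0 (- lam) 0 0 lam 0"
  shows "conic_frame (ac_vec b) (ac_mat G) (ac_mat H) (to_ac lam)"
proof
  show "ac_mat G ** ac_mat H = mat 1" "ac_mat H ** ac_mat G = mat 1"
    by (simp_all add: GH HG ac_mat_1 flip: ac_mat_mult)
  show "qform (ac_vec b) (ac_mat G *v v) = to_ac lam * (v$1 * v$3 - (v$2)^2)" for v
  proof -
    have "qform (ac_vec b) (ac_mat G *v v) = qform (ac_vec (conic_subst b G)) v"
      by (simp add: ac_vec_conic_subst qform_conic_subst)
    then show ?thesis by (simp add: b qform_def algebra_simps)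
  qed
qed (use two_ac[OF two] lam in auto)

lemma poncelet_frame_ac:
  fixes a b :: "'k::field ^ 6"
  assumes two: "(2::'k) \<noteq> 0" and GH: "G ** H = mat 1" and HG: "H ** G = mat 1" and lam: "lam \<noteq> 0"
    and b: "conic_subst b G = vec6 0 (- lam) 0 0 lam 0"
    and a: "conic_det a \<noteq> 0"
  shows "poncelet_frame (ac_vec b) (ac_mat G) (ac_mat H) (to_ac lam) (ac_vec a)"
proof -
  interpret conic_frame "ac_vec b" "ac_mat G" "ac_mat H" "to_ac lam"
    by (rule conic_frame_ac[OF two GH HG lam b])
  show ?thesis
  proof
    fix v :: "'k alg_closure ^ 3" assume "v \<noteq> 0"
    then show "qgrad (ac_vec a) v \<noteq> 0"
      using a singular_iff_conic_det[OF two, of "ac_vec a"] by (auto simp: conic_det_ac_vec)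
  qed
qed

text \<open>The frame is defined over the base field, so the transformed conic over the closure is
  the image of \<open>conic_subst a G\<close>. The vanishing of its invariants can be tested in the
  base field, since \<open>to_ac\<close> is injective.\<close>

lemma transversal_triangle_iff:
  fixes a b :: "'k::field ^ 6"
  assumes two: "(2::'k) \<noteq> 0" and three: "(3::'k) \<noteq> 0"
    and G: "G ** H = mat 1" "H ** G = mat 1" "lam \<noteq> 0" "conic_subst b G = vec6 0 (- lam) 0 0 lam 0"
    and a: "conic_det a \<noteq> 0"
  shows "transversal (abs_proj a) (abs_proj b) \<longleftrightarrow> quart_disc (conic_subst a G) \<noteq> 0"
    and "transversal (abs_proj a) (abs_proj b) \<and> poncelet_triangle (abs_proj a) (abs_proj b) \<longleftrightarrow>
       quart_disc (conic_subst a G) \<noteq> 0 \<and> triangle_form (conic_subst a G) = 0"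
proof -
  interpret poncelet_frame "ac_vec b" "ac_mat G" "ac_mat H" "to_ac lam" "ac_vec a"
    by (rule poncelet_frame_ac[OF two G a])
  have nz: "a \<noteq> 0" "b \<noteq> 0" using a_nz b_nz by simp_all
  have a': "a' = ac_vec (conic_subst a G)" by (simp add: a'_def ac_vec_conic_subst)
  show tr: "transversal (abs_proj a) (abs_proj b) \<longleftrightarrow> quart_disc (conic_subst a G) \<noteq> 0"
    using transversal_iff[OF three_ac[OF three]]
    by (simp add: transversal_def base_change_abs nz a' quart_disc_ac_vec)
  have "poncelet_triangle (abs_proj a) (abs_proj b) \<longleftrightarrow> triangle_form (conic_subst a G) = 0"
    if "quart_disc (conic_subst a G) \<noteq> 0"
  proof -
    have "quart_disc a' \<noteq> 0" using that by (simp add: a' quart_disc_ac_vec)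
    then have "poncelet_triangle (abs_proj a) (abs_proj b) \<longleftrightarrow> triangle_form a' = 0"
      unfolding poncelet_triangle_def base_change_abs[OF nz(1)] base_change_abs[OF nz(2)]
      using triangle_form_0_if_periodic periodic_if_triangle_form_0 by blast
    then show ?thesis by (simp add: a' triangle_form_ac_vec)
  qed
  with tr show "transversal (abs_proj a) (abs_proj b) \<and> poncelet_triangle (abs_proj a) (abs_proj b) \<longleftrightarrow>
       quart_disc (conic_subst a G) \<noteq> 0 \<and> triangle_form (conic_subst a G) = 0"
    by blast
qed

section \<open>From coefficient vectors to conics and pairs of conics\<close>

lemma finite_proj: "finite (S :: ('k::{field,finite}, 'n::finite) proj set)"
proof -
  have "(UNIV :: ('k, 'n) proj set) \<subseteq> range abs_proj" by (metis UNIV_I image_iff proj_cases subsetI)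
  then show ?thesis by (meson finite finite_imageI finite_subset subset_UNIV)
qed

text \<open>Every projective point has as many representatives as there are nonzero scalars.\<close>

lemma card_nonzero_vectors:
  fixes Q :: "('k::{field,finite}, 'n::finite) proj \<Rightarrow> bool"
  shows "card {v. v \<noteq> 0 \<and> Q (abs_proj v)} = (CARD('k) - 1) * card {A. Q A}"
proof -
  define rep where "rep = (\<lambda>A :: ('k, 'n) proj. SOME v. v \<noteq> 0 \<and> A = abs_proj v)"
  have rep: "rep A \<noteq> 0 \<and> A = abs_proj (rep A)" for A
    unfolding rep_def by (rule someI_ex) (metis proj_cases)
  have "bij_betw (\<lambda>(c, A). c *s rep A) ((UNIV - {0}) \<times> {A. Q A}) {v. v \<noteq> 0 \<and> Q (abs_proj v)}"
  proof (rule bij_betwI')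
    fix x y :: "'k \<times> ('k, 'n) proj"
    assume "x \<in> (UNIV - {0}) \<times> {A. Q A}" "y \<in> (UNIV - {0}) \<times> {A. Q A}"
    moreover obtain c A d B where xy: "x = (c, A)" "y = (d, B)" by (metis surj_pair)
    ultimately have cd: "c \<noteq> 0" "d \<noteq> 0" by auto
    have "x = y" if eq: "c *s rep A = d *s rep B"
    proof -
      have "abs_proj (c *s rep A) = A" "abs_proj (d *s rep B) = B"
        using rep cd abs_proj_scale[of c "rep A"] abs_proj_scale[of d "rep B"] by auto
      then have "A = B" using eq by simp
      moreover have "c = d" using eq rep[of A] unfolding \<open>A = B\<close> by simp
      ultimately show ?thesis by (simp add: xy)
    qed
    then show "((case x of (c, A) \<Rightarrow> c *s rep A) = (case y of (c, A) \<Rightarrow> c *s rep A)) = (x = y)"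
      by (auto simp: xy)
  next
    fix x :: "'k \<times> ('k, 'n) proj"
    assume "x \<in> (UNIV - {0}) \<times> {A. Q A}"
    then show "(case x of (c, A) \<Rightarrow> c *s rep A) \<in> {v. v \<noteq> 0 \<and> Q (abs_proj v)}"
      using rep abs_proj_scale[of "fst x" "rep (snd x)"] by auto
  next
    fix v assume v: "v \<in> {v. v \<noteq> 0 \<and> Q (abs_proj v)}"
    then obtain c where "c \<noteq> 0" "v = c *s rep (abs_proj v)"
      using abs_proj_eq_iff[of "rep (abs_proj v)" v] rep[of "abs_proj v"] by auto
    then show "\<exists>x \<in> (UNIV - {0}) \<times> {A. Q A}. v = (case x of (c, A) \<Rightarrow> c *s rep A)"
      using v by (intro bexI[of _ "(c, abs_proj v)"]) auto
  qed
  from bij_betw_same_card[OF this] show ?thesis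
    by (simp add: card_cartesian_product card_Diff_singleton)
qed

lemma card_conic_subst:
  fixes P :: "'k::{field,finite} ^ 6 \<Rightarrow> bool"
  assumes "G ** H = mat 1" "H ** G = mat 1"
  shows "card {a. P (conic_subst a G)} = card {a. P a}"
  by (rule card_Collect_bij[of _ _ "\<lambda>a. conic_subst a G" "\<lambda>a. conic_subst a H"])
    (simp_all add: conic_subst_assoc assms)

context finite_field_count
begin

lemma q_gt_1: "q > 1"
proof -
  have "card {0, 1 :: 'k} \<le> CARD('k)" by (rule card_mono) auto
  then show ?thesis by (simp add: q)
qed

lemma int_card_conics:
  fixes Q :: "'k conic \<Rightarrow> bool"
  assumes P: "\<And>a. a \<noteq> 0 \<Longrightarrow> Q (abs_proj a) \<longleftrightarrow> P a" and P0: "\<not> P 0"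
    and n: "int (card {a. P a}) = (q - 1) * n"
  shows "int (card {A. Q A}) = n"
proof -
  have "a \<noteq> 0 \<and> Q (abs_proj a) \<longleftrightarrow> P a" for a
    using P[of a] P0 by (cases "a = 0") auto
  then have "{a. a \<noteq> 0 \<and> Q (abs_proj a)} = {a. P a}" by (rule Collect_cong)
  then have "int ((CARD('k) - 1) * card {A. Q A}) = (q - 1) * n"
    using card_nonzero_vectors[of Q] n by simp
  moreover have "int (CARD('k) - 1) = q - 1" using q_gt_1 by (simp add: q of_nat_diff)
  ultimately have "(q - 1) * int (card {A. Q A}) = (q - 1) * n" by simp
  then show ?thesis using q_gt_1 by simp
qed

lemma card_smooth_conics: "int (card {B :: 'k conic. smooth_conic B}) = q^5 - q^2"
proof (rule int_card_conics[where P = "\<lambda>b. conic_det b \<noteq> 0"])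
  show "smooth_conic (abs_proj b) \<longleftrightarrow> conic_det b \<noteq> 0" if "b \<noteq> 0" for b :: "'k ^ 6"
    using smooth_conic_abs_iff[OF two that] .
qed (simp_all add: card_smooth)

text \<open>In a frame for \<open>B\<close> the conditions on \<open>A\<close> concern
  \<open>conic_subst a G\<close> alone. Substitution permutes all forms, so the fibre has the same
  size for every smooth \<open>B\<close>.\<close>

lemma card_fibre:
  fixes B :: "'k conic"
  assumes "smooth_conic B"
  shows "int (card {A. (A, B) \<in> \<Psi>}) = (q + 1) * q * (q - 1) * (q^2 - q + 1)"
    and "int (card {A. (A, B) \<in> \<Gamma>\<^sub>3}) = (q + 1) * q * (q - 1)^2"
proof -
  obtain b where b: "b \<noteq> 0" "B = abs_proj b" by (cases B)
  then have "conic_det b \<noteq> 0" using assms smooth_conic_abs_iff[OF two] by blast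
  then obtain G H lam where G: "G ** H = mat 1" "H ** G = mat 1" "lam \<noteq> 0"
      "conic_subst b G = vec6 0 (- lam) 0 0 lam 0"
    using ex_conic_frame[OF two] by metis
  note det = conic_det_subst_iff[OF two G(1,2)]
  note tt = transversal_triangle_iff[OF two three G]
  let ?P = "\<lambda>a :: 'k ^ 6. conic_det a \<noteq> 0 \<and> quart_disc a \<noteq> 0"
  let ?Q = "\<lambda>a :: 'k ^ 6. conic_det a \<noteq> 0 \<and> quart_disc a \<noteq> 0 \<and> triangle_form a = 0"
  show "int (card {A. (A, B) \<in> \<Psi>}) = (q + 1) * q * (q - 1) * (q^2 - q + 1)"
  proof (rule int_card_conics[where P = "\<lambda>a. ?P (conic_subst a G)"])
    show "(abs_proj a, B) \<in> \<Psi> \<longleftrightarrow> ?P (conic_subst a G)" if "a \<noteq> 0" for a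
      using that tt(1)[of a] assms smooth_conic_abs_iff[OF two that] by (auto simp: \<Psi>_def det b(2))
    show "int (card {a. ?P (conic_subst a G)}) = (q - 1) * ((q + 1) * q * (q - 1) * (q^2 - q + 1))"
      unfolding card_conic_subst[OF G(1,2), of ?P] by (rule card_smooth_transversal)
  qed simp
  show "int (card {A. (A, B) \<in> \<Gamma>\<^sub>3}) = (q + 1) * q * (q - 1)^2"
  proof (rule int_card_conics[where P = "\<lambda>a. ?Q (conic_subst a G)"])
    show "(abs_proj a, B) \<in> \<Gamma>\<^sub>3 \<longleftrightarrow> ?Q (conic_subst a G)" if "a \<noteq> 0" for a
      using that tt(2)[of a] assms smooth_conic_abs_iff[OF two that]
      by (auto simp: \<Gamma>\<^sub>3_def \<Psi>_def det b(2))
    show "int (card {a. ?Q (conic_subst a G)}) = (q - 1) * ((q + 1) * q * (q - 1)^2)"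
      unfolding card_conic_subst[OF G(1,2), of ?Q] by (rule card_smooth_transversal_triangle)
  qed simp
qed

lemma card_pairs:
  fixes S :: "('k conic \<times> 'k conic) set"
  assumes S: "S \<subseteq> \<Psi>" and n: "\<And>B. smooth_conic B \<Longrightarrow> int (card {A. (A, B) \<in> S}) = n"
  shows "int (card S) = (q^5 - q^2) * n"
proof -
  let ?T = "SIGMA B:{B. smooth_conic B}. {A. (A, B) \<in> S}"
  have "S = prod.swap ` ?T" using S by (force simp: \<Psi>_def image_iff)
  then have "card S = card (prod.swap ` ?T)" by (rule arg_cong)
  also have "\<dots> = card ?T" by (rule card_image) (auto simp: inj_on_def)
  also have "\<dots> = (\<Sum>B | smooth_conic B. card {A. (A, B) \<in> S})"
    by (rule card_SigmaI) (auto simp: finite_proj)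
  finally have "int (card S) = (\<Sum>B | smooth_conic B. int (card {A. (A, B) \<in> S}))" by simp
  also have "\<dots> = (\<Sum>B | smooth_conic (B :: 'k conic). n)" by (rule sum.cong) (auto simp: n)
  finally show ?thesis by (simp add: card_smooth_conics)
qed

lemma card_\<Psi>: "int (card (\<Psi> :: ('k conic \<times> 'k conic) set)) = (q^5 - q^2) * ((q + 1) * q * (q - 1) * (q^2 - q + 1))"
  by (rule card_pairs[OF subset_refl card_fibre(1)])

lemma card_\<Gamma>\<^sub>3: "int (card (\<Gamma>\<^sub>3 :: ('k conic \<times> 'k conic) set)) = (q^5 - q^2) * ((q + 1) * q * (q - 1)^2)"
proof (rule card_pairs[OF _ card_fibre(2)])
  show "(\<Gamma>\<^sub>3 :: ('k conic \<times> 'k conic) set) \<subseteq> \<Psi>" by (auto simp: \<Gamma>\<^sub>3_def)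
qed

end

theorem theorem1p3:
  fixes q :: nat
  assumes "q = CARD('k::{field, finite})"
    and "CHAR('k) > 3"
  shows "int (card (\<Gamma>\<^sub>3 :: ('k conic \<times> 'k conic) set)) =
           (int q ^ 5 - int q ^ 2) * (int q + 1) * int q * (int q - 1) ^ 2 \<and>
         real (card (\<Gamma>\<^sub>3 :: ('k conic \<times> 'k conic) set)) /
           real (card (\<Psi> :: ('k conic \<times> 'k conic) set)) =
           (real q - 1) / (real q ^ 2 - real q + 1)"
proof -
  have "(of_nat n :: 'k) \<noteq> 0" if "0 < n" "n \<le> 3" for n
  proof
    assume "(of_nat n :: 'k) = 0"
    then have "CHAR('k) dvd n" by (rule of_nat_eq_0_iff_char_dvd[THEN iffD1])
    then show False using that assms(2) dvd_imp_le[of "CHAR('k)" n] by linarith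
  qed
  from this[of 2] this[of 3] have "(2::'k) \<noteq> 0" "(3::'k) \<noteq> 0" by simp_all
  then interpret finite_field_count "TYPE('k)" "int q"
    by unfold_locales (simp_all add: assms(1))
  let ?x = "real q"
  have x: "?x > 1" using q_gt_1 by simp
  have G: "real (card (\<Gamma>\<^sub>3 :: ('k conic \<times> 'k conic) set)) = (?x^5 - ?x^2) * ((?x + 1) * ?x * (?x - 1)^2)"
    using arg_cong[OF card_\<Gamma>\<^sub>3, of real_of_int] by simp
  have P: "real (card (\<Psi> :: ('k conic \<times> 'k conic) set)) = (?x^5 - ?x^2) * ((?x + 1) * ?x * (?x - 1) * (?x^2 - ?x + 1))"
    using arg_cong[OF card_\<Psi>, of real_of_int] by simp
  \<comment> \<open>The common factor of both cardinalities has to be nonzero before it is cancelled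
    from the quotient.\<close>
  have "?x^2 < ?x^5" using x by (intro power_strict_increasing) auto
  then have "(?x^5 - ?x^2) * ((?x + 1) * ?x * (?x - 1)) \<noteq> 0" (is "?c \<noteq> 0") using x by simp
  moreover have "(?x^5 - ?x^2) * ((?x + 1) * ?x * (?x - 1)^2) = ?c * (?x - 1)"
    "(?x^5 - ?x^2) * ((?x + 1) * ?x * (?x - 1) * (?x^2 - ?x + 1)) = ?c * (?x^2 - ?x + 1)"
    by (simp_all add: power2_eq_square)
  ultimately have "real (card (\<Gamma>\<^sub>3 :: ('k conic \<times> 'k conic) set)) / real (card (\<Psi> :: ('k conic \<times> 'k conic) set))
      = (?x - 1) / (?x^2 - ?x + 1)"
    unfolding G P by simp
  then show ?thesis using card_\<Gamma>\<^sub>3 by (simp add: mult.assoc)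
qed

end
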